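(* The pruning distance $d_P$ is a distance on pointwise finite-dimensional (pfd) modules; that is, for all pfd modules $M,N,Q$: $d_P(M,M)=0$, $d_P(M,N)=d_P(N,M)$, and $d_P(M,Q)\le d_P(M,N)+d_P(N,Q)$.
   Context: Fix a field $k$. $\mathbb{P}$ is a poset (regarded as a category) equipped with functions $\mathbb{P}_\epsilon\colon\mathbb{P}\to\mathbb{P}$ for all $\epsilon\in\mathbb{R}$ such that $\mathbb{P}_0=\mathrm{id}$; $p\le q$ implies $\mathbb{P}_\epsilon(p)\le\mathbb{P}_\epsilon(q)$; $\mathbb{P}_\epsilon(p)\ge p$ for $\epsilon\ge0$; and $\mathbb{P}_{\epsilon+\delta}=\mathbb{P}_\epsilon\circ\mathbb{P}_\delta$. A module is a functor $M\colon\mathbb{P}\to\mathbf{Vec}_k$, with vector spaces $M_p$ and maps $M_{p\to q}$ for $p\le q$; morphisms are natural transformations. $M$ is pfd if every $M_p$ is finite-dimensional. The shift $M(\epsilon)$ is given by $M(\epsilon)_p=M_{\mathbb{P}_\epsilon(p)}$, $M(\epsilon)_{p\to q}=M_{\mathbb{P}_\epsilon(p)\to\mathbb{P}_\epsilon(q)}$. For $\epsilon\le\delta$, $M_{\epsilon\to\delta}\colon M(\epsilon)\to M(\delta)$ is the morphism with $(M_{\epsilon\to\delta})_p=M_{\mathbb{P}_\epsilon(p)\to\mathbb{P}_\delta(p)}$. Pruning: for $\epsilon\ge0$, let $I$ be the largest submodule of $M$ such that $f(I)\subseteq M_{0\to2\epsilon}(I)$ for every morphism $f\colon M\to M(2\epsilon)$.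 Let $K$ be the smallest submodule of $I$ such that $I_{0\to2\epsilon}^{-1}(f(K))\subseteq K$ for every morphism $f\colon M\to M(2\epsilon)$ (here $I_{0\to2\epsilon}^{-1}(f(K))$ is the submodule of those $x\in I$ with $M_{0\to2\epsilon}(x)\in f(K)$). These exist, and the $\epsilon$-pruning of $M$ is $\mathrm{Pru}_\epsilon(M)=(I/K)(-\epsilon)$. $N$ is a subquotient of $M$ if there are a module $M'$, a monomorphism $M'\hookrightarrow M$ and an epimorphism $M'\twoheadrightarrow N$. If $M\cong\bigoplus_{i\in\Lambda}M_i$ is pfd with each $M_i$ indecomposable (such a decomposition exists and is essentially unique), an $\infty$-refinement of $M$ is a module isomorphic to $\bigoplus_{i\in\Lambda}N_i$ with each $N_i$ a subquotient of $M_i$. For pfd modules $M,N$, $d_P(M,N)\in[0,\infty]$ is the infimum (with $\inf\emptyset=\infty$) of all $\epsilon\ge0$ such that for all $\delta\ge0$, $\mathrm{Pru}_{\epsilon+\delta}(M)$ is an $\infty$-refinement of $\mathrm{Pru}_\delta(N)$ and $\mathrm{Pru}_{\epsilon+\delta}(N)$ is an $\infty$-refinement of $\mathrm{Pru}_\delta(M)$. *)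

theory Defs
  imports
    "Jordan_Normal_Form.Missing_VectorSpace"
    "HOL-Algebra.AbelCoset"
    "HOL-Library.Extended_Nonnegative_Real"
begin

locale shifted_poset =
  fixes sh :: "real \<Rightarrow> 'p::order \<Rightarrow> 'p"
  assumes sh_zero: "sh 0 = id"
    and sh_mono: "p \<le> q \<Longrightarrow> sh \<epsilon> p \<le> sh \<epsilon> q"
    and sh_ge: "0 \<le> \<epsilon> \<Longrightarrow> p \<le> sh \<epsilon> p"
    and sh_add: "sh (\<epsilon> + \<delta>) = sh \<epsilon> \<circ> sh \<delta>"


section \<open>Modules over a poset\<close>

text \<open>
  \<open>Sp M p\<close> is the vector space at \<open>p\<close>, with carrier a subset of \<open>'v\<close>; \<open>Mp M p q\<close> is the
  structure map, which is meaningful only for \<open>p \<le> q\<close> and on the carrier of \<open>Sp M p\<close>.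
\<close>

record ('p, 'k, 'v) pmod =
  Sp :: "'p \<Rightarrow> ('k, 'v) module"
  Mp :: "'p \<Rightarrow> 'p \<Rightarrow> 'v \<Rightarrow> 'v"

locale pmodule =
  fixes K :: "('k, 'e) ring_scheme" and M :: "('p::order, 'k, 'v) pmod"
  assumes vectorspace_Sp: "vectorspace K (Sp M p)"
    and linear_Mp: "p \<le> q \<Longrightarrow> linear_map K (Sp M p) (Sp M q) (Mp M p q)"
    and Mp_refl: "v \<in> carrier (Sp M p) \<Longrightarrow> Mp M p p v = v"
    and Mp_trans: "p \<le> q \<Longrightarrow> q \<le> r \<Longrightarrow> v \<in> carrier (Sp M p) \<Longrightarrow>
      Mp M q r (Mp M p q v) = Mp M p r v"

definition pfd :: "('k, 'e) ring_scheme \<Rightarrow> ('p::order, 'k, 'v) pmod \<Rightarrow> bool" where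
  "pfd K M \<longleftrightarrow> pmodule K M \<and> (\<forall>p. vectorspace.fin_dim K (Sp M p))"

definition pmod_hom ::
  "('k, 'e) ring_scheme \<Rightarrow> ('p::order, 'k, 'v) pmod \<Rightarrow> ('p, 'k, 'w) pmod \<Rightarrow> ('p \<Rightarrow> 'v \<Rightarrow> 'w) set" where
  "pmod_hom K M N = {f. (\<forall>p. linear_map K (Sp M p) (Sp N p) (f p)) \<and>
     (\<forall>p q. p \<le> q \<longrightarrow> (\<forall>v\<in>carrier (Sp M p). f q (Mp M p q v) = Mp N p q (f p v)))}"

definition pmod_mono ::
  "('k, 'e) ring_scheme \<Rightarrow> ('p::order, 'k, 'v) pmod \<Rightarrow> ('p, 'k, 'w) pmod \<Rightarrow> ('p \<Rightarrow> 'v \<Rightarrow> 'w) set" where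
  "pmod_mono K M N = {f \<in> pmod_hom K M N. \<forall>p. inj_on (f p) (carrier (Sp M p))}"

definition pmod_epi ::
  "('k, 'e) ring_scheme \<Rightarrow> ('p::order, 'k, 'v) pmod \<Rightarrow> ('p, 'k, 'w) pmod \<Rightarrow> ('p \<Rightarrow> 'v \<Rightarrow> 'w) set" where
  "pmod_epi K M N = {f \<in> pmod_hom K M N. \<forall>p. f p ` carrier (Sp M p) = carrier (Sp N p)}"

definition pmod_isomorphic ::
  "('k, 'e) ring_scheme \<Rightarrow> ('p::order, 'k, 'v) pmod \<Rightarrow> ('p, 'k, 'w) pmod \<Rightarrow> bool" where
  "pmod_isomorphic K M N \<longleftrightarrow>
     (\<exists>f \<in> pmod_hom K M N. \<forall>p. bij_betw (f p) (carrier (Sp M p)) (carrier (Sp N p)))"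

text \<open>The shift \<open>M(\<epsilon>)\<close> and the morphism \<open>M(\<epsilon>) \<rightarrow> M(\<delta>)\<close> for \<open>\<epsilon> \<le> \<delta>\<close>.\<close>

definition pmod_shift ::
  "(real \<Rightarrow> 'p \<Rightarrow> 'p) \<Rightarrow> real \<Rightarrow> ('p, 'k, 'v) pmod \<Rightarrow> ('p, 'k, 'v) pmod" where
  "pmod_shift sh \<epsilon> M =
     \<lparr>Sp = \<lambda>p. Sp M (sh \<epsilon> p), Mp = \<lambda>p q. Mp M (sh \<epsilon> p) (sh \<epsilon> q)\<rparr>"

definition pmod_shift_map ::
  "(real \<Rightarrow> 'p \<Rightarrow> 'p) \<Rightarrow> ('p, 'k, 'v) pmod \<Rightarrow> real \<Rightarrow> real \<Rightarrow> 'p \<Rightarrow> 'v \<Rightarrow> 'v" where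
  "pmod_shift_map sh M \<epsilon> \<delta> p = Mp M (sh \<epsilon> p) (sh \<delta> p)"


section \<open>Submodules, quotients and direct sums\<close>

text \<open>A submodule is represented by its family of carriers.\<close>

definition psubmodule ::
  "('k, 'e) ring_scheme \<Rightarrow> ('p::order \<Rightarrow> 'v set) \<Rightarrow> ('p, 'k, 'v) pmod \<Rightarrow> bool" where
  "psubmodule K J M \<longleftrightarrow> (\<forall>p. VectorSpace.subspace K (J p) (Sp M p)) \<and>
     (\<forall>p q. p \<le> q \<longrightarrow> Mp M p q ` J p \<subseteq> J q)"

definition pmod_sub :: "('p, 'k, 'v) pmod \<Rightarrow> ('p \<Rightarrow> 'v set) \<Rightarrow> ('p, 'k, 'v) pmod" where
  "pmod_sub M J = \<lparr>Sp = \<lambda>p. (Sp M p)\<lparr>carrier := J p\<rparr>, Mp = Mp M\<rparr>"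

text \<open>
  The elements of a quotient space are the cosets. The ring fields \<open>mult\<close> and \<open>one\<close>
  of the record play no role for a vector space.
\<close>

definition vs_quot :: "('k, 'v) module \<Rightarrow> 'v set \<Rightarrow> ('k, 'v set) module" where
  "vs_quot V W =
     \<lparr>carrier = a_rcosets\<^bsub>V\<^esub> W,
      mult = undefined, one = undefined,
      zero = W,
      add = (\<lambda>X Y. X <+>\<^bsub>V\<^esub> Y),
      smult = (\<lambda>a X. \<Union>x\<in>X. W +>\<^bsub>V\<^esub> (a \<odot>\<^bsub>V\<^esub> x))\<rparr>"

definition pmod_quot :: "('p, 'k, 'v) pmod \<Rightarrow> ('p \<Rightarrow> 'v set) \<Rightarrow> ('p, 'k, 'v set) pmod" where
  "pmod_quot M J =
     \<lparr>Sp = \<lambda>p. vs_quot (Sp M p) (J p),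
      Mp = \<lambda>p q X. \<Union>x\<in>X. J q +>\<^bsub>Sp M q\<^esub> Mp M p q x\<rparr>"

definition pmod_dsum :: "'i set \<Rightarrow> ('i \<Rightarrow> ('p, 'k, 'v) pmod) \<Rightarrow> ('p, 'k, 'i \<Rightarrow> 'v) pmod" where
  "pmod_dsum \<Lambda> N =
     \<lparr>Sp = \<lambda>p.
        \<lparr>carrier = {x \<in> \<Pi>\<^sub>E i\<in>\<Lambda>. carrier (Sp (N i) p). finite {i \<in> \<Lambda>. x i \<noteq> \<zero>\<^bsub>Sp (N i) p\<^esub>}},
         mult = undefined, one = undefined,
         zero = (\<lambda>i\<in>\<Lambda>. \<zero>\<^bsub>Sp (N i) p\<^esub>),
         add = (\<lambda>x y. \<lambda>i\<in>\<Lambda>. x i \<oplus>\<^bsub>Sp (N i) p\<^esub> y i),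
         smult = (\<lambda>a x. \<lambda>i\<in>\<Lambda>. a \<odot>\<^bsub>Sp (N i) p\<^esub> x i)\<rparr>,
      Mp = \<lambda>p q x. \<lambda>i\<in>\<Lambda>. Mp (N i) p q (x i)\<rparr>"

definition indecomposable :: "('k, 'e) ring_scheme \<Rightarrow> ('p::order, 'k, 'v) pmod \<Rightarrow> bool" where
  "indecomposable K M \<longleftrightarrow>
     pmodule K M \<and> (\<exists>p. carrier (Sp M p) \<noteq> {\<zero>\<^bsub>Sp M p\<^esub>}) \<and>
     (\<forall>A B. psubmodule K A M \<and> psubmodule K B M \<and>
        (\<forall>p. A p \<inter> B p = {\<zero>\<^bsub>Sp M p\<^esub>} \<and> A p <+>\<^bsub>Sp M p\<^esub> B p = carrier (Sp M p)) \<longrightarrow>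
        (\<forall>p. A p = {\<zero>\<^bsub>Sp M p\<^esub>}) \<or> (\<forall>p. B p = {\<zero>\<^bsub>Sp M p\<^esub>}))"


section \<open>Pruning\<close>

text \<open>Submodules are compared by pointwise inclusion, the order on \<open>'p \<Rightarrow> 'v set\<close>.\<close>

definition prune_sub ::
  "('k, 'e) ring_scheme \<Rightarrow> (real \<Rightarrow> 'p::order \<Rightarrow> 'p) \<Rightarrow> real \<Rightarrow> ('p, 'k, 'v) pmod \<Rightarrow> 'p \<Rightarrow> 'v set" where
  "prune_sub K sh \<epsilon> M =
     (GREATEST I. psubmodule K I M \<and>
        (\<forall>f \<in> pmod_hom K M (pmod_shift sh (2 * \<epsilon>) M). \<forall>p.
           f p ` I p \<subseteq> pmod_shift_map sh M 0 (2 * \<epsilon>) p ` I p))"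

definition prune_ker ::
  "('k, 'e) ring_scheme \<Rightarrow> (real \<Rightarrow> 'p::order \<Rightarrow> 'p) \<Rightarrow> real \<Rightarrow> ('p, 'k, 'v) pmod \<Rightarrow> 'p \<Rightarrow> 'v set" where
  "prune_ker K sh \<epsilon> M = (let I = prune_sub K sh \<epsilon> M in
     (LEAST L. psubmodule K L (pmod_sub M I) \<and>
        (\<forall>f \<in> pmod_hom K M (pmod_shift sh (2 * \<epsilon>) M). \<forall>p.
           {x \<in> I p. pmod_shift_map sh M 0 (2 * \<epsilon>) p x \<in> f p ` L p} \<subseteq> L p)))"

definition Pru ::
  "('k, 'e) ring_scheme \<Rightarrow> (real \<Rightarrow> 'p::order \<Rightarrow> 'p) \<Rightarrow> real \<Rightarrow> ('p, 'k, 'v) pmod \<Rightarrow> ('p, 'k, 'v set) pmod" where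
  "Pru K sh \<epsilon> M =
     pmod_shift sh (- \<epsilon>) (pmod_quot (pmod_sub M (prune_sub K sh \<epsilon> M)) (prune_ker K sh \<epsilon> M))"


section \<open>Refinements and the pruning distance\<close>

text \<open>
  Modules with different element types \<open>'v\<close>, \<open>'w\<close> may be compared. In the next definition
  the intermediate module may be taken over \<open>'v\<close>, since it embeds in \<open>M\<close>.
\<close>

definition subquotient ::
  "('k, 'e) ring_scheme \<Rightarrow> ('p::order, 'k, 'w) pmod \<Rightarrow> ('p, 'k, 'v) pmod \<Rightarrow> bool" where
  "subquotient K N M \<longleftrightarrow> pmodule K N \<and>
     (\<exists>M' :: ('p, 'k, 'v) pmod. pmodule K M' \<and> pmod_mono K M' M \<noteq> {} \<and> pmod_epi K M' N \<noteq> {})"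

text \<open>
  \<open>R\<close> is an \<open>\<infinity>\<close>-refinement of \<open>M\<close>. The types chosen for the index set and for the summands
  are no restriction: each summand of \<open>M\<close> (resp. \<open>R\<close>) is isomorphic to a submodule of \<open>M\<close>
  (resp. \<open>R\<close>), and distinct indices of nonzero summands of \<open>M\<close> give distinct submodules,
  so that these can serve as indices.
\<close>

definition inf_refinement ::
  "('k, 'e) ring_scheme \<Rightarrow> ('p::order, 'k, 'w) pmod \<Rightarrow> ('p, 'k, 'v) pmod \<Rightarrow> bool" where
  "inf_refinement K R M \<longleftrightarrow>
     (\<exists>(\<Lambda> :: ('p \<Rightarrow> 'v set) set)
        (Ms :: ('p \<Rightarrow> 'v set) \<Rightarrow> ('p, 'k, 'v) pmod)
        (Ns :: ('p \<Rightarrow> 'v set) \<Rightarrow> ('p, 'k, 'w) pmod).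
        (\<forall>i\<in>\<Lambda>. indecomposable K (Ms i)) \<and> pmod_isomorphic K M (pmod_dsum \<Lambda> Ms) \<and>
        (\<forall>i\<in>\<Lambda>. subquotient K (Ns i) (Ms i)) \<and> pmod_isomorphic K R (pmod_dsum \<Lambda> Ns))"

definition pruning_dist ::
  "('k, 'e) ring_scheme \<Rightarrow> (real \<Rightarrow> 'p::order \<Rightarrow> 'p) \<Rightarrow>
   ('p, 'k, 'v) pmod \<Rightarrow> ('p, 'k, 'w) pmod \<Rightarrow> ennreal" where
  "pruning_dist K sh M N =
     (INF \<epsilon> \<in> {\<epsilon>. 0 \<le> \<epsilon> \<and> (\<forall>\<delta>\<ge>0.
          inf_refinement K (Pru K sh (\<epsilon> + \<delta>) M) (Pru K sh \<delta> N) \<and>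
          inf_refinement K (Pru K sh (\<epsilon> + \<delta>) N) (Pru K sh \<delta> M))}. ennreal \<epsilon>)"

end

theory Submission
  imports Defs
begin

text \<open>
Symmetry of the pruning distance is built into its definition, so two things have to be shown: that
a pointwise finite-dimensional (pfd) module is an \<open>\<infinity>\<close>-refinement of itself, which puts \<open>\<epsilon> = 0\<close>
into the set defining the distance of \<open>M\<close> to itself, and that \<open>\<infinity>\<close>-refinement is transitive when
the middle module is pfd. The triangle inequality then follows by inserting \<open>Pru (\<epsilon>\<^sub>2 + \<delta>) N\<close> between
\<open>Pru (\<epsilon>\<^sub>1 + \<epsilon>\<^sub>2 + \<delta>) M\<close> and \<open>Pru \<delta> Q\<close>, and symmetrically. Prunings of pfd modules are pfd, being shifts of
subquotients (\<open>pfd_Pru\<close>).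

Reflexivity is the existence of a decomposition into indecomposables
(\<open>decomposition_into_indecomposables\<close>). By Zorn's lemma there is a maximal set of pairwise commuting
idempotent endomorphisms. Commuting idempotents on finite-dimensional spaces are simultaneously
diagonalizable, so the module is the direct sum of the joint eigenmodules; a further splitting of one
of them would give a new idempotent that commutes with all the others, against maximality.

For transitivity, let \<open>R\<close> refine \<open>S\<close> and let \<open>S\<close> refine \<open>T\<close>. The two refinements see \<open>S\<close> through two
decompositions: a sum of subquotients \<open>S\<^sub>i\<close> of the indecomposable summands \<open>T\<^sub>i\<close> of \<open>T\<close>, and a sum of
indecomposables \<open>S'\<^sub>j\<close> with a chosen subquotient \<open>R\<^sub>j\<close> of each. Decomposing each \<open>S\<^sub>i\<close> further and applying
the Krull--Schmidt theorem (\<open>krull_schmidt\<close>) distributes the \<open>S'\<^sub>j\<close> among the \<open>S\<^sub>i\<close>. The sum of those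
\<open>R\<^sub>j\<close> that go to a given \<open>i\<close> is then a subquotient of \<open>S\<^sub>i\<close>, and hence of \<open>T\<^sub>i\<close>.

The Krull--Schmidt theorem rests on Fitting's lemma: an endomorphism of an indecomposable pfd module
is either injective or pointwise nilpotent (\<open>fitting\<close>), so the endomorphism ring is local. A nonzero
indecomposable can be a summand only finitely often, because it is nonzero at some point \<open>p\<close> and the
space at \<open>p\<close> is finite-dimensional; the equality of the two multiplicities is proved by a dimension
count at such a \<open>p\<close> (\<open>multiplicity_le\<close>), where Nakayama's lemma for the local endomorphism ring shows
that the part of the module belonging to the first decomposition maps injectively to the part
belonging to the second.
\<close>

locale over_field =
  fixes K :: "('k, 'e) ring_scheme"
  assumes field_K: "field K"
begin

section \<open>Linear algebra with carriers\<close>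

lemma vs_closed [simp]:
  assumes "vectorspace K V"
  shows "\<zero>\<^bsub>V\<^esub> \<in> carrier V"
    and "x \<in> carrier V ==> y \<in> carrier V ==> x \<oplus>\<^bsub>V\<^esub> y \<in> carrier V"
    and "x \<in> carrier V ==> y \<in> carrier V ==> x \<ominus>\<^bsub>V\<^esub> y \<in> carrier V"
    and "c \<in> carrier K ==> x \<in> carrier V ==> c \<odot>\<^bsub>V\<^esub> x \<in> carrier V"
proof -
  interpret V: vectorspace K V by fact
  show "\<zero>\<^bsub>V\<^esub> \<in> carrier V" by simp
  show "x \<in> carrier V ==> y \<in> carrier V ==> x \<oplus>\<^bsub>V\<^esub> y \<in> carrier V" by simp
  show "x \<in> carrier V ==> y \<in> carrier V ==> x \<ominus>\<^bsub>V\<^esub> y \<in> carrier V" by simp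
  show "c \<in> carrier K ==> x \<in> carrier V ==> c \<odot>\<^bsub>V\<^esub> x \<in> carrier V" by simp
qed

lemma vs_simps [simp]:
  assumes "vectorspace K V"
  shows "x \<in> carrier V ==> x \<oplus>\<^bsub>V\<^esub> \<zero>\<^bsub>V\<^esub> = x"
    and "x \<in> carrier V ==> \<zero>\<^bsub>V\<^esub> \<oplus>\<^bsub>V\<^esub> x = x"
    and "x \<in> carrier V ==> x \<ominus>\<^bsub>V\<^esub> x = \<zero>\<^bsub>V\<^esub>"
    and "x \<in> carrier V ==> x \<ominus>\<^bsub>V\<^esub> \<zero>\<^bsub>V\<^esub> = x"
    and "c \<in> carrier K ==> c \<odot>\<^bsub>V\<^esub> \<zero>\<^bsub>V\<^esub> = \<zero>\<^bsub>V\<^esub>"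
    and "x \<in> carrier V ==> y \<in> carrier V ==> (x \<ominus>\<^bsub>V\<^esub> y) \<oplus>\<^bsub>V\<^esub> y = x"
    and "x \<in> carrier V ==> y \<in> carrier V ==> y \<oplus>\<^bsub>V\<^esub> (x \<ominus>\<^bsub>V\<^esub> y) = x"
    and "x \<in> carrier V ==> y \<in> carrier V ==> (x \<oplus>\<^bsub>V\<^esub> y) \<ominus>\<^bsub>V\<^esub> y = x"
    and "x \<in> carrier V ==> y \<in> carrier V ==> (x \<oplus>\<^bsub>V\<^esub> y) \<ominus>\<^bsub>V\<^esub> x = y"
    and "x \<in> carrier V ==> y \<in> carrier V ==> (x \<ominus>\<^bsub>V\<^esub> y = \<zero>\<^bsub>V\<^esub>) = (x = y)"
proof -
  interpret V: vectorspace K V by fact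
  show "x \<in> carrier V ==> x \<oplus>\<^bsub>V\<^esub> \<zero>\<^bsub>V\<^esub> = x" by simp
  show "x \<in> carrier V ==> \<zero>\<^bsub>V\<^esub> \<oplus>\<^bsub>V\<^esub> x = x" by simp
  show "x \<in> carrier V ==> x \<ominus>\<^bsub>V\<^esub> x = \<zero>\<^bsub>V\<^esub>" by (simp add: V.M.r_neg a_minus_def)
  show "x \<in> carrier V ==> x \<ominus>\<^bsub>V\<^esub> \<zero>\<^bsub>V\<^esub> = x" by (simp add: a_minus_def)
  show "c \<in> carrier K ==> c \<odot>\<^bsub>V\<^esub> \<zero>\<^bsub>V\<^esub> = \<zero>\<^bsub>V\<^esub>" by simp
  show 6: "x \<in> carrier V ==> y \<in> carrier V ==> (x \<ominus>\<^bsub>V\<^esub> y) \<oplus>\<^bsub>V\<^esub> y = x"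
    by (simp add: a_minus_def V.M.a_assoc V.M.l_neg)
  then show "x \<in> carrier V ==> y \<in> carrier V ==> y \<oplus>\<^bsub>V\<^esub> (x \<ominus>\<^bsub>V\<^esub> y) = x"
    by (simp add: V.M.a_comm)
  show 8: "x \<in> carrier V ==> y \<in> carrier V ==> (x \<oplus>\<^bsub>V\<^esub> y) \<ominus>\<^bsub>V\<^esub> y = x" for x y
    by (simp add: a_minus_def V.M.a_assoc V.M.r_neg)
  from 8[of y x] show "x \<in> carrier V ==> y \<in> carrier V ==> (x \<oplus>\<^bsub>V\<^esub> y) \<ominus>\<^bsub>V\<^esub> x = y"
    by (simp add: V.M.a_comm)
  show "x \<in> carrier V ==> y \<in> carrier V ==> (x \<ominus>\<^bsub>V\<^esub> y = \<zero>\<^bsub>V\<^esub>) = (x = y)"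
    by (metis 6 V.M.l_zero V.M.r_neg a_minus_def)
qed

abbreviation subsp :: "'v set => ('k, 'v, 'x) module_scheme => bool" where
  "subsp W V \<equiv> VectorSpace.subspace K W V"

lemma subspaceI:
  assumes "vectorspace K V" "W \<subseteq> carrier V" "\<zero>\<^bsub>V\<^esub> \<in> W"
    and "\<And>x y. x \<in> W ==> y \<in> W ==> x \<oplus>\<^bsub>V\<^esub> y \<in> W"
    and "\<And>c x. c \<in> carrier K ==> x \<in> W ==> c \<odot>\<^bsub>V\<^esub> x \<in> W"
  shows "subsp W V"
  using assms by (auto simp: VectorSpace.subspace_def LinearCombinations.submodule_def vectorspace_def)

lemma subspaceD:
  assumes "subsp W V"
  shows "vectorspace K V" "W \<subseteq> carrier V" "\<zero>\<^bsub>V\<^esub> \<in> W" "x \<in> W ==> x \<in> carrier V"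
    and "x \<in> W ==> y \<in> W ==> x \<oplus>\<^bsub>V\<^esub> y \<in> W"
    and "c \<in> carrier K ==> x \<in> W ==> c \<odot>\<^bsub>V\<^esub> x \<in> W"
  using assms by (auto simp: VectorSpace.subspace_def LinearCombinations.submodule_def)

lemma minus_eq_add_smult:
  assumes "vectorspace K V" "x \<in> carrier V" "y \<in> carrier V"
  shows "x \<ominus>\<^bsub>V\<^esub> y = x \<oplus>\<^bsub>V\<^esub> (\<ominus>\<^bsub>K\<^esub> \<one>\<^bsub>K\<^esub>) \<odot>\<^bsub>V\<^esub> y" and "\<ominus>\<^bsub>K\<^esub> \<one>\<^bsub>K\<^esub> \<in> carrier K"
proof -
  interpret V: vectorspace K V by fact
  show "x \<ominus>\<^bsub>V\<^esub> y = x \<oplus>\<^bsub>V\<^esub> (\<ominus>\<^bsub>K\<^esub> \<one>\<^bsub>K\<^esub>) \<odot>\<^bsub>V\<^esub> y"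
    using assms by (simp add: a_minus_def V.smult_minus_1)
  show "\<ominus>\<^bsub>K\<^esub> \<one>\<^bsub>K\<^esub> \<in> carrier K" by simp
qed

lemma vectorspace_sub:
  "subsp W V ==> vectorspace K (V\<lparr>carrier := W\<rparr>)"
  using vectorspace.subspace_is_vs subspaceD(1) by blast

lemma linear_mapI:
  assumes "vectorspace K V" "vectorspace K W"
    and "\<And>x. x \<in> carrier V ==> f x \<in> carrier W"
    and "\<And>x y. x \<in> carrier V ==> y \<in> carrier V ==> f (x \<oplus>\<^bsub>V\<^esub> y) = f x \<oplus>\<^bsub>W\<^esub> f y"
    and "\<And>c x. c \<in> carrier K ==> x \<in> carrier V ==> f (c \<odot>\<^bsub>V\<^esub> x) = c \<odot>\<^bsub>W\<^esub> f x"
  shows "linear_map K V W f"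
  using assms
  by (auto simp: linear_map_def mod_hom_def mod_hom_axioms_def LinearCombinations.module_hom_def vectorspace_def)

lemma linear_mapD:
  assumes "linear_map K V W f"
  shows "vectorspace K V" "vectorspace K W"
    and "x \<in> carrier V ==> f x \<in> carrier W"
    and "x \<in> carrier V ==> y \<in> carrier V ==> f (x \<oplus>\<^bsub>V\<^esub> y) = f x \<oplus>\<^bsub>W\<^esub> f y"
    and "c \<in> carrier K ==> x \<in> carrier V ==> f (c \<odot>\<^bsub>V\<^esub> x) = c \<odot>\<^bsub>W\<^esub> f x"
    and "f \<zero>\<^bsub>V\<^esub> = \<zero>\<^bsub>W\<^esub>"
    and "x \<in> carrier V ==> y \<in> carrier V ==> f (x \<ominus>\<^bsub>V\<^esub> y) = f x \<ominus>\<^bsub>W\<^esub> f y"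
proof -
  interpret f: linear_map K V W f by fact
  show V: "vectorspace K V" and W: "vectorspace K W" by unfold_locales
  show c: "x \<in> carrier V ==> f x \<in> carrier W" for x by simp
  show a: "x \<in> carrier V ==> y \<in> carrier V ==> f (x \<oplus>\<^bsub>V\<^esub> y) = f x \<oplus>\<^bsub>W\<^esub> f y" for x y by simp
  show s: "c \<in> carrier K ==> x \<in> carrier V ==> f (c \<odot>\<^bsub>V\<^esub> x) = c \<odot>\<^bsub>W\<^esub> f x" for c x by simp
  show "f \<zero>\<^bsub>V\<^esub> = \<zero>\<^bsub>W\<^esub>" by simp
  show "x \<in> carrier V ==> y \<in> carrier V ==> f (x \<ominus>\<^bsub>V\<^esub> y) = f x \<ominus>\<^bsub>W\<^esub> f y"
    using minus_eq_add_smult[OF V] minus_eq_add_smult[OF W] c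
    by (simp add: a s vs_closed(4)[OF V])
qed

lemma linear_inj_iff:
  assumes "linear_map K V W f"
  shows "inj_on f (carrier V) \<longleftrightarrow> (\<forall>x\<in>carrier V. f x = \<zero>\<^bsub>W\<^esub> \<longrightarrow> x = \<zero>\<^bsub>V\<^esub>)"
proof -
  note D = linear_mapD[OF assms]
  show ?thesis
  proof
    assume "inj_on f (carrier V)"
    then show "\<forall>x\<in>carrier V. f x = \<zero>\<^bsub>W\<^esub> \<longrightarrow> x = \<zero>\<^bsub>V\<^esub>"
      using D(6) vs_closed(1)[OF D(1)] by (metis inj_onD)
  next
    assume *: "\<forall>x\<in>carrier V. f x = \<zero>\<^bsub>W\<^esub> \<longrightarrow> x = \<zero>\<^bsub>V\<^esub>"
    show "inj_on f (carrier V)"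
    proof (rule inj_onI)
      fix x y assume xy: "x \<in> carrier V" "y \<in> carrier V" "f x = f y"
      then have "f (x \<ominus>\<^bsub>V\<^esub> y) = \<zero>\<^bsub>W\<^esub>" using D by simp
      then have "x \<ominus>\<^bsub>V\<^esub> y = \<zero>\<^bsub>V\<^esub>" using * xy D(1) by simp
      then show "x = y" using xy D(1) by simp
    qed
  qed
qed

lemma linear_id: "vectorspace K V ==> linear_map K V V (\<lambda>x. x)"
  by (rule linear_mapI) auto

lemma linear_zero: "vectorspace K V ==> vectorspace K W ==> linear_map K V W (\<lambda>x. \<zero>\<^bsub>W\<^esub>)"
  by (rule linear_mapI) auto

lemma linear_comp:
  assumes "linear_map K U V f" "linear_map K V W g"
  shows "linear_map K U W (\<lambda>x. g (f x))"
  using linear_mapD[OF assms(1)] linear_mapD[OF assms(2)] by (intro linear_mapI) auto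

lemma vs_add_ac:
  assumes "vectorspace K V" "x \<in> carrier V" "y \<in> carrier V" "z \<in> carrier V"
  shows "x \<oplus>\<^bsub>V\<^esub> y \<oplus>\<^bsub>V\<^esub> z = x \<oplus>\<^bsub>V\<^esub> (y \<oplus>\<^bsub>V\<^esub> z)" "x \<oplus>\<^bsub>V\<^esub> y = y \<oplus>\<^bsub>V\<^esub> x"
    "x \<oplus>\<^bsub>V\<^esub> (y \<oplus>\<^bsub>V\<^esub> z) = y \<oplus>\<^bsub>V\<^esub> (x \<oplus>\<^bsub>V\<^esub> z)"
proof -
  interpret V: vectorspace K V by fact
  show "x \<oplus>\<^bsub>V\<^esub> y \<oplus>\<^bsub>V\<^esub> z = x \<oplus>\<^bsub>V\<^esub> (y \<oplus>\<^bsub>V\<^esub> z)" "x \<oplus>\<^bsub>V\<^esub> y = y \<oplus>\<^bsub>V\<^esub> x"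
    "x \<oplus>\<^bsub>V\<^esub> (y \<oplus>\<^bsub>V\<^esub> z) = y \<oplus>\<^bsub>V\<^esub> (x \<oplus>\<^bsub>V\<^esub> z)"
    using assms(2-4) by (simp_all add: V.M.a_ac)
qed

lemma vs_smult_distrib:
  assumes "vectorspace K V" "x \<in> carrier V" "y \<in> carrier V" "c \<in> carrier K"
  shows "c \<odot>\<^bsub>V\<^esub> (x \<oplus>\<^bsub>V\<^esub> y) = c \<odot>\<^bsub>V\<^esub> x \<oplus>\<^bsub>V\<^esub> c \<odot>\<^bsub>V\<^esub> y"
proof -
  interpret V: vectorspace K V by fact
  show ?thesis using assms(2-4) by (simp add: V.smult_r_distr)
qed

lemma linear_add:
  assumes "linear_map K V W f" "linear_map K V W g"
  shows "linear_map K V W (\<lambda>x. f x \<oplus>\<^bsub>W\<^esub> g x)"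
proof -
  note D = linear_mapD[OF assms(1)] and E = linear_mapD[OF assms(2)]
  show ?thesis
    by (rule linear_mapI) (simp_all add: D E vs_smult_distrib[OF D(2)] vs_add_ac[OF D(2)])
qed

lemma vs_smult_comm:
  assumes "vectorspace K V" "x \<in> carrier V" "c \<in> carrier K" "d \<in> carrier K"
  shows "c \<odot>\<^bsub>V\<^esub> (d \<odot>\<^bsub>V\<^esub> x) = d \<odot>\<^bsub>V\<^esub> (c \<odot>\<^bsub>V\<^esub> x)"
proof -
  interpret V: vectorspace K V by fact
  show ?thesis using assms(2-4) by (metis V.R.m_comm V.smult_assoc1)
qed

lemma linear_scalar: "vectorspace K V ==> c \<in> carrier K ==> linear_map K V V (\<lambda>x. c \<odot>\<^bsub>V\<^esub> x)"
  by (rule linear_mapI) (simp_all add: vs_smult_distrib vs_smult_comm)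

lemma linear_minus:
  assumes "linear_map K V W f" "linear_map K V W g"
  shows "linear_map K V W (\<lambda>x. f x \<ominus>\<^bsub>W\<^esub> g x)"
proof -
  note D = linear_mapD[OF assms(1)] and E = linear_mapD[OF assms(2)]
  have u: "\<ominus>\<^bsub>K\<^esub> \<one>\<^bsub>K\<^esub> \<in> carrier K"
    using minus_eq_add_smult(2)[OF D(2) vs_closed(1)[OF D(2)] vs_closed(1)[OF D(2)]] .
  show ?thesis
    by (rule linear_mapI)
       (simp_all add: D E u vs_smult_distrib[OF D(2)] vs_add_ac[OF D(2)]
          minus_eq_add_smult(1)[OF D(2)] vs_smult_comm[OF D(2) _ u])
qed

lemma subspace_preimage:
  assumes "linear_map K V W f" "subsp U W"
  shows "subsp {x \<in> carrier V. f x \<in> U} V"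
  using linear_mapD[OF assms(1)] subspaceD[OF assms(2)] by (intro subspaceI) auto

lemma subspace_image:
  assumes "linear_map K V W f" "subsp U V"
  shows "subsp (f ` U) W"
proof (rule subspaceI)
  note D = linear_mapD[OF assms(1)] and E = subspaceD[OF assms(2)]
  show "vectorspace K W" by (rule D)
  show "f ` U \<subseteq> carrier W" using D E by auto
  show "\<zero>\<^bsub>W\<^esub> \<in> f ` U" using D(6) E(3) by (metis imageI)
  fix x y assume "x \<in> f ` U" "y \<in> f ` U"
  then obtain a b where "a \<in> U" "b \<in> U" "x = f a" "y = f b" by auto
  then show "x \<oplus>\<^bsub>W\<^esub> y \<in> f ` U" using D(4)[of a b] E by (metis imageI)
next
  note D = linear_mapD[OF assms(1)] and E = subspaceD[OF assms(2)]
  fix c x assume "c \<in> carrier K" "x \<in> f ` U"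
  then obtain a where "a \<in> U" "x = f a" by auto
  then show "c \<odot>\<^bsub>W\<^esub> x \<in> f ` U" using D(5)[of c a] E \<open>c \<in> carrier K\<close> by (metis imageI)
qed

lemma subspace_Inter:
  assumes "vectorspace K V" "\<And>i. i \<in> I ==> subsp (W i) V"
  shows "subsp {x \<in> carrier V. \<forall>i\<in>I. x \<in> W i} V"
  using assms(1) subspaceD[OF assms(2)] by (intro subspaceI) auto

lemma subspace_Int:
  assumes "subsp A V" "subsp B V"
  shows "subsp (A \<inter> B) V"
  using subspaceD[OF assms(1)] subspaceD[OF assms(2)] by (intro subspaceI) auto

lemma subspace_carrier: "vectorspace K V ==> subsp (carrier V) V"
  by (rule subspaceI) auto

lemma subspace_zero: "vectorspace K V ==> subsp {\<zero>\<^bsub>V\<^esub>} V"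
  by (rule subspaceI) auto

lemma subspace_ker:
  "linear_map K V W f ==> subsp {x \<in> carrier V. f x = \<zero>\<^bsub>W\<^esub>} V"
  using subspace_preimage[of V W f "{\<zero>\<^bsub>W\<^esub>}"] subspace_zero[of W] linear_mapD(2)[of V W f] by simp

lemma subspace_common_kernel:
  assumes "vectorspace K V" "\<And>i. i \<in> I ==> linear_map K V (W i) (f i)"
  shows "subsp {x \<in> carrier V. \<forall>i\<in>I. f i x = \<zero>\<^bsub>W i\<^esub>} V"
proof -
  have "subsp {x \<in> carrier V. \<forall>i\<in>I. x \<in> {x \<in> carrier V. f i x = \<zero>\<^bsub>W i\<^esub>}} V"
    by (rule subspace_Inter[OF assms(1) subspace_ker[OF assms(2)]])
  then show ?thesis by (simp cong: conj_cong ball_cong)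
qed

lemma span_facts:
  assumes V: "vectorspace K V" and S: "S \<subseteq> carrier V"
  shows "subsp (LinearCombinations.module.span K V S) V"
    and "S \<subseteq> LinearCombinations.module.span K V S"
    and "subsp W V ==> S \<subseteq> W ==> LinearCombinations.module.span K V S \<subseteq> W"
proof -
  interpret V: vectorspace K V by (rule V)
  show "subsp (V.span S) V" "S \<subseteq> V.span S"
    using V.span_is_subspace[OF S] V.in_own_span[OF S] by auto
  show "V.span S \<subseteq> W" if "subsp W V" "S \<subseteq> W"
    by (rule V.span_is_subset[OF that(2) VectorSpace.subspace.submod[OF that(1)]])
qed

lemma linear_restrict_dom:
  assumes "linear_map K V W f" "subsp U V"
  shows "linear_map K (V\<lparr>carrier := U\<rparr>) W f"
  using linear_mapD[OF assms(1)] subspaceD[OF assms(2)] vectorspace_sub[OF assms(2)]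
  by (intro linear_mapI) auto

lemma linear_restrict_cod:
  assumes "linear_map K V W f" "subsp U W" "\<And>x. x \<in> carrier V ==> f x \<in> U"
  shows "linear_map K V (W\<lparr>carrier := U\<rparr>) f"
  using linear_mapD[OF assms(1)] assms(3) vectorspace_sub[OF assms(2)]
  by (intro linear_mapI) auto

lemma subspace_sub_iff:
  assumes "subsp U V"
  shows "subsp W (V\<lparr>carrier := U\<rparr>) \<longleftrightarrow> subsp W V \<and> W \<subseteq> U"
proof
  assume "subsp W (V\<lparr>carrier := U\<rparr>)"
  note D = subspaceD[OF this]
  show "subsp W V \<and> W \<subseteq> U"
    using D subspaceD[OF assms] by (intro conjI subspaceI) auto
next
  assume *: "subsp W V \<and> W \<subseteq> U"
  show "subsp W (V\<lparr>carrier := U\<rparr>)"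
    using subspaceD[of W V] * vectorspace_sub[OF assms] by (intro subspaceI) auto
qed


subsection \<open>Dimension\<close>

abbreviation fd :: "('k, 'v) module => bool" where
  "fd V \<equiv> vectorspace.fin_dim K V"

abbreviation dm :: "('k, 'v) module => nat" where
  "dm V \<equiv> vectorspace.dim K V"

abbreviation sdim :: "('k, 'v) module => 'v set => nat" where
  "sdim V W \<equiv> dm (V\<lparr>carrier := W\<rparr>)"

text \<open>
A maximal independent subset of \<open>W\<close> is independent in \<open>V\<close> as well. It is therefore finite, it is a basis
of \<open>W\<close>, and if it has \<open>dim V\<close> elements then it is also a basis of \<open>V\<close>.
\<close>
lemma fd_sub:
  assumes V: "vectorspace K V" "fd V" and W: "subsp W V"
  shows "fd (V\<lparr>carrier := W\<rparr>)" "sdim V W \<le> dm V"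
    and "sdim V W = dm V ==> W = carrier V"
proof -
  interpret V: vectorspace K V by fact
  interpret W: vectorspace K "V\<lparr>carrier := W\<rparr>" using vectorspace_sub[OF W] .
  have sm: "submodule K W V" using W by (rule VectorSpace.subspace.submod)
  have WV: "W \<subseteq> carrier V" using subspaceD[OF W] by simp
  let ?P = "\<lambda>S. S \<subseteq> W \<and> W.lin_indpt S"
  have li: "V.lin_indpt S" if "?P S" for S
    using V.span_li_not_depend(2)[OF _ sm, of S] that by simp
  have "\<exists>A. finite A \<and> maximal A ?P"
  proof (rule maximal_exists)
    show "\<And>A. A \<subseteq> W \<and> W.lin_indpt A ==> finite A \<and> card A \<le> V.dim"
      using li V.li_le_dim[OF V(2)] WV by (meson subset_trans)
    show "{} \<subseteq> W \<and> W.lin_indpt {}"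
      by (simp add: W.lin_dep_def)
  qed
  then obtain A where A: "finite A" "maximal A ?P" by blast
  have b: "W.basis A" using W.max_li_is_basis[of A] A(2) by simp
  show "fd (V\<lparr>carrier := W\<rparr>)"
    using b A(1) unfolding W.fin_dim_def W.basis_def by blast
  have dA: "W.dim = card A" using W.dim_basis[OF A(1) b] .
  have PA: "?P A" using A(2) by (simp add: maximal_def)
  then show "sdim V W \<le> dm V"
    using dA V.li_le_dim(2)[OF V(2) _ li[OF PA]] WV by auto
  assume "sdim V W = dm V"
  then have "V.basis A"
    using V.dim_li_is_basis[OF V(2) A(1) _ li[OF PA]] dA PA WV by auto
  then have "V.span A = carrier V" by (simp add: V.basis_def)
  moreover have "V.span A \<subseteq> W" using V.span_is_subset[OF _ sm] PA by blast
  ultimately show "W = carrier V" using WV by blast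
qed

lemma dm_mono:
  assumes V: "vectorspace K V" "fd V"
    and U: "subsp U V" and W: "subsp W V" "U \<subseteq> W"
  shows "sdim V U \<le> sdim V W"
    and "sdim V U = sdim V W ==> U = W"
  using fd_sub(2,3)[of "V\<lparr>carrier := W\<rparr>" U] vectorspace_sub[OF W(1)] fd_sub(1)[OF V W(1)]
    subspace_sub_iff[OF W(1), of U] U W by auto

lemma rank_nullity_sub:
  assumes f: "linear_map K V W f" and V: "fd V" and U: "subsp U V"
  shows "sdim W (f ` U) + sdim V {x \<in> U. f x = \<zero>\<^bsub>W\<^esub>}
    = sdim V U"
proof -
  interpret f: linear_map K "V\<lparr>carrier := U\<rparr>" W f by (rule linear_restrict_dom[OF f U])
  show ?thesis
    using f.rank_nullity[OF fd_sub(1)[OF linear_mapD(1)[OF f] V U]]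
    by (simp add: f.im_def f.ker_def)
qed

lemma dm_zero: "vectorspace K V ==> sdim V {\<zero>\<^bsub>V\<^esub>} = 0"
proof -
  assume V: "vectorspace K V"
  interpret W: vectorspace K "V\<lparr>carrier := {\<zero>\<^bsub>V\<^esub>}\<rparr>"
    using vectorspace_sub[OF subspace_zero[OF V]] .
  show ?thesis by (rule W.dim0I) (use W.span_is_subset2[of "{\<zero>\<^bsub>V\<^esub>}"] W.in_own_span[of "{\<zero>\<^bsub>V\<^esub>}"] in auto)
qed

lemma dm_eq_0:
  assumes "vectorspace K V" "fd V" "dm V = 0" shows "carrier V = {\<zero>\<^bsub>V\<^esub>}"
  using fd_sub(3)[OF assms(1,2) subspace_zero[OF assms(1)]] dm_zero[OF assms(1)] assms(3) by simp

lemma fd_image: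
  assumes "linear_map K V W f" "fd V" "f ` carrier V = carrier W"
  shows "fd W"
proof -
  interpret f: linear_map K V W f by fact
  show ?thesis using f.surj_fin_dim assms by blast
qed

lemma dm_iso:
  assumes "linear_map K V W f" "fd V" "bij_betw f (carrier V) (carrier W)"
  shows "dm V = dm W"
proof -
  interpret f: linear_map K V W f by fact
  show ?thesis using f.dim_eq assms by (simp add: bij_betw_def)
qed

text \<open>
Rank--nullity, for an endomorphism of a finite-dimensional space.
\<close>
lemma inj_iff_surj:
  assumes f: "linear_map K V V f" and V: "fd V"
  shows "(\<forall>x\<in>carrier V. f x = \<zero>\<^bsub>V\<^esub> \<longrightarrow> x = \<zero>\<^bsub>V\<^esub>) \<longleftrightarrow> f ` carrier V = carrier V"
proof -
  note D = linear_mapD[OF f]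
  have rn: "sdim V (f ` carrier V)
      + sdim V {x \<in> carrier V. f x = \<zero>\<^bsub>V\<^esub>} = dm V"
    using rank_nullity_sub[OF f V subspace_carrier[OF D(1)]] by simp
  show ?thesis
  proof
    assume "\<forall>x\<in>carrier V. f x = \<zero>\<^bsub>V\<^esub> \<longrightarrow> x = \<zero>\<^bsub>V\<^esub>"
    then have "{x \<in> carrier V. f x = \<zero>\<^bsub>V\<^esub>} = {\<zero>\<^bsub>V\<^esub>}" using D(1,6) by auto
    then have "sdim V (f ` carrier V) = dm V" using rn dm_zero[OF D(1)] by simp
    then show "f ` carrier V = carrier V"
      using fd_sub(3)[OF D(1) V subspace_image[OF f subspace_carrier[OF D(1)]]] by simp
  next
    assume "f ` carrier V = carrier V"
    then have "sdim V {x \<in> carrier V. f x = \<zero>\<^bsub>V\<^esub>} = 0" using rn by simp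
    then have "carrier (V\<lparr>carrier := {x \<in> carrier V. f x = \<zero>\<^bsub>V\<^esub>}\<rparr>) = {\<zero>\<^bsub>V\<^esub>}"
      using dm_eq_0[OF vectorspace_sub[OF subspace_ker[OF f]] fd_sub(1)[OF D(1) V subspace_ker[OF f]]]
      by simp
    then show "\<forall>x\<in>carrier V. f x = \<zero>\<^bsub>V\<^esub> \<longrightarrow> x = \<zero>\<^bsub>V\<^esub>" by auto
  qed
qed


section \<open>Modules, morphisms and submodules\<close>

abbreviation elts :: "('p, 'k, 'v) pmod => 'p => 'v set" where
  "elts M p \<equiv> carrier (Sp M p)"

abbreviation zero_of :: "('p, 'k, 'v) pmod => 'p => 'v" where
  "zero_of M p \<equiv> \<zero>\<^bsub>Sp M p\<^esub>"

lemma pmodD: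
  assumes "pmodule K M"
  shows "vectorspace K (Sp M p)"
    and "p \<le> q ==> linear_map K (Sp M p) (Sp M q) (Mp M p q)"
    and "p \<le> q ==> x \<in> elts M p ==> Mp M p q x \<in> elts M q"
    and "x \<in> elts M p ==> Mp M p p x = x"
    and "p \<le> q ==> q \<le> r ==> x \<in> elts M p ==> Mp M q r (Mp M p q x) = Mp M p r x"
  using assms linear_mapD(3) pmodule.linear_Mp by (fastforce simp: pmodule_def)+

abbreviation Hom :: "('p::order, 'k, 'v) pmod => ('p, 'k, 'w) pmod => ('p => 'v => 'w) set" where
  "Hom M N \<equiv> pmod_hom K M N"

lemma homI:
  assumes "\<And>p. linear_map K (Sp M p) (Sp N p) (f p)"
    and "\<And>p q v. p \<le> q ==> v \<in> elts M p ==> f q (Mp M p q v) = Mp N p q (f p v)"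
  shows "f \<in> Hom M N"
  using assms by (auto simp: pmod_hom_def)

lemma homD:
  assumes "f \<in> Hom M N"
  shows "linear_map K (Sp M p) (Sp N p) (f p)"
    and "p \<le> q ==> v \<in> elts M p ==> f q (Mp M p q v) = Mp N p q (f p v)"
    and "v \<in> elts M p ==> f p v \<in> elts N p"
    and "v \<in> elts M p ==> w \<in> elts M p ==>
      f p (v \<oplus>\<^bsub>Sp M p\<^esub> w) = f p v \<oplus>\<^bsub>Sp N p\<^esub> f p w"
    and "c \<in> carrier K ==> v \<in> elts M p ==>
      f p (c \<odot>\<^bsub>Sp M p\<^esub> v) = c \<odot>\<^bsub>Sp N p\<^esub> f p v"
    and "f p (zero_of M p) = zero_of N p"
    and "v \<in> elts M p ==> w \<in> elts M p ==>
      f p (v \<ominus>\<^bsub>Sp M p\<^esub> w) = f p v \<ominus>\<^bsub>Sp N p\<^esub> f p w"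
proof -
  have l: "linear_map K (Sp M p) (Sp N p) (f p)" for p using assms by (simp add: pmod_hom_def)
  show "linear_map K (Sp M p) (Sp N p) (f p)" by (rule l)
  show "p \<le> q ==> v \<in> elts M p ==> f q (Mp M p q v) = Mp N p q (f p v)"
    using assms by (simp add: pmod_hom_def)
qed (use linear_mapD(3-7)[of "Sp M p" "Sp N p" "f p"] assms in \<open>auto simp: pmod_hom_def\<close>)

lemma hom_id: "pmodule K M ==> (\<lambda>p v. v) \<in> Hom M M"
  by (rule homI) (auto intro: linear_id pmodD)

lemma hom_comp:
  assumes "f \<in> Hom L M" "g \<in> Hom M N"
  shows "(\<lambda>p v. g p (f p v)) \<in> Hom L N"
  by (rule homI, rule linear_comp[OF homD(1)[OF assms(1)] homD(1)[OF assms(2)]])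
     (simp add: homD(2,3)[OF assms(1)] homD(2)[OF assms(2)])

lemma hom_zero:
  assumes "pmodule K M" "pmodule K N"
  shows "(\<lambda>p v. zero_of N p) \<in> Hom M N"
  by (rule homI, rule linear_zero[OF pmodD(1)[OF assms(1)] pmodD(1)[OF assms(2)]])
     (simp add: linear_mapD(6)[OF pmodD(2)[OF assms(2)]])

lemma hom_add:
  assumes "pmodule K N" "f \<in> Hom M N" "g \<in> Hom M N"
  shows "(\<lambda>p v. f p v \<oplus>\<^bsub>Sp N p\<^esub> g p v) \<in> Hom M N"
  by (rule homI, rule linear_add[OF homD(1)[OF assms(2)] homD(1)[OF assms(3)]])
     (simp add: linear_mapD(4)[OF pmodD(2)[OF assms(1)]] homD(2,3)[OF assms(2)] homD(2,3)[OF assms(3)])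

lemma hom_minus:
  assumes "pmodule K N" "f \<in> Hom M N" "g \<in> Hom M N"
  shows "(\<lambda>p v. f p v \<ominus>\<^bsub>Sp N p\<^esub> g p v) \<in> Hom M N"
  by (rule homI, rule linear_minus[OF homD(1)[OF assms(2)] homD(1)[OF assms(3)]])
     (simp add: linear_mapD(7)[OF pmodD(2)[OF assms(1)]] homD(2,3)[OF assms(2)] homD(2,3)[OF assms(3)])

lemma hom_inverse:
  assumes M: "pmodule K M" and f: "f \<in> Hom M N"
    and bij: "\<And>p. bij_betw (f p) (elts M p) (elts N p)"
  obtains g where "g \<in> Hom N M"
    and "\<And>p v. v \<in> elts M p ==> g p (f p v) = v"
    and "\<And>p w. w \<in> elts N p ==> f p (g p w) = w"
    and "\<And>p. bij_betw (g p) (elts N p) (elts M p)"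
proof -
  define g where "g = (\<lambda>p. inv_into (elts M p) (f p))"
  note F = homD[OF f]
  have gf: "g p (f p v) = v" if "v \<in> elts M p" for p v
    unfolding g_def using bij[of p] that by (meson bij_betw_inv_into_left)
  have fg: "f p (g p w) = w" if "w \<in> elts N p" for p w
    unfolding g_def using bij[of p] that by (meson bij_betw_inv_into_right)
  have bg: "bij_betw (g p) (elts N p) (elts M p)" for p
    unfolding g_def using bij[of p] by (rule bij_betw_inv_into)
  have gc: "g p w \<in> elts M p" if "w \<in> elts N p" for p w
    using bg[of p] that by (meson bij_betwE)
  have "g \<in> Hom N M"
  proof (rule homI)
    fix p
    note V = linear_mapD(1,2)[OF F(1)]
    show "linear_map K (Sp N p) (Sp M p) (g p)"
    proof (rule linear_mapI)
      show "vectorspace K (Sp N p)" "vectorspace K (Sp M p)" using V by auto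
      show "g p x \<in> elts M p" if "x \<in> elts N p" for x using gc that .
      show "g p (x \<oplus>\<^bsub>Sp N p\<^esub> y) = g p x \<oplus>\<^bsub>Sp M p\<^esub> g p y"
        if "x \<in> elts N p" "y \<in> elts N p" for x y
      proof -
        have "f p (g p x \<oplus>\<^bsub>Sp M p\<^esub> g p y) = x \<oplus>\<^bsub>Sp N p\<^esub> y"
          using F(4)[OF gc[OF that(1)] gc[OF that(2)]] fg that by simp
        then show ?thesis using gf gc that V(1) by (metis vs_closed(2))
      qed
      show "g p (c \<odot>\<^bsub>Sp N p\<^esub> x) = c \<odot>\<^bsub>Sp M p\<^esub> g p x"
        if "c \<in> carrier K" "x \<in> elts N p" for c x
      proof -
        have "f p (c \<odot>\<^bsub>Sp M p\<^esub> g p x) = c \<odot>\<^bsub>Sp N p\<^esub> x"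
          using F(5)[OF that(1) gc[OF that(2)]] fg that by simp
        then show ?thesis using gf gc that V(1) by (metis vs_closed(4))
      qed
    qed
  next
    fix p q v assume pq: "p \<le> q" and v: "v \<in> elts N p"
    have "f q (Mp M p q (g p v)) = Mp N p q v" using F(2)[OF pq gc[OF v]] fg[OF v] by simp
    then show "g q (Mp N p q v) = Mp M p q (g p v)"
      using gf pmodD(3)[OF M pq gc[OF v]] by metis
  qed
  with gf fg bg that show thesis by blast
qed

lemma iso_refl: "pmodule K M ==> pmod_isomorphic K M M"
  unfolding pmod_isomorphic_def using hom_id by (intro bexI[of _ "\<lambda>p v. v"]) (auto simp: bij_betw_def)

lemma iso_sym: "pmodule K M ==> pmod_isomorphic K M N ==> pmod_isomorphic K N M"
  unfolding pmod_isomorphic_def by (elim bexE, erule (1) hom_inverse) auto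

lemma iso_trans:
  assumes "pmod_isomorphic K L M" "pmod_isomorphic K M N"
  shows "pmod_isomorphic K L N"
proof -
  obtain f g where f: "f \<in> Hom L M" "\<And>p. bij_betw (f p) (elts L p) (elts M p)"
    and g: "g \<in> Hom M N" "\<And>p. bij_betw (g p) (elts M p) (elts N p)"
    using assms by (auto simp: pmod_isomorphic_def)
  have "bij_betw (\<lambda>v. g p (f p v)) (elts L p) (elts N p)" for p
    using bij_betw_trans[OF f(2) g(2)] by (simp add: comp_def)
  then show ?thesis unfolding pmod_isomorphic_def
    by (intro bexI[OF _ hom_comp[OF f(1) g(1)]]) simp
qed

lemma psubI:
  assumes "\<And>p. subsp (J p) (Sp M p)"
    and "\<And>p q x. p \<le> q ==> x \<in> J p ==> Mp M p q x \<in> J q"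
  shows "psubmodule K J M"
  using assms by (auto simp: psubmodule_def)

lemma psubD:
  assumes "psubmodule K J M"
  shows "subsp (J p) (Sp M p)"
    and "p \<le> q ==> x \<in> J p ==> Mp M p q x \<in> J q"
    and "x \<in> J p ==> x \<in> elts M p"
  using assms subspaceD(2) unfolding psubmodule_def by blast+

lemma pmod_sub_simps [simp]:
  "Sp (pmod_sub M J) p = (Sp M p)\<lparr>carrier := J p\<rparr>" "Mp (pmod_sub M J) = Mp M"
  by (simp_all add: pmod_sub_def)

lemma pmodule_sub:
  assumes "pmodule K M" "psubmodule K J M"
  shows "pmodule K (pmod_sub M J)"
proof -
  note D = pmodD[OF assms(1)] and J = psubD[OF assms(2)]
  have "linear_map K ((Sp M p)\<lparr>carrier := J p\<rparr>) ((Sp M q)\<lparr>carrier := J q\<rparr>) (Mp M p q)"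
    if "p \<le> q" for p q
    using linear_restrict_cod[OF linear_restrict_dom[OF D(2)[OF that] J(1)] J(1)] J(2)[OF that]
    by simp
  then show ?thesis
    using vectorspace_sub[OF J(1)] D(4,5) J(3) by (simp add: pmodule_def)
qed

lemma hom_sub_dom:
  assumes "f \<in> Hom M N" "psubmodule K J M"
  shows "f \<in> Hom (pmod_sub M J) N"
  using homD[OF assms(1)] psubD[OF assms(2)] by (intro homI) (auto intro: linear_restrict_dom)

lemma hom_sub_cod:
  assumes "f \<in> Hom L M" "psubmodule K J M"
    and "\<And>p x. x \<in> elts L p ==> f p x \<in> J p"
  shows "f \<in> Hom L (pmod_sub M J)"
  using homD[OF assms(1)] psubD[OF assms(2)] assms(3)
  by (intro homI) (auto intro: linear_restrict_cod)

lemma psub_sub_iff: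
  assumes "psubmodule K J M"
  shows "psubmodule K L (pmod_sub M J) \<longleftrightarrow> psubmodule K L M \<and> (\<forall>p. L p \<subseteq> J p)"
  using subspace_sub_iff[OF psubD(1)[OF assms]] by (auto simp: psubmodule_def)

lemma psub_preimage:
  assumes "pmodule K M" "f \<in> Hom M N" "psubmodule K J N"
  shows "psubmodule K (\<lambda>p. {x \<in> elts M p. f p x \<in> J p}) M"
  using homD[OF assms(2)] psubD[OF assms(3)] pmodD[OF assms(1)]
  by (intro psubI subspace_preimage) auto

lemma psub_image:
  assumes "f \<in> Hom M N" "psubmodule K J M"
  shows "psubmodule K (\<lambda>p. f p ` J p) N"
proof (rule psubI)
  show "subsp (f p ` J p) (Sp N p)" for p
    using homD(1)[OF assms(1)] psubD[OF assms(2)] by (intro subspace_image) auto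
  fix p q x assume pq: "p \<le> q" and "x \<in> f p ` J p"
  then obtain y where y: "y \<in> J p" "x = f p y" by blast
  then have "Mp N p q x = f q (Mp M p q y)" using homD(2)[OF assms(1) pq psubD(3)[OF assms(2) y(1)]] by simp
  then show "Mp N p q x \<in> f q ` J q" using psubD(2)[OF assms(2) pq y(1)] by simp
qed

lemma psub_zero:
  assumes "pmodule K M" shows "psubmodule K (\<lambda>p. {zero_of M p}) M"
  using pmodD[OF assms] linear_mapD(6)[OF pmodD(2)[OF assms]] by (intro psubI subspace_zero) auto

lemma psub_full:
  assumes "pmodule K M" shows "psubmodule K (\<lambda>p. elts M p) M"
  using pmodD[OF assms] by (intro psubI subspace_carrier) auto

lemma psub_Inter:
  assumes "pmodule K M" "\<And>i. i \<in> I ==> psubmodule K (J i) M"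
  shows "psubmodule K (\<lambda>p. {x \<in> elts M p. \<forall>i\<in>I. x \<in> J i p}) M"
  using pmodD[OF assms(1)] psubD[OF assms(2)] by (intro psubI subspace_Inter) auto

lemma psub_ker:
  assumes "pmodule K M" "pmodule K N" "f \<in> Hom M N"
  shows "psubmodule K (\<lambda>p. {x \<in> elts M p. f p x = zero_of N p}) M"
  using psub_preimage[OF assms(1,3) psub_zero[OF assms(2)]] by simp


section \<open>Direct sum decompositions\<close>

text \<open>
This is \<open>M \<cong> \<Oplus> N\<^sub>i\<close> expressed through the projections \<open>pr i\<close>: they identify the elements of \<open>M\<close> at each
point with the finitely supported families. No sum occurs in the definition, so that most arguments
about decompositions only compare components (\<open>decomp_ext\<close>).
\<close>
definition decomp ::
  "('p::order, 'k, 'v) pmod => 'i set => ('i => ('p, 'k, 'w) pmod) => ('i => 'p => 'v => 'w) => bool"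
  where "decomp M I N pr \<longleftrightarrow> pmodule K M \<and> (\<forall>i\<in>I. pmodule K (N i)) \<and>
    (\<forall>i\<in>I. pr i \<in> Hom M (N i)) \<and>
    (\<forall>p. \<forall>x\<in>elts M p. finite {i\<in>I. pr i p x \<noteq> zero_of (N i) p}) \<and>
    (\<forall>p. \<forall>x\<in>elts M p. (\<forall>i\<in>I. pr i p x = zero_of (N i) p) \<longrightarrow> x = zero_of M p) \<and>
    (\<forall>p y. (\<forall>i\<in>I. y i \<in> elts (N i) p) \<longrightarrow> finite {i\<in>I. y i \<noteq> zero_of (N i) p} \<longrightarrow>
       (\<exists>x\<in>elts M p. \<forall>i\<in>I. pr i p x = y i))"

lemma decompD:
  assumes "decomp M I N pr"
  shows "pmodule K M" "i \<in> I ==> pmodule K (N i)" "i \<in> I ==> pr i \<in> Hom M (N i)"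
    and "x \<in> elts M p ==> finite {i\<in>I. pr i p x \<noteq> zero_of (N i) p}"
    and "x \<in> elts M p ==> (\<And>i. i \<in> I ==> pr i p x = zero_of (N i) p) ==> x = zero_of M p"
    and "(\<And>i. i \<in> I ==> y i \<in> elts (N i) p) ==> finite {i\<in>I. y i \<noteq> zero_of (N i) p} ==>
      \<exists>x\<in>elts M p. \<forall>i\<in>I. pr i p x = y i"
  using assms unfolding decomp_def by blast+

lemma decomp_ext:
  assumes d: "decomp M I N pr" and xy: "x \<in> elts M p" "y \<in> elts M p"
    and eq: "\<And>i. i \<in> I ==> pr i p x = pr i p y"
  shows "x = y"
proof -
  note D = decompD[OF d]
  have V: "vectorspace K (Sp M p)" using pmodD(1)[OF D(1)] .
  have "x \<ominus>\<^bsub>Sp M p\<^esub> y = zero_of M p"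
  proof (rule D(5))
    show "x \<ominus>\<^bsub>Sp M p\<^esub> y \<in> elts M p" using V xy by simp
    fix i assume i: "i \<in> I"
    show "pr i p (x \<ominus>\<^bsub>Sp M p\<^esub> y) = zero_of (N i) p"
      using homD(3,7)[OF D(3)[OF i]] xy eq[OF i] pmodD(1)[OF D(2)[OF i]] by simp
  qed
  then show ?thesis using V xy by simp
qed

text \<open>
The universal property of a product, valid for a direct sum as long as the given components have
finite support on every element. It produces all the morphisms into a direct sum below: the
inclusions of the summands, the projections to partial sums, and sums of morphisms.
\<close>
lemma decomp_lift:
  assumes d: "decomp M I N pr" and L: "pmodule K L"
    and g: "\<And>i. i \<in> I ==> g i \<in> Hom L (N i)"
    and fin: "\<And>p x. x \<in> elts L p ==> finite {i\<in>I. g i p x \<noteq> zero_of (N i) p}"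
  obtains h where "h \<in> Hom L M"
    and "\<And>i p x. i \<in> I ==> x \<in> elts L p ==> pr i p (h p x) = g i p x"
proof -
  note D = decompD[OF d]
  have VM: "vectorspace K (Sp M p)" and VL: "vectorspace K (Sp L p)" for p
    using pmodD(1) D(1) L by auto
  define h where "h p x = (SOME z. z \<in> elts M p \<and> (\<forall>i\<in>I. pr i p z = g i p x))" for p x
  have h: "h p x \<in> elts M p \<and> (\<forall>i\<in>I. pr i p (h p x) = g i p x)"
    if "x \<in> elts L p" for p x
  proof -
    have "\<exists>z\<in>elts M p. \<forall>i\<in>I. pr i p z = g i p x"
      using D(6)[of "\<lambda>i. g i p x" p] homD(3)[OF g that] fin[OF that] by blast
    then show ?thesis unfolding h_def by (rule_tac someI_ex) blast
  qed
  have hc: "h p x \<in> elts M p" if "x \<in> elts L p" for p x using h[OF that] by simp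
  have hp: "pr i p (h p x) = g i p x" if "i \<in> I" "x \<in> elts L p" for i p x
    using h[OF that(2)] that(1) by simp
  have "h \<in> Hom L M"
  proof (rule homI)
    fix p show "linear_map K (Sp L p) (Sp M p) (h p)"
    proof (rule linear_mapI)
      show "h p (x \<oplus>\<^bsub>Sp L p\<^esub> y) = h p x \<oplus>\<^bsub>Sp M p\<^esub> h p y"
        if "x \<in> elts L p" "y \<in> elts L p" for x y
        by (rule decomp_ext[OF d, where p = p]) (use that hc hp VM VL homD(4)[OF D(3)] homD(4)[OF g] in auto)
      show "h p (c \<odot>\<^bsub>Sp L p\<^esub> x) = c \<odot>\<^bsub>Sp M p\<^esub> h p x"
        if "c \<in> carrier K" "x \<in> elts L p" for c x
        by (rule decomp_ext[OF d, where p = p]) (use that hc hp VM VL homD(5)[OF D(3)] homD(5)[OF g] in auto)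
    qed (use VM VL hc in auto)
  next
    fix p q v assume pq: "p \<le> q" and v: "v \<in> elts L p"
    show "h q (Mp L p q v) = Mp M p q (h p v)"
      by (rule decomp_ext[OF d, where p = q])
         (use pq v hc hp pmodD(3)[OF L] pmodD(3)[OF D(1)] homD(2)[OF D(3)] homD(2)[OF g] in auto)
  qed
  with hp that show thesis by blast
qed

lemma decomp_inj:
  assumes d: "decomp M I N pr" and i: "i \<in> I"
  obtains h where "h \<in> Hom (N i) M"
    and "\<And>p x. x \<in> elts (N i) p ==> pr i p (h p x) = x"
    and "\<And>j p x. j \<in> I ==> j \<noteq> i ==> x \<in> elts (N i) p ==> pr j p (h p x) = zero_of (N j) p"
proof -
  note D = decompD[OF d]
  define g where "g j = (if j = i then (\<lambda>p v. v) else (\<lambda>p v. zero_of (N j) p))" for j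
  obtain h where "h \<in> Hom (N i) M"
    and "\<And>j p x. j \<in> I ==> x \<in> elts (N i) p ==> pr j p (h p x) = g j p x"
  proof (rule decomp_lift[OF d D(2)[OF i], of g])
    show "g j \<in> Hom (N i) (N j)" if "j \<in> I" for j
      using hom_id[OF D(2)[OF i]] hom_zero[OF D(2)[OF i] D(2)[OF that]] by (simp add: g_def)
    show "finite {j \<in> I. g j p x \<noteq> zero_of (N j) p}" for p x
      by (rule finite_subset[of _ "{i}"]) (auto simp: g_def)
  qed blast
  with that[of h] i show thesis by (simp add: g_def)
qed

text \<open>
Every element is the sum of its components, stated without a sum: a subspace that contains all the
components of \<open>w\<close> contains \<open>w\<close>. The proof removes one component of \<open>w\<close> after the other.
\<close>
lemma decomp_mem:
  assumes d: "decomp M I N pr" and W: "subsp W (Sp M p)"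
    and w: "w \<in> elts M p"
    and \<iota>: "\<And>i. i \<in> I ==> \<iota> i \<in> Hom (N i) M"
      "\<And>i p x. i \<in> I ==> x \<in> elts (N i) p ==> pr i p (\<iota> i p x) = x"
      "\<And>i j p x. i \<in> I ==> j \<in> I ==> j \<noteq> i ==> x \<in> elts (N i) p ==>
        pr j p (\<iota> i p x) = zero_of (N j) p"
    and comp: "\<And>i. i \<in> I ==> \<iota> i p (pr i p w) \<in> W"
  shows "w \<in> W"
proof -
  note D = decompD[OF d] and W = subspaceD[OF W]
  have V: "vectorspace K (Sp M p)" using pmodD(1)[OF D(1)] .
  have "w \<in> W" if "finite F" "w \<in> elts M p" "{i\<in>I. pr i p w \<noteq> zero_of (N i) p} \<subseteq> F"
      "\<forall>i\<in>I. \<iota> i p (pr i p w) \<in> W" for F w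
    using that
  proof (induction F arbitrary: w rule: finite_induct)
    case empty
    then show ?case using D(5)[of w p] W(3) by auto
  next
    case (insert i F)
    show ?case
    proof (cases "i \<in> I")
      case False
      then show ?thesis using insert by blast
    next
      case i: True
      let ?c = "\<iota> i p (pr i p w)"
      have pc: "pr j p w \<in> elts (N j) p" if "j \<in> I" for j
        using homD(3)[OF D(3)[OF that]] insert.prems by blast
      have c: "?c \<in> elts M p" using homD(3)[OF \<iota>(1)[OF i]] pc[OF i] by blast
      have VN: "vectorspace K (Sp (N j) p)" if "j \<in> I" for j using pmodD(1)[OF D(2)[OF that]] .
      have prj: "pr j p (w \<ominus>\<^bsub>Sp M p\<^esub> ?c) = (if j = i then zero_of (N j) p else pr j p w)"
        if j: "j \<in> I" for j
        using homD(7)[OF D(3)[OF j]] c insert.prems(1) \<iota>(2)[OF i pc[OF i]] \<iota>(3)[OF i j _ pc[OF i]]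
          pc[OF j] VN[OF j] by (cases "j = i") simp_all
      have "w \<ominus>\<^bsub>Sp M p\<^esub> ?c \<in> W"
      proof (rule insert.IH)
        show "w \<ominus>\<^bsub>Sp M p\<^esub> ?c \<in> elts M p" using V c insert.prems by simp
        show "{j \<in> I. pr j p (w \<ominus>\<^bsub>Sp M p\<^esub> ?c) \<noteq> zero_of (N j) p} \<subseteq> F"
          using prj insert.prems(2) by (auto split: if_splits)
        show "\<forall>j\<in>I. \<iota> j p (pr j p (w \<ominus>\<^bsub>Sp M p\<^esub> ?c)) \<in> W"
          using prj insert.prems(3) homD(6)[OF \<iota>(1)] W(3) by auto
      qed
      then have "(w \<ominus>\<^bsub>Sp M p\<^esub> ?c) \<oplus>\<^bsub>Sp M p\<^esub> ?c \<in> W" using W(5) insert.prems(3) i by blast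
      then show ?thesis using V c insert.prems(1) by simp
    qed
  qed
  then show ?thesis using w comp D(4)[OF w] by blast
qed

subsection \<open>Comparison with external direct sums\<close>

lemma dsum_simps:
  "elts (pmod_dsum I N) p = {x \<in> \<Pi>\<^sub>E i\<in>I. elts (N i) p. finite {i \<in> I. x i \<noteq> zero_of (N i) p}}"
  "zero_of (pmod_dsum I N) p = (\<lambda>i\<in>I. zero_of (N i) p)"
  "x \<oplus>\<^bsub>Sp (pmod_dsum I N) p\<^esub> y = (\<lambda>i\<in>I. x i \<oplus>\<^bsub>Sp (N i) p\<^esub> y i)"
  "c \<odot>\<^bsub>Sp (pmod_dsum I N) p\<^esub> x = (\<lambda>i\<in>I. c \<odot>\<^bsub>Sp (N i) p\<^esub> x i)"
  "Mp (pmod_dsum I N) p q x = (\<lambda>i\<in>I. Mp (N i) p q (x i))"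
  by (simp_all add: pmod_dsum_def)

lemma decomp_of_iso:
  assumes M: "pmodule K M" and N: "\<And>i. i \<in> I ==> pmodule K (N i)"
    and iso: "pmod_isomorphic K M (pmod_dsum I N)"
  obtains pr where "decomp M I N pr"
proof -
  obtain f where f: "f \<in> Hom M (pmod_dsum I N)"
    and bij: "\<And>p. bij_betw (f p) (elts M p) (elts (pmod_dsum I N) p)"
    using iso by (auto simp: pmod_isomorphic_def)
  note F = homD[OF f]
  define pr where "pr = (\<lambda>i p x. f p x i)"
  have prc: "pr i p x \<in> elts (N i) p" if "i \<in> I" "x \<in> elts M p" for i p x
    using F(3)[OF that(2)] that(1) by (auto simp: dsum_simps pr_def)
  have "decomp M I N pr"
    unfolding decomp_def
  proof (intro conjI ballI allI impI M N)
    fix i assume i: "i \<in> I"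
    show "pr i \<in> Hom M (N i)"
    proof (rule homI)
      show "linear_map K (Sp M p) (Sp (N i) p) (pr i p)" for p
        using i pmodD(1)[OF M] pmodD(1)[OF N[OF i]] prc[OF i] F(4,5)
        by (intro linear_mapI) (auto simp: pr_def dsum_simps)
      show "pr i q (Mp M p q v) = Mp (N i) p q (pr i p v)"
        if "p \<le> q" "v \<in> elts M p" for p q v
        using F(2)[OF that] i by (simp add: pr_def dsum_simps)
    qed
  next
    fix p x assume x: "x \<in> elts M p"
    show "finite {i \<in> I. pr i p x \<noteq> zero_of (N i) p}"
      using F(3)[OF x] by (simp add: dsum_simps pr_def)
    assume "\<forall>i\<in>I. pr i p x = zero_of (N i) p"
    then have "f p x = f p (zero_of M p)"
      unfolding F(6) using F(3)[OF x] by (auto simp: dsum_simps pr_def fun_eq_iff PiE_def extensional_def)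
    then show "x = zero_of M p"
      using bij[of p] x vs_closed(1)[OF pmodD(1)[OF M]] by (metis bij_betw_imp_inj_on inj_onD)
  next
    fix p y assume "\<forall>i\<in>I. y i \<in> elts (N i) p" "finite {i \<in> I. y i \<noteq> zero_of (N i) p}"
    then have "restrict y I \<in> elts (pmod_dsum I N) p"
      by (auto simp: dsum_simps cong: conj_cong)
    then obtain x where "x \<in> elts M p" "f p x = restrict y I"
      using bij[of p] by (metis bij_betw_imp_surj_on imageE)
    then show "\<exists>x\<in>elts M p. \<forall>i\<in>I. pr i p x = y i"
      by (intro bexI[of _ x]) (simp_all add: pr_def)
  qed
  then show thesis by (rule that)
qed

text \<open>
The vector space axioms pass to any structure that is the image of a vector space under a map
compatible with the operations. External direct sums and quotient spaces are recognized as vector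
spaces in this way.
\<close>
lemma vectorspace_transport:
  assumes V: "vectorspace K V" and surj: "f ` carrier V = carrier Q"
    and z: "f \<zero>\<^bsub>V\<^esub> = \<zero>\<^bsub>Q\<^esub>"
    and add: "\<And>x y. x \<in> carrier V ==> y \<in> carrier V ==> f (x \<oplus>\<^bsub>V\<^esub> y) = f x \<oplus>\<^bsub>Q\<^esub> f y"
    and smult: "\<And>c x. c \<in> carrier K ==> x \<in> carrier V ==> f (c \<odot>\<^bsub>V\<^esub> x) = c \<odot>\<^bsub>Q\<^esub> f x"
  shows "vectorspace K Q" "linear_map K V Q f"
proof -
  interpret V: vectorspace K V by fact
  have ex: "\<exists>x\<in>carrier V. X = f x" if "X \<in> carrier Q" for X using surj that by blast
  have c: "f x \<in> carrier Q" if "x \<in> carrier V" for x using surj that by blast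
  note push = add[symmetric] smult[symmetric] z[symmetric]
  show Q: "vectorspace K Q"
  proof (rule vs_criteria[OF field_K])
    show "\<zero>\<^bsub>Q\<^esub> \<in> carrier Q" using c[of "\<zero>\<^bsub>V\<^esub>"] z by simp
    show "\<forall>v\<in>carrier Q. \<exists>neg_v\<in>carrier Q. v \<oplus>\<^bsub>Q\<^esub> neg_v = \<zero>\<^bsub>Q\<^esub>"
    proof
      fix v assume "v \<in> carrier Q"
      then obtain x where x: "x \<in> carrier V" "v = f x" using ex by blast
      then have "v \<oplus>\<^bsub>Q\<^esub> f (\<ominus>\<^bsub>V\<^esub> x) = \<zero>\<^bsub>Q\<^esub>" by (simp add: push V.M.r_neg)
      then show "\<exists>neg_v\<in>carrier Q. v \<oplus>\<^bsub>Q\<^esub> neg_v = \<zero>\<^bsub>Q\<^esub>" using c[of "\<ominus>\<^bsub>V\<^esub> x"] x(1) by auto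
    qed
  qed (intro allI ballI impI; (elim conjE)?; (drule ex)+; elim bexE;
      simp add: push c V.M.a_ac V.smult_assoc1 V.smult_l_distr V.smult_r_distr)+
  show "linear_map K V Q f" by (rule linear_mapI[OF V Q]) (use c add smult in auto)
qed

lemma iso_of_decomp:
  assumes d: "decomp M I N pr"
  shows "pmod_isomorphic K M (pmod_dsum I N)"
proof -
  note D = decompD[OF d]
  define f where "f = (\<lambda>p x. \<lambda>i\<in>I. pr i p x)"
  have surj: "f p ` elts M p = elts (pmod_dsum I N) p" for p
  proof (intro equalityI subsetI)
    fix y assume "y \<in> f p ` elts M p"
    then show "y \<in> elts (pmod_dsum I N) p"
      using homD(3)[OF D(3)] D(4) by (auto simp: f_def dsum_simps cong: conj_cong)
  next
    fix y assume y: "y \<in> elts (pmod_dsum I N) p"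
    then obtain x where x: "x \<in> elts M p" "\<forall>i\<in>I. pr i p x = y i"
      using D(6)[of y p] by (auto simp: dsum_simps)
    then have "y = f p x" using y by (auto simp: f_def dsum_simps fun_eq_iff PiE_def extensional_def)
    then show "y \<in> f p ` elts M p" using x(1) by blast
  qed
  have lin: "linear_map K (Sp M p) (Sp (pmod_dsum I N) p) (f p)" for p
    by (rule vectorspace_transport(2)[OF pmodD(1)[OF D(1)] surj])
       (auto simp: f_def dsum_simps fun_eq_iff homD(4-6)[OF D(3)])
  have hom: "f \<in> Hom M (pmod_dsum I N)"
    by (rule homI[OF lin]) (auto simp: f_def dsum_simps fun_eq_iff homD(2)[OF D(3)])
  have "inj_on (f p) (elts M p)" for p
    by (rule inj_onI, rule decomp_ext[OF d, where p = p]) (auto simp: f_def fun_eq_iff restrict_def split: if_splits)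
  then show ?thesis using surj by (auto simp: pmod_isomorphic_def bij_betw_def intro!: bexI[OF _ hom])
qed


lemma decompI:
  assumes "pmodule K M" "\<And>i. i \<in> I ==> pmodule K (N i)" "\<And>i. i \<in> I ==> pr i \<in> Hom M (N i)"
    and "\<And>p x. x \<in> elts M p ==> finite {i\<in>I. pr i p x \<noteq> zero_of (N i) p}"
    and "\<And>p x. x \<in> elts M p ==> (\<And>i. i \<in> I ==> pr i p x = zero_of (N i) p) ==> x = zero_of M p"
    and "\<And>p y. (\<And>i. i \<in> I ==> y i \<in> elts (N i) p) ==> finite {i\<in>I. y i \<noteq> zero_of (N i) p} ==>
      \<exists>x\<in>elts M p. \<forall>i\<in>I. pr i p x = y i"
  shows "decomp M I N pr"
  unfolding decomp_def using assms by simp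

subsection \<open>Reindexing, refining and grouping\<close>

lemma decomp_reindex:
  assumes d: "decomp M I N pr" and \<sigma>: "bij_betw \<sigma> I' I"
  shows "decomp M I' (\<lambda>j. N (\<sigma> j)) (\<lambda>j. pr (\<sigma> j))"
proof (rule decompI)
  note D = decompD[OF d]
  have mem: "\<sigma> j \<in> I" if "j \<in> I'" for j using \<sigma> that by (meson bij_betwE)
  have inv: "inv_into I' \<sigma> i \<in> I'" "\<sigma> (inv_into I' \<sigma> i) = i" if "i \<in> I" for i
    using \<sigma> that by (auto simp: bij_betw_def inv_into_into f_inv_into_f)
  have inv': "inv_into I' \<sigma> (\<sigma> j) = j" if "j \<in> I'" for j
    using \<sigma> that by (auto simp: bij_betw_def)
  show "pmodule K M" by (rule D)
  show "pmodule K (N (\<sigma> j))" "pr (\<sigma> j) \<in> Hom M (N (\<sigma> j))" if "j \<in> I'" for j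
    using D mem[OF that] by auto
  fix p
  show "finite {j \<in> I'. pr (\<sigma> j) p x \<noteq> zero_of (N (\<sigma> j)) p}" if "x \<in> elts M p" for x
  proof (rule inj_on_finite)
    show "inj_on \<sigma> {j \<in> I'. pr (\<sigma> j) p x \<noteq> zero_of (N (\<sigma> j)) p}"
      using \<sigma> by (auto simp: bij_betw_def inj_on_def)
    show "\<sigma> ` {j \<in> I'. pr (\<sigma> j) p x \<noteq> zero_of (N (\<sigma> j)) p}
        \<subseteq> {i \<in> I. pr i p x \<noteq> zero_of (N i) p}" using mem by auto
  qed (rule D(4)[OF that])
  show "x = zero_of M p" if "x \<in> elts M p"
    "\<And>j. j \<in> I' ==> pr (\<sigma> j) p x = zero_of (N (\<sigma> j)) p" for x
    using D(5)[OF that(1)] that(2) inv by metis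
  show "\<exists>x\<in>elts M p. \<forall>j\<in>I'. pr (\<sigma> j) p x = y j"
    if y: "\<And>j. j \<in> I' ==> y j \<in> elts (N (\<sigma> j)) p"
      and fin: "finite {j \<in> I'. y j \<noteq> zero_of (N (\<sigma> j)) p}" for y
  proof -
    let ?y = "\<lambda>i. y (inv_into I' \<sigma> i)"
    have "\<exists>x\<in>elts M p. \<forall>i\<in>I. pr i p x = ?y i"
    proof (rule D(6))
      show "?y i \<in> elts (N i) p" if "i \<in> I" for i using y inv that by metis
      show "finite {i \<in> I. ?y i \<noteq> zero_of (N i) p}"
      proof (rule finite_subset)
        show "{i \<in> I. ?y i \<noteq> zero_of (N i) p} \<subseteq> \<sigma> ` {j \<in> I'. y j \<noteq> zero_of (N (\<sigma> j)) p}"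
        proof
          fix i assume "i \<in> {i \<in> I. ?y i \<noteq> zero_of (N i) p}"
          then show "i \<in> \<sigma> ` {j \<in> I'. y j \<noteq> zero_of (N (\<sigma> j)) p}"
            using inv[of i] by (intro image_eqI[of _ _ "inv_into I' \<sigma> i"]) auto
        qed
      qed (use fin in simp)
    qed
    then show ?thesis using mem inv' by fastforce
  qed
qed

text \<open>
To realize a finitely supported family over the pairs \<open>(i, k)\<close>, realize it inside each \<open>N\<^sub>i\<close> first. The
resulting elements vanish for almost all \<open>i\<close>, since an element of \<open>N\<^sub>i\<close> with zero components is zero.
\<close>
lemma decomp_Sigma:
  assumes d: "decomp M I N pr" and e: "\<And>i. i \<in> I ==> decomp (N i) (\<Theta> i) (L i) (q i)"
  shows "decomp M (Sigma I \<Theta>) (\<lambda>ik. L (fst ik) (snd ik))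
    (\<lambda>ik p x. q (fst ik) (snd ik) p (pr (fst ik) p x))"
proof (rule decompI)
  note D = decompD[OF d]
  show "pmodule K M" by (rule D)
  show "pmodule K (L (fst ik) (snd ik))"
    "(\<lambda>p x. q (fst ik) (snd ik) p (pr (fst ik) p x)) \<in> Hom M (L (fst ik) (snd ik))"
    if "ik \<in> Sigma I \<Theta>" for ik
    using that decompD(2,3)[OF e] D(3) by (auto intro: hom_comp[OF D(3)])
  fix p
  show "finite {ik \<in> Sigma I \<Theta>. q (fst ik) (snd ik) p (pr (fst ik) p x) \<noteq> zero_of (L (fst ik) (snd ik)) p}"
    if x: "x \<in> elts M p" for x
  proof (rule finite_subset)
    show "{ik \<in> Sigma I \<Theta>. q (fst ik) (snd ik) p (pr (fst ik) p x) \<noteq> zero_of (L (fst ik) (snd ik)) p}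
      \<subseteq> Sigma {i \<in> I. pr i p x \<noteq> zero_of (N i) p}
          (\<lambda>i. {k \<in> \<Theta> i. q i k p (pr i p x) \<noteq> zero_of (L i k) p})"
      using homD(6)[OF decompD(3)[OF e]] by auto
    show "finite (Sigma {i \<in> I. pr i p x \<noteq> zero_of (N i) p}
          (\<lambda>i. {k \<in> \<Theta> i. q i k p (pr i p x) \<noteq> zero_of (L i k) p}))"
      using D(4)[OF x] decompD(4)[OF e] homD(3)[OF D(3) x] by auto
  qed
  show "x = zero_of M p" if x: "x \<in> elts M p"
    "\<And>ik. ik \<in> Sigma I \<Theta> ==> q (fst ik) (snd ik) p (pr (fst ik) p x) = zero_of (L (fst ik) (snd ik)) p" for x
  proof (rule D(5)[OF x(1)])
    fix i assume i: "i \<in> I"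
    show "pr i p x = zero_of (N i) p"
      by (rule decompD(5)[OF e[OF i] homD(3)[OF D(3)[OF i] x(1)]]) (use x(2)[of "(i, _)"] i in auto)
  qed
  show "\<exists>x\<in>elts M p. \<forall>ik\<in>Sigma I \<Theta>. q (fst ik) (snd ik) p (pr (fst ik) p x) = y ik"
    if y: "\<And>ik. ik \<in> Sigma I \<Theta> ==> y ik \<in> elts (L (fst ik) (snd ik)) p"
      and fin: "finite {ik \<in> Sigma I \<Theta>. y ik \<noteq> zero_of (L (fst ik) (snd ik)) p}" for y
  proof -
    have "\<exists>z\<in>elts (N i) p. \<forall>k\<in>\<Theta> i. q i k p z = y (i, k)" if i: "i \<in> I" for i
    proof (rule decompD(6)[OF e[OF i]])
      show "y (i, k) \<in> elts (L i k) p" if "k \<in> \<Theta> i" for k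
        using y[of "(i, k)"] i that by simp
      show "finite {k \<in> \<Theta> i. y (i, k) \<noteq> zero_of (L i k) p}"
        by (rule finite_subset[OF _ finite_imageI[OF fin, of snd]]) (use i in force)
    qed
    then obtain z where z: "\<And>i. i \<in> I ==> z i \<in> elts (N i) p"
      "\<And>i k. i \<in> I ==> k \<in> \<Theta> i ==> q i k p (z i) = y (i, k)" by metis
    have "\<exists>x\<in>elts M p. \<forall>i\<in>I. pr i p x = z i"
    proof (rule D(6)[OF z(1)])
      show "finite {i \<in> I. z i \<noteq> zero_of (N i) p}"
      proof (rule finite_subset[OF _ finite_imageI[OF fin, of fst]], rule subsetI)
        fix i assume i: "i \<in> {i \<in> I. z i \<noteq> zero_of (N i) p}"
        then obtain k where "k \<in> \<Theta> i" "q i k p (z i) \<noteq> zero_of (L i k) p"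
          using decompD(5)[OF e z(1)] by blast
        then have "(i, k) \<in> {ik \<in> Sigma I \<Theta>. y ik \<noteq> zero_of (L (fst ik) (snd ik)) p}"
          using i z(2) by auto
        then show "i \<in> fst ` {ik \<in> Sigma I \<Theta>. y ik \<noteq> zero_of (L (fst ik) (snd ik)) p}"
          by (rule image_eqI[rotated]) simp
      qed
    qed
    then obtain x where "x \<in> elts M p" "\<And>i. i \<in> I ==> pr i p x = z i" by blast
    then show ?thesis using z(2) by (intro bexI[of _ x]) auto
  qed
qed

text \<open>
The sum of the summands with label \<open>i\<close>, for a labelling \<open>c\<close> of the summands of \<open>R\<close>; as a submodule of
\<open>R\<close> it is cut out by the vanishing of all the other components.
\<close>
definition part ::
  "('p, 'k, 'v) pmod => 'j set => ('j => ('p, 'k, 'w) pmod) => ('j => 'p => 'v => 'w) => ('j => 'i) => 'i => 'p => 'v set"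
  where "part R J Rs pr c i p =
    {x \<in> elts R p. \<forall>j\<in>J. c j \<noteq> i \<longrightarrow> pr j p x = zero_of (Rs j) p}"

lemma psub_part:
  assumes d: "decomp R J Rs pr"
  shows "psubmodule K (part R J Rs pr c i) R"
proof -
  note D = decompD[OF d]
  have "psubmodule K (\<lambda>p. {x \<in> elts R p. \<forall>j\<in>{j\<in>J. c j \<noteq> i}.
      x \<in> {x \<in> elts R p. pr j p x = zero_of (Rs j) p}}) R"
    by (rule psub_Inter[OF D(1)]) (use psub_ker[OF D(1) D(2) D(3)] in blast)
  moreover have "(\<lambda>p. {x \<in> elts R p. \<forall>j\<in>{j\<in>J. c j \<noteq> i}.
      x \<in> {x \<in> elts R p. pr j p x = zero_of (Rs j) p}}) = part R J Rs pr c i"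
    by (auto simp: part_def fun_eq_iff)
  ultimately show ?thesis by (simp only:)
qed

lemma decomp_part:
  assumes d: "decomp R J Rs pr"
  shows "decomp (pmod_sub R (part R J Rs pr c i)) {j\<in>J. c j = i} Rs pr"
proof (rule decompI)
  note D = decompD[OF d]
  show "pmodule K (pmod_sub R (part R J Rs pr c i))"
    by (rule pmodule_sub[OF D(1) psub_part[OF d]])
  show "pmodule K (Rs j)" "pr j \<in> Hom (pmod_sub R (part R J Rs pr c i)) (Rs j)"
    if "j \<in> {j\<in>J. c j = i}" for j
    using that D(2) hom_sub_dom[OF D(3) psub_part[OF d]] by auto
  fix p
  show "finite {j \<in> {j\<in>J. c j = i}. pr j p x \<noteq> zero_of (Rs j) p}"
    if "x \<in> elts (pmod_sub R (part R J Rs pr c i)) p" for x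
    by (rule finite_subset[OF _ D(4)[of x p]]) (use that in \<open>auto simp: part_def\<close>)
  show "x = zero_of (pmod_sub R (part R J Rs pr c i)) p"
    if "x \<in> elts (pmod_sub R (part R J Rs pr c i)) p"
      "\<And>j. j \<in> {j\<in>J. c j = i} ==> pr j p x = zero_of (Rs j) p" for x
    using D(5)[of x p] that by (auto simp: part_def)
  show "\<exists>x\<in>elts (pmod_sub R (part R J Rs pr c i)) p. \<forall>j\<in>{j\<in>J. c j = i}. pr j p x = y j"
    if y: "\<And>j. j \<in> {j\<in>J. c j = i} ==> y j \<in> elts (Rs j) p"
      and fin: "finite {j \<in> {j\<in>J. c j = i}. y j \<noteq> zero_of (Rs j) p}" for y
  proof -
    let ?y = "\<lambda>j. if c j = i then y j else zero_of (Rs j) p"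
    have "\<exists>x\<in>elts R p. \<forall>j\<in>J. pr j p x = ?y j"
    proof (rule D(6))
      show "?y j \<in> elts (Rs j) p" if "j \<in> J" for j
        using y that vs_closed(1)[OF pmodD(1)[OF D(2)[OF that]]] by simp
      show "finite {j \<in> J. ?y j \<noteq> zero_of (Rs j) p}"
        by (rule finite_subset[OF _ fin]) auto
    qed
    then show ?thesis by (auto simp: part_def)
  qed
qed

text \<open>
The projection to the part with label \<open>i\<close> keeps the components with label \<open>i\<close> and annihilates the others.
\<close>
lemma decomp_group:
  assumes d: "decomp R J Rs pr" and c: "\<And>j. j \<in> J ==> c j \<in> I"
  obtains pr' where "decomp R I (\<lambda>i. pmod_sub R (part R J Rs pr c i)) pr'"
proof -
  note D = decompD[OF d]
  have "\<exists>h. h \<in> Hom R R \<and> (\<forall>j\<in>J. \<forall>p. \<forall>x\<in>elts R p.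
      pr j p (h p x) = (if c j = i then pr j p x else zero_of (Rs j) p))" for i
  proof -
    define g where "g j = (if c j = i then pr j else (\<lambda>p x. zero_of (Rs j) p))" for j
    obtain h where "h \<in> Hom R R"
      "\<And>j p x. j \<in> J ==> x \<in> elts R p ==> pr j p (h p x) = g j p x"
    proof (rule decomp_lift[OF d D(1), of g])
      show "g j \<in> Hom R (Rs j)" if "j \<in> J" for j
        using D(3)[OF that] hom_zero[OF D(1) D(2)[OF that]] by (simp add: g_def)
      show "finite {j \<in> J. g j p x \<noteq> zero_of (Rs j) p}" if "x \<in> elts R p" for p x
        by (rule finite_subset[OF _ D(4)[OF that]]) (auto simp: g_def)
    qed blast
    then show ?thesis by (intro exI[of _ h]) (simp add: g_def)
  qed
  then obtain h where h: "\<And>i. h i \<in> Hom R R"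
    "\<And>i j p x. j \<in> J ==> x \<in> elts R p ==>
      pr j p (h i p x) = (if c j = i then pr j p x else zero_of (Rs j) p)" by metis
  have hpart: "h i p x \<in> part R J Rs pr c i p" if "x \<in> elts R p" for i p x
    using that h(2) homD(3)[OF h(1)] by (auto simp: part_def)
  have "decomp R I (\<lambda>i. pmod_sub R (part R J Rs pr c i)) h"
  proof (rule decompI)
    show "pmodule K R" by (rule D)
    show "pmodule K (pmod_sub R (part R J Rs pr c i))" for i
      by (rule pmodule_sub[OF D(1) psub_part[OF d]])
    show "h i \<in> Hom R (pmod_sub R (part R J Rs pr c i))" for i
      by (rule hom_sub_cod[OF h(1) psub_part[OF d] hpart])
    fix p
    show "finite {i \<in> I. h i p x \<noteq> zero_of (pmod_sub R (part R J Rs pr c i)) p}"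
      if x: "x \<in> elts R p" for x
    proof (rule finite_subset[OF _ finite_imageI[OF D(4)[OF x], of c]], rule subsetI)
      fix i assume "i \<in> {i \<in> I. h i p x \<noteq> zero_of (pmod_sub R (part R J Rs pr c i)) p}"
      then obtain j where "j \<in> J" "pr j p (h i p x) \<noteq> zero_of (Rs j) p"
        using D(5)[OF homD(3)[OF h(1) x], of i] by auto
      then show "i \<in> c ` {j \<in> J. pr j p x \<noteq> zero_of (Rs j) p}"
        using h(2)[OF _ x] by (auto split: if_splits)
    qed
    show "x = zero_of R p" if x: "x \<in> elts R p"
      "\<And>i. i \<in> I ==> h i p x = zero_of (pmod_sub R (part R J Rs pr c i)) p" for x
    proof (rule D(5)[OF x(1)])
      fix j assume j: "j \<in> J"
      have "pr j p (h (c j) p x) = zero_of (Rs j) p"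
        using x(2)[OF c[OF j]] homD(6)[OF D(3)[OF j]] by simp
      then show "pr j p x = zero_of (Rs j) p" using h(2)[OF j x(1)] by simp
    qed
    show "\<exists>x\<in>elts R p. \<forall>i\<in>I. h i p x = y i"
      if y: "\<And>i. i \<in> I ==> y i \<in> elts (pmod_sub R (part R J Rs pr c i)) p"
        and fin: "finite {i \<in> I. y i \<noteq> zero_of (pmod_sub R (part R J Rs pr c i)) p}" for y
    proof -
      have y': "y i \<in> elts R p" "\<And>j. j \<in> J ==> c j \<noteq> i ==> pr j p (y i) = zero_of (Rs j) p"
        if "i \<in> I" for i using y[OF that] by (auto simp: part_def)
      have "\<exists>x\<in>elts R p. \<forall>j\<in>J. pr j p x = pr j p (y (c j))"
      proof (rule D(6))
        show "pr j p (y (c j)) \<in> elts (Rs j) p" if "j \<in> J" for j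
          using homD(3)[OF D(3)[OF that] y'(1)[OF c[OF that]]] .
        let ?F = "{i \<in> I. y i \<noteq> zero_of R p}"
        show "finite {j \<in> J. pr j p (y (c j)) \<noteq> zero_of (Rs j) p}"
        proof (rule finite_subset)
          show "{j \<in> J. pr j p (y (c j)) \<noteq> zero_of (Rs j) p} \<subseteq>
              (\<Union>i\<in>?F. {j \<in> J. pr j p (y i) \<noteq> zero_of (Rs j) p})"
          proof
            fix j assume j: "j \<in> {j \<in> J. pr j p (y (c j)) \<noteq> zero_of (Rs j) p}"
            then have "y (c j) \<noteq> zero_of R p" using homD(6)[OF D(3), of j p] by auto
            then show "j \<in> (\<Union>i\<in>?F. {j \<in> J. pr j p (y i) \<noteq> zero_of (Rs j) p})"
              using j c by auto
          qed
          show "finite (\<Union>i\<in>?F. {j \<in> J. pr j p (y i) \<noteq> zero_of (Rs j) p})"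
            using fin D(4) y'(1) by auto
        qed
      qed
      then obtain x where x: "x \<in> elts R p" "\<And>j. j \<in> J ==> pr j p x = pr j p (y (c j))" by blast
      have "h i p x = y i" if i: "i \<in> I" for i
        by (rule decomp_ext[OF d homD(3)[OF h(1) x(1)] y'(1)[OF i]])
           (use h(2)[OF _ x(1)] x(2) y'(2)[OF i] in auto)
      then show ?thesis using x(1) by blast
    qed
  qed
  then show thesis by (rule that)
qed


section \<open>Subquotients\<close>

text \<open>
The monomorphism may be replaced by the inclusion of its image.
\<close>
lemma subquotient_iff:
  fixes M :: "('p::order, 'k, 'v) pmod"
  assumes M: "pmodule K M"
  shows "subquotient K N M \<longleftrightarrow> pmodule K N \<and>
    (\<exists>J e. psubmodule K J M \<and> e \<in> Hom (pmod_sub M J) N \<and> (\<forall>p. e p ` J p = elts N p))"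
proof
  assume "subquotient K N M"
  then obtain M' :: "('p, 'k, 'v) pmod" and m e where N: "pmodule K N" and M': "pmodule K M'"
    and m: "m \<in> Hom M' M" "\<And>p. inj_on (m p) (elts M' p)"
    and e: "e \<in> Hom M' N" "\<And>p. e p ` elts M' p = elts N p"
    by (auto simp: subquotient_def pmod_mono_def pmod_epi_def)
  define J where "J = (\<lambda>p. m p ` elts M' p)"
  have J: "psubmodule K J M" unfolding J_def by (rule psub_image[OF m(1) psub_full[OF M']])
  have m': "m \<in> Hom M' (pmod_sub M J)"
    by (rule hom_sub_cod[OF m(1) J]) (simp add: J_def)
  obtain g where g: "g \<in> Hom (pmod_sub M J) M'"
    "\<And>p. bij_betw (g p) (elts (pmod_sub M J) p) (elts M' p)"
    by (rule hom_inverse[OF M' m']) (use m(2) in \<open>auto simp: bij_betw_def J_def\<close>)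
  have "(\<lambda>x. e p (g p x)) ` J p = elts N p" for p
    using g(2)[of p] e(2)[of p] by (auto simp: bij_betw_def image_image[symmetric])
  then show "pmodule K N \<and>
    (\<exists>J e. psubmodule K J M \<and> e \<in> Hom (pmod_sub M J) N \<and> (\<forall>p. e p ` J p = elts N p))"
    using N J hom_comp[OF g(1) e(1)] by (intro conjI exI[of _ J] exI[of _ "\<lambda>p x. e p (g p x)"]) auto
next
  assume "pmodule K N \<and>
    (\<exists>J e. psubmodule K J M \<and> e \<in> Hom (pmod_sub M J) N \<and> (\<forall>p. e p ` J p = elts N p))"
  then obtain J e where N: "pmodule K N" and J: "psubmodule K J M"
    and e: "e \<in> Hom (pmod_sub M J) N" "\<And>p. e p ` J p = elts N p" by blast
  have "(\<lambda>p x. x) \<in> pmod_mono K (pmod_sub M J) M"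
    using hom_sub_dom[OF hom_id[OF M] J] by (simp add: pmod_mono_def)
  moreover have "e \<in> pmod_epi K (pmod_sub M J) N" using e by (simp add: pmod_epi_def)
  ultimately show "subquotient K N M"
    unfolding subquotient_def using N pmodule_sub[OF M J] by blast
qed

text \<open>
If \<open>S\<close> is a quotient of \<open>I \<subseteq> T\<close> and \<open>R\<close> is a quotient of \<open>J \<subseteq> S\<close>, then \<open>R\<close> is a quotient of the preimage
of \<open>J\<close> in \<open>I\<close>.
\<close>
lemma subquotient_trans:
  assumes T: "pmodule K T" and SQ: "subquotient K R S" "subquotient K S T"
  shows "subquotient K R T"
proof -
  have S: "pmodule K S" using SQ(2) by (simp add: subquotient_def)
  obtain J e where R: "pmodule K R" and J: "psubmodule K J S"
    and e: "e \<in> Hom (pmod_sub S J) R" "\<And>p. e p ` J p = elts R p"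
    using SQ(1) unfolding subquotient_iff[OF S] by blast
  obtain I f where I: "psubmodule K I T"
    and f: "f \<in> Hom (pmod_sub T I) S" "\<And>p. f p ` I p = elts S p"
    using SQ(2) unfolding subquotient_iff[OF T] by blast
  define L where "L = (\<lambda>p. {x \<in> I p. f p x \<in> J p})"
  have L': "psubmodule K L (pmod_sub T I)"
    using psub_preimage[OF pmodule_sub[OF T I] f(1) J] by (simp add: L_def)
  then have L: "psubmodule K L T" using psub_sub_iff[OF I] by blast
  have f': "f \<in> Hom (pmod_sub T L) (pmod_sub S J)"
    using hom_sub_cod[OF hom_sub_dom[OF f(1) L'] J] by (simp add: L_def pmod_sub_def)
  have "(\<lambda>x. e p (f p x)) ` L p = elts R p" for p
  proof -
    have "f p ` L p = J p" using f(2)[of p] psubD(3)[OF J, of _ p] by (auto simp: L_def image_iff)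
    then show ?thesis using e(2)[of p] by (metis image_image)
  qed
  then show ?thesis
    unfolding subquotient_iff[OF T] using R L hom_comp[OF f' e(1)] by blast
qed

lemma subquotient_of_iso:
  assumes M: "pmodule K M" and N: "pmodule K N" and iso: "pmod_isomorphic K M N"
  shows "subquotient K N M"
proof -
  obtain f where f: "f \<in> Hom M N" "\<And>p. bij_betw (f p) (elts M p) (elts N p)"
    using iso by (auto simp: pmod_isomorphic_def)
  show ?thesis
    unfolding subquotient_iff[OF M]
    using f(2)
    by (intro conjI N exI[of _ "\<lambda>p. elts M p"] exI[of _ f] psub_full[OF M]
        hom_sub_dom[OF f(1) psub_full[OF M]]) (simp add: bij_betw_def)
qed

text \<open>
If \<open>Rs j\<close> is a quotient of \<open>I j \<subseteq> Ss j\<close> for each \<open>j\<close>, take the submodule of those elements of \<open>S\<close> whose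
\<open>j\<close>-th component lies in \<open>I j\<close>, and map it to \<open>R\<close> componentwise. For surjectivity the preimages of the
zero components are chosen to be zero, which keeps the support finite.
\<close>
lemma subquotient_sum:
  assumes dR: "decomp R J Rs pr" and dS: "decomp S J Ss qr"
    and sq: "\<And>j. j \<in> J ==> subquotient K (Rs j) (Ss j)"
  shows "subquotient K R S"
proof -
  note R = decompD[OF dR] and S = decompD[OF dS]
  have "\<exists>I e. psubmodule K I (Ss j) \<and> e \<in> Hom (pmod_sub (Ss j) I) (Rs j) \<and>
      (\<forall>p. e p ` I p = elts (Rs j) p)" if "j \<in> J" for j
    using sq[OF that] subquotient_iff[OF S(2)[OF that]] by blast
  then obtain I e where I: "\<And>j. j \<in> J ==> psubmodule K (I j) (Ss j)"
    and e: "\<And>j. j \<in> J ==> e j \<in> Hom (pmod_sub (Ss j) (I j)) (Rs j)"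
      "\<And>j p. j \<in> J ==> e j p ` I j p = elts (Rs j) p" by metis
  define L where "L = (\<lambda>p. {x \<in> elts S p. \<forall>j\<in>J. x \<in> {x \<in> elts S p. qr j p x \<in> I j p}})"
  have L: "psubmodule K L S"
    unfolding L_def by (rule psub_Inter[OF S(1) psub_preimage[OF S(1) S(3) I]])
  have Lq: "x \<in> elts S p" "j \<in> J ==> qr j p x \<in> I j p" if "x \<in> L p" for x p j
    using that by (auto simp: L_def)
  have hq: "qr j \<in> Hom (pmod_sub S L) (pmod_sub (Ss j) (I j))" if j: "j \<in> J" for j
    by (rule hom_sub_cod[OF hom_sub_dom[OF S(3)[OF j] L] I[OF j]]) (use j Lq(2) in auto)
  have e0: "e j p (zero_of (Ss j) p) = zero_of (Rs j) p" if "j \<in> J" for j p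
    using homD(6)[OF e(1)[OF that], of p] by simp
  obtain h where h: "h \<in> Hom (pmod_sub S L) R"
    "\<And>j p x. j \<in> J ==> x \<in> elts (pmod_sub S L) p ==> pr j p (h p x) = e j p (qr j p x)"
  proof (rule decomp_lift[OF dR pmodule_sub[OF S(1) L], of "\<lambda>j p x. e j p (qr j p x)"])
    show "(\<lambda>p x. e j p (qr j p x)) \<in> Hom (pmod_sub S L) (Rs j)" if "j \<in> J" for j
      by (rule hom_comp[OF hq[OF that] e(1)[OF that]])
    show "finite {j \<in> J. e j p (qr j p x) \<noteq> zero_of (Rs j) p}"
      if x: "x \<in> elts (pmod_sub S L) p" for p x
      by (rule finite_subset[OF _ S(4)[of x p]]) (use x Lq(1) e0 in auto)
  qed blast
  have "h p ` L p = elts R p" for p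
  proof (intro equalityI subsetI)
    fix y assume "y \<in> h p ` L p" then show "y \<in> elts R p" using homD(3)[OF h(1), of _ p] by auto
  next
    fix y assume y: "y \<in> elts R p"
    have "\<exists>x\<in>I j p. e j p x = pr j p y \<and> (pr j p y = zero_of (Rs j) p \<longrightarrow> x = zero_of (Ss j) p)"
      if j: "j \<in> J" for j
    proof (cases "pr j p y = zero_of (Rs j) p")
      case True
      then show ?thesis using e0[OF j] subspaceD(3)[OF psubD(1)[OF I[OF j]]] by auto
    next
      case False
      then show ?thesis using e(2)[OF j, of p] homD(3)[OF R(3)[OF j] y] by (metis imageE)
    qed
    then obtain x where x: "\<And>j. j \<in> J ==> x j \<in> I j p" "\<And>j. j \<in> J ==> e j p (x j) = pr j p y"
      "\<And>j. j \<in> J ==> pr j p y = zero_of (Rs j) p ==> x j = zero_of (Ss j) p" by metis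
    have "\<exists>z\<in>elts S p. \<forall>j\<in>J. qr j p z = x j"
    proof (rule S(6))
      show "x j \<in> elts (Ss j) p" if "j \<in> J" for j using psubD(3)[OF I[OF that] x(1)[OF that]] .
      show "finite {j \<in> J. x j \<noteq> zero_of (Ss j) p}"
        by (rule finite_subset[OF _ R(4)[OF y]]) (use x(3) in auto)
    qed
    then obtain z where z: "z \<in> elts S p" "\<And>j. j \<in> J ==> qr j p z = x j" by blast
    then have zL: "z \<in> L p" using x(1) by (auto simp: L_def)
    have "h p z = y"
      by (rule decomp_ext[OF dR, where p = p]) (use homD(3)[OF h(1), of z p] zL y h(2)[of _ z p] z x(2) in auto)
    then show "y \<in> h p ` L p" using zL by blast
  qed
  then show ?thesis unfolding subquotient_iff[OF S(1)] using R(1) L h(1) by blast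
qed


section \<open>Pointwise finite-dimensional modules\<close>

lemma pfdD:
  assumes "pfd K M" shows "pmodule K M" "fd (Sp M p)"
  using assms by (auto simp: pfd_def)

lemma pfd_sub:
  assumes "pfd K M" "psubmodule K J M" shows "pfd K (pmod_sub M J)"
  using assms(1) pmodule_sub[OF _ assms(2)] fd_sub(1)[OF pmodD(1) _ psubD(1)[OF assms(2)]]
  by (simp add: pfd_def)

lemma pfd_summand:
  assumes d: "decomp M I N pr" and M: "pfd K M" and i: "i \<in> I"
  shows "pfd K (N i)"
proof -
  note D = decompD[OF d]
  obtain h where h: "h \<in> Hom (N i) M"
    "\<And>p x. x \<in> elts (N i) p ==> pr i p (h p x) = x" by (rule decomp_inj[OF d i]) blast
  have "fd (Sp (N i) p)" for p
  proof (rule fd_image[OF homD(1)[OF D(3)[OF i]] pfdD(2)[OF M]], intro equalityI subsetI)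
    fix x assume "x \<in> elts (N i) p"
    then show "x \<in> pr i p ` elts M p" using h(2) homD(3)[OF h(1)] by (metis imageI)
  qed (use homD(3)[OF D(3)[OF i]] in auto)
  then show ?thesis using D(2)[OF i] by (simp add: pfd_def)
qed


section \<open>Quotients\<close>

lemma a_coset_facts:
  assumes W: "subsp W V"
  shows "x \<in> carrier V ==> x \<in> W +>\<^bsub>V\<^esub> x"
    and "x \<in> carrier V ==> y \<in> W +>\<^bsub>V\<^esub> x ==> W +>\<^bsub>V\<^esub> y = W +>\<^bsub>V\<^esub> x"
    and "x \<in> carrier V ==> y \<in> carrier V ==> (W +>\<^bsub>V\<^esub> x) <+>\<^bsub>V\<^esub> (W +>\<^bsub>V\<^esub> y) = W +>\<^bsub>V\<^esub> (x \<oplus>\<^bsub>V\<^esub> y)"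
    and "W +>\<^bsub>V\<^esub> \<zero>\<^bsub>V\<^esub> = W"
    and "x \<in> carrier V ==> y \<in> W +>\<^bsub>V\<^esub> x \<longleftrightarrow> (\<exists>w\<in>W. y = w \<oplus>\<^bsub>V\<^esub> x)"
proof -
  note D = subspaceD[OF W]
  interpret V: vectorspace K V by (rule D(1))
  have "\<ominus>\<^bsub>V\<^esub> w \<in> W" if "w \<in> W" for w
    using V.smult_minus_1[OF D(4)[OF that]] D(6)[OF _ that, of "\<ominus>\<^bsub>K\<^esub> \<one>\<^bsub>K\<^esub>"] by simp
  then have "subgroup W (add_monoid V)"
    using D by (auto simp: subgroup_def a_inv_def)
  then interpret W: additive_subgroup W V by (rule additive_subgroupI)
  interpret W: abelian_subgroup W V by (rule abelian_subgroupI3) unfold_locales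
  show 5: "y \<in> W +>\<^bsub>V\<^esub> x \<longleftrightarrow> (\<exists>w\<in>W. y = w \<oplus>\<^bsub>V\<^esub> x)" for x y
    by (auto simp: a_r_coset_def')
  show "x \<in> carrier V ==> x \<in> W +>\<^bsub>V\<^esub> x" by (rule W.a_rcos_self)
  show "x \<in> carrier V ==> y \<in> W +>\<^bsub>V\<^esub> x ==> W +>\<^bsub>V\<^esub> y = W +>\<^bsub>V\<^esub> x"
    using W.a_repr_independence'[symmetric] .
  show "x \<in> carrier V ==> y \<in> carrier V ==> (W +>\<^bsub>V\<^esub> x) <+>\<^bsub>V\<^esub> (W +>\<^bsub>V\<^esub> y) = W +>\<^bsub>V\<^esub> (x \<oplus>\<^bsub>V\<^esub> y)"
    by (rule W.a_rcos_sum)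
  show "W +>\<^bsub>V\<^esub> \<zero>\<^bsub>V\<^esub> = W" using D(2) by (auto simp: a_r_coset_def')
qed

text \<open>
The union in the definition of an operation on cosets is taken over equal cosets.
\<close>
lemma coset_UNION:
  assumes W: "subsp W V" and U: "subsp U T"
    and f: "linear_map K V T f" and fW: "\<And>w. w \<in> W ==> f w \<in> U" and x: "x \<in> carrier V"
  shows "(\<Union>y\<in>W +>\<^bsub>V\<^esub> x. U +>\<^bsub>T\<^esub> f y) = U +>\<^bsub>T\<^esub> f x"
proof -
  have "U +>\<^bsub>T\<^esub> f y = U +>\<^bsub>T\<^esub> f x" if y: "y \<in> W +>\<^bsub>V\<^esub> x" for y
  proof -
    obtain w where w: "w \<in> W" "y = w \<oplus>\<^bsub>V\<^esub> x" using y a_coset_facts(5)[OF W x] by blast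
    then have "f y = f w \<oplus>\<^bsub>T\<^esub> f x" using linear_mapD(4)[OF f subspaceD(4)[OF W w(1)] x] by simp
    then have "f y \<in> U +>\<^bsub>T\<^esub> f x"
      using a_coset_facts(5)[OF U linear_mapD(3)[OF f x]] fW[OF w(1)] by blast
    then show ?thesis using a_coset_facts(2)[OF U linear_mapD(3)[OF f x]] by blast
  qed
  then show ?thesis using a_coset_facts(1)[OF W x] by blast
qed

lemma vs_quot_facts:
  assumes W: "subsp W V"
  shows "linear_map K V (vs_quot V W) (\<lambda>x. W +>\<^bsub>V\<^esub> x)"
    and "(\<lambda>x. W +>\<^bsub>V\<^esub> x) ` carrier V = carrier (vs_quot V W)"
proof -
  note V = subspaceD(1)[OF W]
  show surj: "(\<lambda>x. W +>\<^bsub>V\<^esub> x) ` carrier V = carrier (vs_quot V W)"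
    by (auto simp: vs_quot_def A_RCOSETS_def')
  show "linear_map K V (vs_quot V W) (\<lambda>x. W +>\<^bsub>V\<^esub> x)"
  proof (rule vectorspace_transport(2)[OF V surj])
    fix c x assume "c \<in> carrier K" "x \<in> carrier V"
    then show "W +>\<^bsub>V\<^esub> (c \<odot>\<^bsub>V\<^esub> x) = c \<odot>\<^bsub>vs_quot V W\<^esub> (W +>\<^bsub>V\<^esub> x)"
      using coset_UNION[OF W W linear_scalar[OF V]] subspaceD(6)[OF W] by (simp add: vs_quot_def)
  qed (use a_coset_facts(3,4)[OF W] in \<open>simp_all add: vs_quot_def\<close>)
qed

lemma linear_factor:
  assumes q: "linear_map K V Q q" "q ` carrier V = carrier Q" and h: "linear_map K V W (\<lambda>x. h (q x))"
  shows "linear_map K Q W h"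
proof -
  note Q = linear_mapD[OF q(1)] and H = linear_mapD[OF h]
  have ex: "\<exists>x\<in>carrier V. X = q x" if "X \<in> carrier Q" for X using q(2) that by blast
  show ?thesis
  proof (rule linear_mapI[OF Q(2) H(2)])
    show "h X \<in> carrier W" if "X \<in> carrier Q" for X using ex[OF that] H(3) by blast
    show "h (X \<oplus>\<^bsub>Q\<^esub> Y) = h X \<oplus>\<^bsub>W\<^esub> h Y" if XY: "X \<in> carrier Q" "Y \<in> carrier Q" for X Y
    proof -
      obtain x y where "x \<in> carrier V" "X = q x" "y \<in> carrier V" "Y = q y" using ex XY by meson
      then show ?thesis using H(4)[of x y] Q(4)[of x y] by simp
    qed
    show "h (c \<odot>\<^bsub>Q\<^esub> X) = c \<odot>\<^bsub>W\<^esub> h X" if c: "c \<in> carrier K" and X: "X \<in> carrier Q" for c X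
    proof -
      obtain x where "x \<in> carrier V" "X = q x" using ex X by meson
      then show ?thesis using H(5)[of c x] Q(5)[of c x] c by simp
    qed
  qed
qed

lemma quot_facts:
  assumes P: "pmodule K N" and J: "psubmodule K J N"
  shows "pmodule K (pmod_quot N J)"
    and "(\<lambda>p x. J p +>\<^bsub>Sp N p\<^esub> x) \<in> Hom N (pmod_quot N J)"
    and "(\<lambda>x. J p +>\<^bsub>Sp N p\<^esub> x) ` elts N p = elts (pmod_quot N J) p"
    and "zero_of (pmod_quot N J) p = J p"
proof -
  note V = pmodD(1)[OF P]
  let ?Q = "pmod_quot N J"
  let ?q = "\<lambda>p x. J p +>\<^bsub>Sp N p\<^esub> x"
  have S: "Sp ?Q p = vs_quot (Sp N p) (J p)" for p by (simp add: pmod_quot_def)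
  show "zero_of ?Q p = J p" by (simp add: S vs_quot_def)
  have q: "linear_map K (Sp N p) (Sp ?Q p) (?q p)" "?q p ` elts N p = elts ?Q p" for p
    using vs_quot_facts[OF psubD(1)[OF J]] S by simp_all
  show "?q p ` elts N p = elts ?Q p" by (rule q(2))
  have ex: "\<exists>x\<in>elts N p. X = ?q p x" if "X \<in> elts ?Q p" for p X using q(2)[of p] that by blast
  have Mpq: "Mp ?Q p r (?q p x) = ?q r (Mp N p r x)" if "p \<le> r" "x \<in> elts N p" for p r x
    using coset_UNION[OF psubD(1)[OF J] psubD(1)[OF J] pmodD(2)[OF P that(1)] _ that(2)]
      psubD(2)[OF J that(1)] by (simp add: pmod_quot_def)
  show "?q \<in> Hom N ?Q" by (rule homI[OF q(1)]) (simp add: Mpq)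
  show "pmodule K ?Q"
    unfolding pmodule_def
  proof (intro conjI allI impI)
    show "vectorspace K (Sp ?Q p)" for p using linear_mapD(2)[OF q(1)] .
    show "linear_map K (Sp ?Q p) (Sp ?Q r) (Mp ?Q p r)" if "p \<le> r" for p r
    proof (rule linear_factor[OF q])
      have qM: "linear_map K (Sp N p) (Sp ?Q r) (\<lambda>x. ?q r (Mp N p r x))"
        by (rule linear_comp[OF pmodD(2)[OF P that] q(1)])
      show "linear_map K (Sp N p) (Sp ?Q r) (\<lambda>x. Mp ?Q p r (?q p x))"
        using linear_mapD[OF qM] Mpq[OF that] V[of p] by (intro linear_mapI) auto
    qed
    show "Mp ?Q p p X = X" if "X \<in> elts ?Q p" for p X
      using ex[OF that] Mpq[OF order_refl] pmodD(4)[OF P] by auto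
    show "Mp ?Q r s (Mp ?Q p r X) = Mp ?Q p s X"
      if pr: "p \<le> r" and rs: "r \<le> s" and X: "X \<in> elts ?Q p" for p r s X
    proof -
      obtain x where x: "x \<in> elts N p" "X = ?q p x" using ex[OF X] by blast
      then show ?thesis
        using Mpq[OF pr x(1)] Mpq[OF rs pmodD(3)[OF P pr x(1)]]
          Mpq[OF order_trans[OF pr rs] x(1)] pmodD(5)[OF P pr rs x(1)] by simp
    qed
  qed
qed

lemma pfd_quot:
  assumes N: "pfd K N" and J: "psubmodule K J N"
  shows "pfd K (pmod_quot N J)"
  using quot_facts(1)[OF pfdD(1)[OF N] J]
    fd_image[OF homD(1)[OF quot_facts(2)[OF pfdD(1)[OF N] J]] pfdD(2)[OF N] quot_facts(3)[OF pfdD(1)[OF N] J]]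
  by (simp add: pfd_def)


section \<open>Endomorphisms of indecomposable modules\<close>

lemma indecomposableD:
  assumes "indecomposable K M"
  shows "pmodule K M" "\<exists>p. elts M p \<noteq> {zero_of M p}"
  using assms by (auto simp: indecomposable_def)

lemma indecomposable_split:
  assumes M: "indecomposable K M" and A: "psubmodule K A M" and B: "psubmodule K B M"
    and int: "\<And>p x. x \<in> A p ==> x \<in> B p ==> x = zero_of M p"
    and sum: "\<And>p x. x \<in> elts M p ==> \<exists>a\<in>A p. \<exists>b\<in>B p. x = a \<oplus>\<^bsub>Sp M p\<^esub> b"
  shows "(\<forall>p. A p = {zero_of M p}) \<or> (\<forall>p. B p = {zero_of M p})"
proof -
  note V = pmodD(1)[OF indecomposableD(1)[OF M]]
  have "A p \<inter> B p = {zero_of M p}" for p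
    using int subspaceD(3)[OF psubD(1)[OF A]] subspaceD(3)[OF psubD(1)[OF B]] by blast
  moreover have "A p <+>\<^bsub>Sp M p\<^esub> B p = elts M p" for p
    using sum[of _ p] psubD(3)[OF A, of _ p] psubD(3)[OF B, of _ p] V[of p] by (auto simp: set_add_def')
  ultimately show ?thesis using M A B unfolding indecomposable_def by blast
qed

lemma hom_funpow:
  assumes "pmodule K M" "f \<in> Hom M M"
  shows "(\<lambda>p. f p ^^ n) \<in> Hom M M"
proof (induction n)
  case 0 then show ?case using hom_id[OF assms(1)] by (simp add: id_def)
next
  case (Suc n) then show ?case using hom_comp[OF Suc assms(2)] by (simp add: comp_def)
qed

definition inj_hom :: "('p, 'k, 'v) pmod => ('p, 'k, 'w) pmod => ('p => 'v => 'w) => bool" where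
  "inj_hom M N f \<longleftrightarrow> (\<forall>p. \<forall>x\<in>elts M p. f p x = zero_of N p \<longrightarrow> x = zero_of M p)"

text \<open>
The exponent may depend on the point and on the element: the dimensions of the spaces of \<open>M\<close> need not
be bounded.
\<close>
definition nil_hom :: "('p, 'k, 'v) pmod => ('p => 'v => 'v) => bool" where
  "nil_hom M f \<longleftrightarrow> (\<forall>p. \<forall>x\<in>elts M p. \<exists>n. (f p ^^ n) x = zero_of M p)"

lemma linear_funpow:
  assumes "linear_map K V V f" shows "linear_map K V V (f ^^ n)"
proof (induction n)
  case 0 then show ?case using linear_id[OF linear_mapD(1)[OF assms]] by (simp add: id_def)
next
  case (Suc n) then show ?case using linear_comp[OF Suc assms] by (simp add: comp_def)
qed

text \<open>
Choose \<open>n\<close> such that the dimension of the image of \<open>f\<^sup>n\<close> is minimal. From then on the images are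
constant, so \<open>f\<close> is surjective, hence injective, on the image of \<open>f\<^sup>n\<close>; and \<open>V\<close> is the sum of that image
and the kernel of \<open>f\<^sup>n\<close>.
\<close>
lemma fitting_pointwise:
  assumes f: "linear_map K V V f" and V: "fd V"
  obtains n where "\<And>x m. x \<in> carrier V ==> (f ^^ n) x \<in> (f ^^ m) ` carrier V"
    and "\<And>x m. x \<in> (f ^^ n) ` carrier V ==> (f ^^ m) x = \<zero>\<^bsub>V\<^esub> ==> x = \<zero>\<^bsub>V\<^esub>"
    and "\<And>x. x \<in> carrier V ==> \<exists>y\<in>carrier V. (f ^^ n) (x \<ominus>\<^bsub>V\<^esub> (f ^^ n) y) = \<zero>\<^bsub>V\<^esub>"
proof -
  have VV: "vectorspace K V" using linear_mapD(1)[OF f] .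
  note L = linear_funpow[OF f]
  let ?im = "\<lambda>m. (f ^^ m) ` carrier V"
  have sub: "subsp (?im m) V" for m
    by (rule subspace_image[OF L subspace_carrier[OF VV]])
  have desc: "?im m \<subseteq> ?im n" if "n \<le> m" for m n
  proof
    fix y assume "y \<in> ?im m"
    then obtain x where x: "x \<in> carrier V" "y = (f ^^ m) x" by blast
    have "(f ^^ m) x = (f ^^ n) ((f ^^ (m - n)) x)"
      using that funpow_add[of n "m - n" f] by simp
    then show "y \<in> ?im n" using x linear_mapD(3)[OF L[of "m - n"] x(1)] by auto
  qed
  obtain n where n: "\<And>m. sdim V (?im n) \<le> sdim V (?im m)"
    using ex_has_least_nat[of "\<lambda>_. True" 0 "\<lambda>m. sdim V (?im m)"] by auto
  have stab: "?im m = ?im n" if "n \<le> m" for m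
    using dm_mono[OF VV V sub sub desc[OF that]] n[of m] by simp
  let ?W = "V\<lparr>carrier := ?im n\<rparr>"
  have fim: "f ` ?im n = ?im (Suc n)" by (simp add: image_image)
  have fW: "linear_map K ?W ?W f"
    using linear_restrict_cod[OF linear_restrict_dom[OF f sub[of n]] sub[of n]] fim stab[of "Suc n"]
    by auto
  have inj: "\<forall>x\<in>?im n. f x = \<zero>\<^bsub>V\<^esub> \<longrightarrow> x = \<zero>\<^bsub>V\<^esub>"
    using inj_iff_surj[OF fW fd_sub(1)[OF VV V sub]] fim stab[of "Suc n"] by simp
  have inj': "(f ^^ m) x = \<zero>\<^bsub>V\<^esub> ==> x = \<zero>\<^bsub>V\<^esub>" if "x \<in> ?im n" for x m
    using that
  proof (induction m)
    case (Suc m)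
    have "(f ^^ m) x \<in> ?im n"
    proof -
      obtain y where "y \<in> carrier V" "x = (f ^^ n) y" using Suc.prems by blast
      then have "(f ^^ m) x \<in> ?im (m + n)" by (auto simp: funpow_add)
      then show ?thesis using desc[of n "m + n"] by auto
    qed
    then have "(f ^^ m) x = \<zero>\<^bsub>V\<^esub>" using bspec[OF inj, of "(f ^^ m) x"] Suc.prems(1) by simp
    then show ?case using Suc by blast
  qed simp
  have "\<exists>y\<in>carrier V. (f ^^ n) (x \<ominus>\<^bsub>V\<^esub> (f ^^ n) y) = \<zero>\<^bsub>V\<^esub>" if x: "x \<in> carrier V" for x
  proof -
    have "(f ^^ n) x \<in> ?im (n + n)" using stab[of "n + n"] x by auto
    then obtain y where y: "y \<in> carrier V" "(f ^^ n) x = (f ^^ n) ((f ^^ n) y)"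
      by (auto simp: funpow_add)
    then show ?thesis
      using linear_mapD(7)[OF L x linear_mapD(3)[OF L y(1)], of n n] linear_mapD(3)[OF L] x VV by auto
  qed
  moreover have "(f ^^ n) x \<in> ?im m" if "x \<in> carrier V" for x m
    using that stab[of m] desc[of m n] by (cases "n \<le> m") auto
  ultimately show thesis using inj' that by blast
qed

text \<open>
The elements killed by some power of \<open>f\<close>, and the elements lying in the image of every power of \<open>f\<close>, are
complementary submodules by the previous lemma; one of them is zero.
\<close>
lemma fitting:
  assumes ind: "indecomposable K X" and X: "pfd K X" and f: "f \<in> Hom X X"
  shows "inj_hom X X f \<or> nil_hom X f"
proof -
  note P = pfdD(1)[OF X] and V = pmodD(1)[OF pfdD(1)[OF X]]
  note F = homD(1)[OF f] and L = hom_funpow[OF P f]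
  define A where "A = (\<lambda>p. {x \<in> elts X p. \<exists>n. (f p ^^ n) x = zero_of X p})"
  define B where "B = (\<lambda>p. {x \<in> elts X p. \<forall>n\<in>(UNIV::nat set). x \<in> (f p ^^ n) ` elts X p})"
  have zero: "(f p ^^ m) (zero_of X p) = zero_of X p" for p m using homD(6)[OF L] .
  have up: "(f p ^^ (m + n)) x = zero_of X p" if "(f p ^^ n) x = zero_of X p" for p m n x
    using that zero by (simp add: funpow_add)
  have A: "psubmodule K A X"
  proof (rule psubI)
    fix p show "subsp (A p) (Sp X p)"
    proof (rule subspaceI)
      show "zero_of X p \<in> A p" using V zero by (auto simp: A_def)
      fix x y assume "x \<in> A p" "y \<in> A p"
      then obtain m n where xy: "x \<in> elts X p" "y \<in> elts X p"
        "(f p ^^ m) x = zero_of X p" "(f p ^^ n) y = zero_of X p" by (auto simp: A_def)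
      have "(f p ^^ (n + m)) (x \<oplus>\<^bsub>Sp X p\<^esub> y) = zero_of X p"
        using homD(4)[OF L xy(1,2), of "n + m"] up[OF xy(3), of n] up[OF xy(4), of m] V[of p]
        by (simp add: add.commute)
      then show "x \<oplus>\<^bsub>Sp X p\<^esub> y \<in> A p" using xy V[of p] by (auto simp: A_def)
    next
      fix c x assume c: "c \<in> carrier K" and "x \<in> A p"
      then obtain n where x: "x \<in> elts X p" "(f p ^^ n) x = zero_of X p" by (auto simp: A_def)
      then have "(f p ^^ n) (c \<odot>\<^bsub>Sp X p\<^esub> x) = zero_of X p"
        using homD(5)[OF L c x(1), of n] V[of p] c by simp
      then show "c \<odot>\<^bsub>Sp X p\<^esub> x \<in> A p" using V[of p] c x(1) by (auto simp: A_def)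
    qed (use V in \<open>auto simp: A_def\<close>)
  next
    fix p q x assume pq: "p \<le> q" and "x \<in> A p"
    then obtain n where x: "x \<in> elts X p" "(f p ^^ n) x = zero_of X p" by (auto simp: A_def)
    then have "(f q ^^ n) (Mp X p q x) = zero_of X q"
      using homD(2)[OF L pq x(1), of n] linear_mapD(6)[OF pmodD(2)[OF P pq]] by simp
    then show "Mp X p q x \<in> A q" using pmodD(3)[OF P pq x(1)] by (auto simp: A_def)
  qed
  have B: "psubmodule K B X"
    unfolding B_def by (rule psub_Inter[OF P]) (rule psub_image[OF L psub_full[OF P]])
  have split: "(\<forall>p. A p = {zero_of X p}) \<or> (\<forall>p. B p = {zero_of X p})"
  proof (rule indecomposable_split[OF ind A B])
    fix p
    obtain n where n: "\<And>x m. x \<in> elts X p ==> (f p ^^ n) x \<in> (f p ^^ m) ` elts X p"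
      "\<And>x m. x \<in> (f p ^^ n) ` elts X p ==> (f p ^^ m) x = zero_of X p ==> x = zero_of X p"
      "\<And>x. x \<in> elts X p ==>
        \<exists>y\<in>elts X p. (f p ^^ n) (x \<ominus>\<^bsub>Sp X p\<^esub> (f p ^^ n) y) = zero_of X p"
      by (rule fitting_pointwise[OF F pfdD(2)[OF X]]) blast
    show "x = zero_of X p" if "x \<in> A p" "x \<in> B p" for x
      using that n(2)[of x] by (auto simp: A_def B_def)
    show "\<exists>a\<in>A p. \<exists>b\<in>B p. x = a \<oplus>\<^bsub>Sp X p\<^esub> b" if x: "x \<in> elts X p" for x
    proof -
      obtain y where y: "y \<in> elts X p" "(f p ^^ n) (x \<ominus>\<^bsub>Sp X p\<^esub> (f p ^^ n) y) = zero_of X p"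
        using n(3)[OF x] by blast
      let ?b = "(f p ^^ n) y"
      have b: "?b \<in> elts X p" using homD(3)[OF L y(1)] .
      have "?b \<in> B p" using b n(1)[OF y(1)] by (simp add: B_def)
      moreover have "x \<ominus>\<^bsub>Sp X p\<^esub> ?b \<in> A p" using y(2) x b V[of p] by (auto simp: A_def)
      moreover have "x = (x \<ominus>\<^bsub>Sp X p\<^esub> ?b) \<oplus>\<^bsub>Sp X p\<^esub> ?b" using x b V[of p] by simp
      ultimately show ?thesis by blast
    qed
  qed
  then show ?thesis
  proof
    assume A0: "\<forall>p. A p = {zero_of X p}"
    have "inj_hom X X f"
      unfolding inj_hom_def
    proof (intro allI ballI impI)
      fix p x assume "x \<in> elts X p" "f p x = zero_of X p"
      then have "x \<in> A p" by (auto simp: A_def intro!: exI[of _ "Suc 0"])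
      then show "x = zero_of X p" using A0 by blast
    qed
    then show ?thesis ..
  next
    assume B0: "\<forall>p. B p = {zero_of X p}"
    have "nil_hom X f"
      unfolding nil_hom_def
    proof (intro allI ballI)
      fix p x assume x: "x \<in> elts X p"
      obtain n where "\<And>x m. x \<in> elts X p ==> (f p ^^ n) x \<in> (f p ^^ m) ` elts X p"
        by (rule fitting_pointwise[OF F pfdD(2)[OF X]]) blast
      then have "(f p ^^ n) x \<in> B p" using homD(3)[OF L x] x by (simp add: B_def)
      then show "\<exists>n. (f p ^^ n) x = zero_of X p" using B0 by blast
    qed
    then show ?thesis ..
  qed
qed

lemma inj_hom_bij:
  assumes X: "pfd K X" and f: "f \<in> Hom X X" and inj: "inj_hom X X f"
  shows "bij_betw (f p) (elts X p) (elts X p)"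
  using inj_iff_surj[OF homD(1)[OF f] pfdD(2)[OF X], of p] linear_inj_iff[OF homD(1)[OF f], of p] inj
  by (auto simp: bij_betw_def inj_hom_def)

lemma nil_kernel:
  assumes f: "linear_map K V V f" and x: "x \<in> carrier V" "x \<noteq> \<zero>\<^bsub>V\<^esub>" "(f ^^ n) x = \<zero>\<^bsub>V\<^esub>"
  shows "\<exists>y\<in>carrier V. y \<noteq> \<zero>\<^bsub>V\<^esub> \<and> f y = \<zero>\<^bsub>V\<^esub>"
  using x(3)
proof (induction n)
  case 0 then show ?case using x by simp
next
  case (Suc n)
  then show ?case using linear_mapD(3)[OF linear_funpow[OF f] x(1), of n] by (cases "(f ^^ n) x = \<zero>\<^bsub>V\<^esub>") auto
qed

context
  fixes X :: "('p::order, 'k, 'v) pmod"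
  assumes ind: "indecomposable K X" and X: "pfd K X"
begin

text \<open>
The nilpotent endomorphisms, which by Fitting's lemma are exactly those that are not invertible. The
next lemmas show that they form the radical of the local ring of endomorphisms of \<open>X\<close>.
\<close>
definition rad :: "('p => 'v => 'v) set" where
  "rad = {f \<in> Hom X X. nil_hom X f}"

lemma rad_hom: "f \<in> rad ==> f \<in> Hom X X"
  by (simp add: rad_def)

lemma nil_not_inj: "f \<in> rad ==> \<not> inj_hom X X f"
proof
  assume f: "f \<in> rad" and inj: "inj_hom X X f"
  obtain p x where x: "x \<in> elts X p" "x \<noteq> zero_of X p"
    using indecomposableD(2)[OF ind] vs_closed(1)[OF pmodD(1)[OF pfdD(1)[OF X]]] by blast
  obtain n where "(f p ^^ n) x = zero_of X p" using f x(1) by (auto simp: rad_def nil_hom_def)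
  from nil_kernel[OF homD(1)[OF rad_hom[OF f]] x this] show False
    using inj by (auto simp: inj_hom_def)
qed

lemma rad_iff: "f \<in> Hom X X ==> f \<in> rad \<longleftrightarrow> \<not> inj_hom X X f"
  using nil_not_inj fitting[OF ind X] by (auto simp: rad_def)

lemma rad_left:
  assumes f: "f \<in> rad" and g: "g \<in> Hom X X"
  shows "(\<lambda>p x. g p (f p x)) \<in> rad"
proof -
  have "\<not> inj_hom X X (\<lambda>p x. g p (f p x))"
    using nil_not_inj[OF f] homD(6)[OF g] unfolding inj_hom_def by metis
  then show ?thesis using rad_iff[OF hom_comp[OF rad_hom[OF f] g]] by simp
qed

text \<open>
If \<open>f + g\<close> had an inverse \<open>u\<close>, then \<open>u f + u g = 1\<close> with both summands nilpotent. On a nonzero element of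
the kernel of \<open>u f\<close> the endomorphism \<open>u g\<close> would then be the identity.
\<close>
lemma rad_add:
  assumes f: "f \<in> rad" and g: "g \<in> rad"
  shows "(\<lambda>p x. f p x \<oplus>\<^bsub>Sp X p\<^esub> g p x) \<in> rad"
proof (rule ccontr)
  note P = pfdD(1)[OF X]
  let ?s = "\<lambda>p x. f p x \<oplus>\<^bsub>Sp X p\<^esub> g p x"
  have s: "?s \<in> Hom X X" by (rule hom_add[OF P rad_hom[OF f] rad_hom[OF g]])
  assume "?s \<notin> rad"
  then have inj: "inj_hom X X ?s" using rad_iff[OF s] by blast
  obtain u where u: "u \<in> Hom X X" "\<And>p v. v \<in> elts X p ==> u p (?s p v) = v"
    by (rule hom_inverse[OF P s inj_hom_bij[OF X s inj]]) blast
  have uf: "(\<lambda>p x. u p (f p x)) \<in> rad" and ug: "(\<lambda>p x. u p (g p x)) \<in> rad"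
    using rad_left f g u(1) by auto
  obtain p x where x: "x \<in> elts X p" "x \<noteq> zero_of X p" "u p (f p x) = zero_of X p"
    using nil_not_inj[OF uf] by (auto simp: inj_hom_def)
  have "u p (f p x \<oplus>\<^bsub>Sp X p\<^esub> g p x) = u p (f p x) \<oplus>\<^bsub>Sp X p\<^esub> u p (g p x)"
    using homD(4)[OF u(1)] homD(3)[OF rad_hom[OF f] x(1)] homD(3)[OF rad_hom[OF g] x(1)] by blast
  then have fixed: "u p (g p x) = x"
    using u(2)[OF x(1)] x(3) homD(3)[OF rad_hom[OF ug] x(1)] pmodD(1)[OF P] by simp
  have "((\<lambda>x. u p (g p x)) ^^ n) x = x" for n by (induction n) (simp_all add: fixed)
  then show False using ug x(1,2) unfolding rad_def nil_hom_def by force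
qed

lemma one_minus_rad:
  assumes f: "f \<in> rad"
  obtains u where "u \<in> Hom X X" "\<And>p v. v \<in> elts X p ==> u p (v \<ominus>\<^bsub>Sp X p\<^esub> f p v) = v"
proof -
  note P = pfdD(1)[OF X]
  let ?s = "\<lambda>p x. x \<ominus>\<^bsub>Sp X p\<^esub> f p x"
  have s: "?s \<in> Hom X X" by (rule hom_minus[OF P hom_id[OF P] rad_hom[OF f]])
  have inj: "inj_hom X X ?s"
    unfolding inj_hom_def
  proof (intro allI ballI impI)
    fix p x assume x: "x \<in> elts X p" "x \<ominus>\<^bsub>Sp X p\<^esub> f p x = zero_of X p"
    then have fx: "f p x = x" using pmodD(1)[OF P] homD(3)[OF rad_hom[OF f] x(1)] by simp
    have "(f p ^^ n) x = x" for n by (induction n) (simp_all add: fx)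
    then show "x = zero_of X p" using f x(1) unfolding rad_def nil_hom_def by force
  qed
  show thesis by (rule hom_inverse[OF P s inj_hom_bij[OF X s inj]]) (rule that)
qed

lemma zero_rad: "(\<lambda>p x. zero_of X p) \<in> rad"
  using rad_iff[OF hom_zero[OF pfdD(1)[OF X] pfdD(1)[OF X]]] indecomposableD(2)[OF ind]
    vs_closed(1)[OF pmodD(1)[OF pfdD(1)[OF X]]]
  by (auto simp: inj_hom_def)

lemma hom_scalar: "c \<in> carrier K ==> (\<lambda>p x. c \<odot>\<^bsub>Sp X p\<^esub> x) \<in> Hom X X"
proof (rule homI)
  note P = pfdD(1)[OF X]
  assume c: "c \<in> carrier K"
  show "linear_map K (Sp X p) (Sp X p) (\<lambda>x. c \<odot>\<^bsub>Sp X p\<^esub> x)" for p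
    by (rule linear_scalar[OF pmodD(1)[OF P] c])
  show "p \<le> q ==> v \<in> elts X p ==>
      c \<odot>\<^bsub>Sp X q\<^esub> Mp X p q v = Mp X p q (c \<odot>\<^bsub>Sp X p\<^esub> v)" for p q v
    using linear_mapD(5)[OF pmodD(2)[OF P]] c by simp
qed

abbreviation radspan :: "'p => 'v set => 'v set" where
  "radspan p A \<equiv> LinearCombinations.module.span K (Sp X p) {j p x | j x. j \<in> rad \<and> x \<in> A}"

lemma radspan_gen:
  assumes "A \<subseteq> elts X p"
  shows "subsp (radspan p A) (Sp X p)"
    and "j \<in> rad ==> x \<in> A ==> j p x \<in> radspan p A"
    and "subsp W (Sp X p) ==> (\<And>j x. j \<in> rad ==> x \<in> A ==> j p x \<in> W) ==>
      radspan p A \<subseteq> W"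
proof -
  note V = pmodD(1)[OF pfdD(1)[OF X], of p]
  have sub: "{j p x | j x. j \<in> rad \<and> x \<in> A} \<subseteq> elts X p"
    using homD(3)[OF rad_hom] assms by blast
  show "subsp (radspan p A) (Sp X p)" by (rule span_facts(1)[OF V sub])
  show "j \<in> rad ==> x \<in> A ==> j p x \<in> radspan p A" using span_facts(2)[OF V sub] by blast
  show "radspan p A \<subseteq> W" if "subsp W (Sp X p)"
    "\<And>j x. j \<in> rad ==> x \<in> A ==> j p x \<in> W"
    by (rule span_facts(3)[OF V sub that(1)]) (use that(2) in blast)
qed

lemma radspan_stable:
  assumes A: "A \<subseteq> elts X p" and g: "g \<in> Hom X X" and z: "z \<in> radspan p A"
  shows "g p z \<in> radspan p A"
proof -
  have "radspan p A \<subseteq> {z \<in> elts X p. g p z \<in> radspan p A}"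
    using subspace_preimage[OF homD(1)[OF g] radspan_gen(1)[OF A]]
      radspan_gen(2)[OF A rad_left[OF _ g]] homD(3)[OF rad_hom] A
    by (intro radspan_gen(3)[OF A]) blast+
  then show ?thesis using z by blast
qed

text \<open>
The radical is closed under sums and scalar multiples, so the contributions of \<open>a\<close> to a linear
combination can be collected into a single \<open>j a\<close>.
\<close>
lemma radspan_insert:
  assumes aA: "insert a A \<subseteq> elts X p" and z: "z \<in> radspan p (insert a A)"
  obtains j s where "j \<in> rad" "s \<in> radspan p A" "z = j p a \<oplus>\<^bsub>Sp X p\<^esub> s"
proof -
  have A: "A \<subseteq> elts X p" and a: "a \<in> elts X p" using aA by auto
  note V = pmodD(1)[OF pfdD(1)[OF X], of p]
  note S = subspaceD[OF radspan_gen(1)[OF A]]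
  let ?W = "{j p a \<oplus>\<^bsub>Sp X p\<^esub> s | j s. j \<in> rad \<and> s \<in> radspan p A}"
  have WI: "j p a \<oplus>\<^bsub>Sp X p\<^esub> s \<in> ?W" if "j \<in> rad" "s \<in> radspan p A" for j s
    using that by blast
  have ja: "j p a \<in> elts X p" if "j \<in> rad" for j using homD(3)[OF rad_hom[OF that] a] .
  have "subsp ?W (Sp X p)"
  proof (rule subspaceI[OF V])
    show "?W \<subseteq> elts X p" using S(4) ja V by auto
    show "zero_of X p \<in> ?W" using WI[OF zero_rad S(3)] V by simp
    fix x y assume "x \<in> ?W" "y \<in> ?W"
    then obtain j s k t where js: "j \<in> rad" "s \<in> radspan p A" "k \<in> rad" "t \<in> radspan p A"
      "x = j p a \<oplus>\<^bsub>Sp X p\<^esub> s" "y = k p a \<oplus>\<^bsub>Sp X p\<^esub> t" by blast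
    have "x \<oplus>\<^bsub>Sp X p\<^esub> y = (j p a \<oplus>\<^bsub>Sp X p\<^esub> k p a) \<oplus>\<^bsub>Sp X p\<^esub> (s \<oplus>\<^bsub>Sp X p\<^esub> t)"
      using js ja S(4) V by (simp add: vs_add_ac[OF V])
    then show "x \<oplus>\<^bsub>Sp X p\<^esub> y \<in> ?W" using WI[OF rad_add[OF js(1,3)] S(5)[OF js(2,4)]] by simp
  next
    fix c x assume c: "c \<in> carrier K" and "x \<in> ?W"
    then obtain j s where js: "j \<in> rad" "s \<in> radspan p A" "x = j p a \<oplus>\<^bsub>Sp X p\<^esub> s" by blast
    have "c \<odot>\<^bsub>Sp X p\<^esub> x = c \<odot>\<^bsub>Sp X p\<^esub> j p a \<oplus>\<^bsub>Sp X p\<^esub> c \<odot>\<^bsub>Sp X p\<^esub> s"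
      using js ja S(4) c by (simp add: vs_smult_distrib[OF V])
    then show "c \<odot>\<^bsub>Sp X p\<^esub> x \<in> ?W" 
      using WI[OF rad_left[OF js(1) hom_scalar[OF c]] S(6)[OF c js(2)]] by simp
  qed
  moreover have "j p x \<in> ?W" if j: "j \<in> rad" and x: "x \<in> insert a A" for j x
  proof (cases "x = a")
    case True
    then show ?thesis using WI[OF j S(3)] V ja[OF j] by simp
  next
    case False
    then have s: "j p x \<in> radspan p A" using radspan_gen(2)[OF A j] x by blast
    then show ?thesis using WI[OF zero_rad s] V S(4)[OF s] by simp
  qed
  ultimately have "radspan p (insert a A) \<subseteq> ?W" by (rule radspan_gen(3)[OF aA])
  then show thesis using z that by blast
qed

text \<open>
Nakayama's lemma for the finite set \<open>A\<close> in the space of \<open>X\<close> at \<open>p\<close>, on which the endomorphism ring acts.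
If \<open>a = j a + s\<close> with \<open>j\<close> in the radical and \<open>s\<close> in the span of \<open>rad A\<close>, then \<open>a = (1 - j)\<^sup>-\<^sup>1 s\<close>, so \<open>a\<close> can be
eliminated from the generators; induction on the size of \<open>A\<close> finishes the proof.
\<close>
lemma nakayama:
  assumes "finite A" "A \<subseteq> elts X p" "A \<subseteq> radspan p A"
  shows "A \<subseteq> {zero_of X p}"
  using assms
proof (induction A rule: finite_induct)
  case (insert a A)
  note V = pmodD(1)[OF pfdD(1)[OF X], of p]
  have A: "A \<subseteq> elts X p" and a: "a \<in> elts X p" using insert.prems by auto
  note S = subspaceD[OF radspan_gen(1)[OF A]]
  obtain j s where js: "j \<in> rad" "s \<in> radspan p A" "a = j p a \<oplus>\<^bsub>Sp X p\<^esub> s"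
    using radspan_insert[OF insert.prems(1), of a] insert.prems(2) by blast
  obtain u where u: "u \<in> Hom X X"
    "\<And>p v. v \<in> elts X p ==> u p (v \<ominus>\<^bsub>Sp X p\<^esub> j p v) = v" by (rule one_minus_rad[OF js(1)]) blast
  have "a \<ominus>\<^bsub>Sp X p\<^esub> j p a = s"
    using js(3) vs_simps(9)[OF V homD(3)[OF rad_hom[OF js(1)] a] S(4)[OF js(2)]] by simp
  then have aS: "a \<in> radspan p A" using radspan_stable[OF A u(1) js(2)] u(2)[OF a] by simp
  have "A \<subseteq> radspan p A"
  proof
    fix x assume "x \<in> A"
    then obtain k t where "k \<in> rad" "t \<in> radspan p A" "x = k p a \<oplus>\<^bsub>Sp X p\<^esub> t"
      using radspan_insert[OF insert.prems(1), of x] insert.prems(2) by blast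
    then show "x \<in> radspan p A" using radspan_stable[OF A rad_hom aS] S(5) by blast
  qed
  then have A0: "A \<subseteq> {zero_of X p}" using insert.IH A by blast
  have "radspan p A \<subseteq> {zero_of X p}"
    by (rule radspan_gen(3)[OF A subspace_zero[OF V]]) (use A0 homD(6)[OF rad_hom] in auto)
  then show ?case using aS A0 by blast
qed simp

end


section \<open>Uniqueness of decompositions into indecomposables\<close>

text \<open>
Each further condition \<open>pr i x = 0\<close> cuts down the dimension, because \<open>y i\<close> satisfies all the previous
conditions but not the new one.
\<close>
lemma finite_dual_family:
  assumes V: "vectorspace K V" "fd V" and pr: "\<And>i. i \<in> I ==> linear_map K V (W i) (pr i)"
    and y: "\<And>i. i \<in> I ==> y i \<in> carrier V" "\<And>i. i \<in> I ==> pr i (y i) \<noteq> \<zero>\<^bsub>W i\<^esub>"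
      "\<And>i j. i \<in> I ==> j \<in> I ==> j \<noteq> i ==> pr j (y i) = \<zero>\<^bsub>W j\<^esub>"
  shows "finite I"
proof -
  let ?T = "\<lambda>F. {x \<in> carrier V. \<forall>i\<in>F. pr i x = \<zero>\<^bsub>W i\<^esub>}"
  have sub: "subsp (?T F) V" if "F \<subseteq> I" for F
    by (rule subspace_common_kernel[OF V(1) pr]) (use that in blast)
  have "sdim V (?T F) + card F \<le> dm V" if "finite F" "F \<subseteq> I" for F
    using that
  proof (induction F rule: finite_induct)
    case empty
    then show ?case using fd_sub(2)[OF V sub[of "{}"]] by simp
  next
    case (insert i F)
    have i: "i \<in> I" and F: "F \<subseteq> I" using insert.prems by auto
    have "y i \<in> ?T F" using y(1)[OF i] y(3)[OF i] insert.hyps(2) F by auto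
    moreover have "y i \<notin> ?T (insert i F)" using y(2)[OF i] by auto
    ultimately have "?T (insert i F) \<noteq> ?T F" by blast
    moreover have "?T (insert i F) \<subseteq> ?T F" by blast
    ultimately have "sdim V (?T (insert i F)) < sdim V (?T F)"
      using dm_mono[OF V sub[OF insert.prems] sub[OF F]] by (meson le_neq_implies_less)
    then show ?case using insert.IH[OF F] insert.hyps by simp
  qed
  then have "card F \<le> dm V" if "finite F" "F \<subseteq> I" for F using that by (meson add_leD2)
  then show ?thesis using finite_if_finite_subsets_card_bdd[of I "dm V"] by simp
qed

lemma decomp_injs:
  assumes d: "decomp M I N pr"
  obtains \<iota> where "\<And>i. i \<in> I ==> \<iota> i \<in> Hom (N i) M"
    and "\<And>i p x. i \<in> I ==> x \<in> elts (N i) p ==> pr i p (\<iota> i p x) = x"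
    and "\<And>i j p x. i \<in> I ==> j \<in> I ==> j \<noteq> i ==> x \<in> elts (N i) p ==>
        pr j p (\<iota> i p x) = zero_of (N j) p"
proof -
  have "\<exists>h. h \<in> Hom (N i) M \<and> (\<forall>p. \<forall>x\<in>elts (N i) p. pr i p (h p x) = x \<and>
      (\<forall>j\<in>I. j \<noteq> i \<longrightarrow> pr j p (h p x) = zero_of (N j) p))" if i: "i \<in> I" for i
    by (rule decomp_inj[OF d i]) blast
  then obtain \<iota> where "\<And>i. i \<in> I ==> \<iota> i \<in> Hom (N i) M \<and>
      (\<forall>p. \<forall>x\<in>elts (N i) p. pr i p (\<iota> i p x) = x \<and>
      (\<forall>j\<in>I. j \<noteq> i \<longrightarrow> pr j p (\<iota> i p x) = zero_of (N j) p))" by metis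
  then show thesis by (intro that[of \<iota>]) blast+
qed

lemma decomp_support_finite:
  assumes d: "decomp M I N pr" and M: "pfd K M"
  shows "finite {i\<in>I. elts (N i) p \<noteq> {zero_of (N i) p}}"
proof -
  note D = decompD[OF d]
  obtain \<iota> where \<iota>: "\<And>i. i \<in> I ==> \<iota> i \<in> Hom (N i) M"
    "\<And>i p x. i \<in> I ==> x \<in> elts (N i) p ==> pr i p (\<iota> i p x) = x"
    "\<And>i j p x. i \<in> I ==> j \<in> I ==> j \<noteq> i ==> x \<in> elts (N i) p ==>
        pr j p (\<iota> i p x) = zero_of (N j) p" by (rule decomp_injs[OF d]) blast
  let ?S = "{i\<in>I. elts (N i) p \<noteq> {zero_of (N i) p}}"
  have "\<forall>i\<in>?S. \<exists>y. y \<in> elts (N i) p \<and> y \<noteq> zero_of (N i) p"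
    using vs_closed(1)[OF pmodD(1)[OF D(2)]] by blast
  from bchoice[OF this] obtain y where y: "\<And>i. i \<in> ?S ==> y i \<in> elts (N i) p"
    "\<And>i. i \<in> ?S ==> y i \<noteq> zero_of (N i) p" by blast
  show ?thesis
  proof (rule finite_dual_family[OF pmodD(1)[OF D(1)] pfdD(2)[OF M]])
    show "linear_map K (Sp M p) (Sp (N i) p) (pr i p)" if "i \<in> ?S" for i
      using homD(1)[OF D(3)] that by blast
    show "\<iota> i p (y i) \<in> elts M p" if "i \<in> ?S" for i
      using homD(3)[OF \<iota>(1) y(1)[OF that]] that by blast
    show "pr i p (\<iota> i p (y i)) \<noteq> zero_of (N i) p" if "i \<in> ?S" for i
      using \<iota>(2)[OF _ y(1)[OF that]] y(2)[OF that] that by simp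
    show "pr j p (\<iota> i p (y i)) = zero_of (N j) p" if "i \<in> ?S" "j \<in> ?S" "j \<noteq> i" for i j
      using \<iota>(3)[OF _ _ that(3) y(1)[OF that(1)]] that by simp
  qed
qed

text \<open>
Adding the summand \<open>A a\<close> to a partial sum raises the dimension by that of \<open>A a\<close>: the projection to \<open>A a\<close>
is onto, and its kernel is the previous partial sum.
\<close>
lemma dm_partial_sum:
  assumes d: "decomp S I A \<pi>" and S: "pfd K S" and F: "finite F" "F \<subseteq> I"
    and dim: "\<And>a. a \<in> F ==> dm (Sp (A a) p) = n"
  shows "sdim (Sp S p) {w \<in> elts S p. \<forall>a\<in>I - F. \<pi> a p w = zero_of (A a) p}
    = card F * n"
  using F dim
proof (induction F rule: finite_induct)
  note D = decompD[OF d] and V = pmodD(1)[OF pfdD(1)[OF S], of p]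
  case empty
  have "{w \<in> elts S p. \<forall>a\<in>I - {}. \<pi> a p w = zero_of (A a) p} = {zero_of S p}"
    using D(5) homD(6)[OF D(3)] V by auto
  then show ?case using dm_zero[OF V] by simp
next
  note D = decompD[OF d] and V = pmodD(1)[OF pfdD(1)[OF S], of p]
  case (insert a F)
  let ?U = "\<lambda>F. {w \<in> elts S p. \<forall>a\<in>I - F. \<pi> a p w = zero_of (A a) p}"
  have a: "a \<in> I" and F: "F \<subseteq> I" using insert.prems by auto
  have U: "subsp (?U (insert a F)) (Sp S p)"
    by (rule subspace_common_kernel[OF V homD(1)[OF D(3)]]) blast
  obtain h where h: "h \<in> Hom (A a) S"
    "\<And>p x. x \<in> elts (A a) p ==> \<pi> a p (h p x) = x"
    "\<And>j p x. j \<in> I ==> j \<noteq> a ==> x \<in> elts (A a) p ==> \<pi> j p (h p x) = zero_of (A j) p"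
    by (rule decomp_inj[OF d a]) blast
  have "\<pi> a p ` ?U (insert a F) = elts (A a) p"
  proof (intro equalityI subsetI)
    fix x assume x: "x \<in> elts (A a) p"
    then have "h p x \<in> ?U (insert a F)" using h(3)[OF _ _ x] homD(3)[OF h(1) x] by auto
    with h(2)[OF x, symmetric] show "x \<in> \<pi> a p ` ?U (insert a F)" by (rule image_eqI)
  qed (use homD(3)[OF D(3)[OF a]] in auto)
  moreover have "{w \<in> ?U (insert a F). \<pi> a p w = zero_of (A a) p} = ?U F"
    using a insert.hyps(2) by auto
  ultimately have "dm (Sp (A a) p) + sdim (Sp S p) (?U F)
      = sdim (Sp S p) (?U (insert a F))"
    using rank_nullity_sub[OF homD(1)[OF D(3)[OF a]] pfdD(2)[OF S] U] by simp
  then show ?case using insert.IH[OF F] insert.prems(2) insert.hyps by simp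
qed

text \<open>
Each of the conditions \<open>\<rho> b w = 0\<close> lowers the dimension by at most the dimension of \<open>W b\<close>.
\<close>
lemma dm_common_kernel:
  assumes V: "vectorspace K V" "fd V" and G: "finite G"
    and \<rho>: "\<And>b. b \<in> G ==> linear_map K V (W b) (\<rho> b)"
    and W: "\<And>b. b \<in> G ==> fd (W b)" "\<And>b. b \<in> G ==> dm (W b) \<le> n"
    and U: "subsp U V"
  shows "sdim V U \<le> sdim V {w \<in> U. \<forall>b\<in>G. \<rho> b w = \<zero>\<^bsub>W b\<^esub>} + card G * n"
  using G \<rho> W
proof (induction G rule: finite_induct)
  case (insert b G)
  let ?U = "\<lambda>G. {w \<in> U. \<forall>b\<in>G. \<rho> b w = \<zero>\<^bsub>W b\<^esub>}"
  have "subsp {w \<in> carrier V. \<forall>b\<in>G. \<rho> b w = \<zero>\<^bsub>W b\<^esub>} V"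
    by (rule subspace_common_kernel[OF V(1)]) (use insert.prems(1) in blast)
  then have "subsp (U \<inter> {w \<in> carrier V. \<forall>b\<in>G. \<rho> b w = \<zero>\<^bsub>W b\<^esub>}) V" by (rule subspace_Int[OF U])
  also have "U \<inter> {w \<in> carrier V. \<forall>b\<in>G. \<rho> b w = \<zero>\<^bsub>W b\<^esub>} = ?U G" using subspaceD(2)[OF U] by auto
  finally have UG: "subsp (?U G) V" .
  have lin: "linear_map K V (W b) (\<rho> b)" using insert.prems(1) by simp
  have "sdim (W b) (\<rho> b ` ?U G) \<le> n"
    using fd_sub(2)[OF linear_mapD(2)[OF lin] _ subspace_image[OF lin UG]] insert.prems(2,3)
    by (meson insertI1 le_trans)
  moreover have "{w \<in> ?U G. \<rho> b w = \<zero>\<^bsub>W b\<^esub>} = ?U (insert b G)" by auto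
  ultimately have "sdim V (?U G) \<le> n + sdim V (?U (insert b G))"
    using rank_nullity_sub[OF lin V(2) UG] by simp
  moreover have "sdim V U \<le> sdim V (?U G) + card G * n"
    using insert.IH insert.prems by simp
  ultimately show ?case using insert.hyps by simp
qed simp

text \<open>
If the composite \<open>g e\<close> were injective, hence bijective, then \<open>B\<close> would be the direct sum of the image of
\<open>e\<close> and the kernel of \<open>g\<close>. The image is not zero, so the kernel is, and \<open>g\<close> would be an isomorphism.
\<close>
lemma factor_through_nonisomorphic:
  assumes X: "indecomposable K X" "pfd K X" and B: "indecomposable K B"
    and noniso: "\<not> pmod_isomorphic K X B"
    and e: "e \<in> Hom X B" and g: "g \<in> Hom B X"
  shows "\<not> inj_hom X X (\<lambda>p x. g p (e p x))"
proof
  assume inj: "inj_hom X X (\<lambda>p x. g p (e p x))"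
  note PX = pfdD(1)[OF X(2)] and PB = indecomposableD(1)[OF B]
  note ge = hom_comp[OF e g]
  have bij: "bij_betw (\<lambda>x. g p (e p x)) (elts X p) (elts X p)" for p
    using inj_hom_bij[OF X(2) ge inj] .
  have split: "(\<forall>p. e p ` elts X p = {zero_of B p}) \<or>
      (\<forall>p. {x \<in> elts B p. g p x = zero_of X p} = {zero_of B p})"
  proof (rule indecomposable_split[OF B psub_image[OF e psub_full[OF PX]] psub_ker[OF PB PX g]])
    fix p x assume "x \<in> e p ` elts X p" "x \<in> {x \<in> elts B p. g p x = zero_of X p}"
    then show "x = zero_of B p" using inj homD(6)[OF e] by (auto simp: inj_hom_def)
  next
    fix p x assume x: "x \<in> elts B p"
    then have "g p x \<in> (\<lambda>x. g p (e p x)) ` elts X p"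
      using bij[of p] homD(3)[OF g] by (simp add: bij_betw_def)
    then obtain y where y: "y \<in> elts X p" "g p x = g p (e p y)" by blast
    let ?k = "x \<ominus>\<^bsub>Sp B p\<^esub> e p y"
    have ey: "e p y \<in> elts B p" using homD(3)[OF e y(1)] .
    have "?k \<in> elts B p" "g p ?k = zero_of X p"
      using x ey homD(7)[OF g x ey] y(2) homD(3)[OF g ey] pmodD(1)[OF PB] pmodD(1)[OF PX] by simp_all
    moreover have "x = e p y \<oplus>\<^bsub>Sp B p\<^esub> ?k" using x ey pmodD(1)[OF PB] by simp
    ultimately show "\<exists>a\<in>e p ` elts X p. \<exists>b\<in>{x \<in> elts B p. g p x = zero_of X p}.
        x = a \<oplus>\<^bsub>Sp B p\<^esub> b" using y(1) by blast
  qed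
  from split show False
  proof
    assume e0: "\<forall>p. e p ` elts X p = {zero_of B p}"
    obtain p x where x: "x \<in> elts X p" "x \<noteq> zero_of X p"
      using indecomposableD(2)[OF X(1)] vs_closed(1)[OF pmodD(1)[OF PX]] by blast
    have "e p x = zero_of B p" using e0 x(1) by blast
    then show False using inj x homD(6)[OF g] by (auto simp: inj_hom_def)
  next
    assume k0: "\<forall>p. {x \<in> elts B p. g p x = zero_of X p} = {zero_of B p}"
    have "bij_betw (g p) (elts B p) (elts X p)" for p
      unfolding bij_betw_def
    proof
      show "inj_on (g p) (elts B p)"
        unfolding linear_inj_iff[OF homD(1)[OF g]] using k0 by blast
      have "(\<lambda>x. g p (e p x)) ` elts X p \<subseteq> g p ` elts B p" using homD(3)[OF e] by blast
      then show "g p ` elts B p = elts X p"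
        using bij[of p] homD(3)[OF g] by (auto simp: bij_betw_def)
    qed
    then have "pmod_isomorphic K B X" using g by (auto simp: pmod_isomorphic_def)
    then show False using noniso iso_sym[OF PB] by blast
  qed
qed

text \<open>
Fix a point \<open>p\<close> with \<open>X\<^sub>p \<noteq> 0\<close>, let \<open>U\<close> be the sum of the \<open>A\<^sub>a \<cong> X\<close> at \<open>p\<close>, and consider the projections of
\<open>U\<close> to the \<open>B\<^sub>b \<cong> X\<close>. If they are jointly injective then comparing dimensions gives
\<open>|F| \<cdot> dim X\<^sub>p \<le> |G| \<cdot> dim X\<^sub>p\<close>. So let \<open>w\<close> in \<open>U\<close> have zero component in each \<open>B\<^sub>b \<cong> X\<close>. Then \<open>w\<close> is the sum of
its components in the \<open>B\<^sub>b\<close> with \<open>B\<^sub>b\<close> not isomorphic to \<open>X\<close>, and passing from \<open>A\<^sub>a'\<close> to such a \<open>B\<^sub>b\<close> and back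
to \<open>A\<^sub>a\<close> is an element of the radical of the endomorphism ring of \<open>X\<close>. Hence the components of \<open>w\<close> in the
\<open>A\<^sub>a\<close>, read as elements of \<open>X\<^sub>p\<close>, satisfy the hypothesis of Nakayama's lemma, and \<open>w = 0\<close>.
\<close>
lemma multiplicity_le:
  assumes S: "pfd K S" and dA: "decomp S I A \<pi>" and dB: "decomp S I' B \<rho>"
    and ind: "\<And>b. b \<in> I' ==> indecomposable K (B b)"
    and X: "indecomposable K X" "pfd K X"
  shows "finite {a\<in>I. pmod_isomorphic K X (A a)}" (is "finite ?F")
    and "card {a\<in>I. pmod_isomorphic K X (A a)} \<le> card {b\<in>I'. pmod_isomorphic K X (B b)}"
      (is "_ \<le> card ?G")
proof -
  note PX = pfdD(1)[OF X(2)] and VX = pmodD(1)[OF pfdD(1)[OF X(2)]]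
  note VS = pmodD(1)[OF pfdD(1)[OF S]]
  note DA = decompD[OF dA] and DB = decompD[OF dB]
  obtain p where p: "elts X p \<noteq> {zero_of X p}" using indecomposableD(2)[OF X(1)] by blast
  have fin: "finite {c\<in>\<Gamma>. pmod_isomorphic K X (C c)}" if "decomp S \<Gamma> C \<tau>"
    for \<Gamma> :: "'i set" and C :: "'i => ('a, 'k, 'w) pmod" and \<tau>
  proof (rule finite_subset[OF _ decomp_support_finite[OF that S, of p]], rule subsetI)
    fix c assume c: "c \<in> {c\<in>\<Gamma>. pmod_isomorphic K X (C c)}"
    then obtain f where f: "f \<in> Hom X (C c)"
      "bij_betw (f p) (elts X p) (elts (C c) p)" by (auto simp: pmod_isomorphic_def)
    have "elts (C c) p \<noteq> {zero_of (C c) p}"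
    proof
      assume "elts (C c) p = {zero_of (C c) p}"
      then have fx: "f p x = f p (zero_of X p)" if "x \<in> elts X p" for x
        using homD(3)[OF f(1) that] homD(6)[OF f(1)] by simp
      have "x = zero_of X p" if "x \<in> elts X p" for x
        by (rule inj_onD[OF bij_betw_imp_inj_on[OF f(2)] fx[OF that] that vs_closed(1)[OF VX]])
      then have "elts X p = {zero_of X p}" using vs_closed(1)[OF VX, of p] by blast
      then show False using p by simp
    qed
    then show "c \<in> {c\<in>\<Gamma>. elts (C c) p \<noteq> {zero_of (C c) p}}" using c by blast
  qed
  show finF: "finite ?F" using fin[OF dA] .
  have finG: "finite ?G" using fin[OF dB] .
  have *: "\<exists>\<alpha> \<beta>. \<alpha> \<in> Hom X (A a) \<and> \<beta> \<in> Hom (A a) X \<and>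
      (\<forall>p. bij_betw (\<alpha> p) (elts X p) (elts (A a) p)) \<and>
      (\<forall>p. \<forall>x\<in>elts (A a) p. \<alpha> p (\<beta> p x) = x)" if "a \<in> ?F" for a
  proof -
    obtain \<alpha> where \<alpha>: "\<alpha> \<in> Hom X (A a)"
      "\<And>p. bij_betw (\<alpha> p) (elts X p) (elts (A a) p)"
      using \<open>a \<in> ?F\<close> by (auto simp: pmod_isomorphic_def)
    show ?thesis by (rule hom_inverse[OF PX \<alpha>]) (use \<alpha> in blast)
  qed
  obtain \<alpha> where "\<forall>a\<in>?F. \<exists>\<beta>. \<alpha> a \<in> Hom X (A a) \<and> \<beta> \<in> Hom (A a) X \<and>
      (\<forall>p. bij_betw (\<alpha> a p) (elts X p) (elts (A a) p)) \<and>
      (\<forall>p. \<forall>x\<in>elts (A a) p. \<alpha> a p (\<beta> p x) = x)"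
    using bchoice[OF ballI[OF *]] by (rule exE)
  then obtain \<beta> where "\<forall>a\<in>?F. \<alpha> a \<in> Hom X (A a) \<and> \<beta> a \<in> Hom (A a) X \<and>
      (\<forall>p. bij_betw (\<alpha> a p) (elts X p) (elts (A a) p)) \<and>
      (\<forall>p. \<forall>x\<in>elts (A a) p. \<alpha> a p (\<beta> a p x) = x)"
    by (rule exE[OF bchoice])
  then have \<alpha>: "\<And>a. a \<in> ?F ==> \<alpha> a \<in> Hom X (A a)"
      "\<And>a p. a \<in> ?F ==> bij_betw (\<alpha> a p) (elts X p) (elts (A a) p)"
    and \<beta>: "\<And>a. a \<in> ?F ==> \<beta> a \<in> Hom (A a) X"
      "\<And>a p x. a \<in> ?F ==> x \<in> elts (A a) p ==> \<alpha> a p (\<beta> a p x) = x" by simp_all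
  obtain \<iota> where \<iota>: "\<And>i. i \<in> I ==> \<iota> i \<in> Hom (A i) S"
    "\<And>i p x. i \<in> I ==> x \<in> elts (A i) p ==> \<pi> i p (\<iota> i p x) = x"
    "\<And>i j p x. i \<in> I ==> j \<in> I ==> j \<noteq> i ==> x \<in> elts (A i) p ==>
        \<pi> j p (\<iota> i p x) = zero_of (A j) p" by (rule decomp_injs[OF dA]) blast
  obtain \<kappa> where \<kappa>: "\<And>i. i \<in> I' ==> \<kappa> i \<in> Hom (B i) S"
    "\<And>i p x. i \<in> I' ==> x \<in> elts (B i) p ==> \<rho> i p (\<kappa> i p x) = x"
    "\<And>i j p x. i \<in> I' ==> j \<in> I' ==> j \<noteq> i ==> x \<in> elts (B i) p ==>
        \<rho> j p (\<kappa> i p x) = zero_of (B j) p" by (rule decomp_injs[OF dB]) blast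
  let ?U = "{w \<in> elts S p. \<forall>a\<in>I - ?F. \<pi> a p w = zero_of (A a) p}"
  have trivial: "w = zero_of S p" if wU: "w \<in> ?U" and wG: "\<forall>b\<in>?G. \<rho> b p w = zero_of (B b) p" for w
  proof -
    have w: "w \<in> elts S p" using wU by simp
    define y where "y a = \<beta> a p (\<pi> a p w)" for a
    have \<pi>w: "\<pi> a p w \<in> elts (A a) p" if "a \<in> I" for a using homD(3)[OF DA(3)[OF that] w] .
    have y: "y a \<in> elts X p" if "a \<in> ?F" for a
      unfolding y_def using homD(3)[OF \<beta>(1)[OF that] \<pi>w] that by simp
    have \<alpha>y: "\<alpha> a p (y a) = \<pi> a p w" if "a \<in> ?F" for a
      unfolding y_def using \<beta>(2)[OF that \<pi>w] that by simp
    have yX: "y ` ?F \<subseteq> elts X p" using y by blast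
    let ?Z = "radspan X p (y ` ?F)"
    note Zsub = radspan_gen(1)[OF X yX]
    have Z0: "zero_of X p \<in> ?Z" using subspaceD(3)[OF Zsub] .
    have "y a \<in> ?Z" if a: "a \<in> ?F" for a
    proof -
      have aI: "a \<in> I" using a by simp
      have \<psi>: "(\<lambda>p s. \<beta> a p (\<pi> a p s)) \<in> Hom S X"
        by (rule hom_comp[OF DA(3)[OF aI] \<beta>(1)[OF a]])
      \<comment> \<open>expand \<open>w\<close> in the second decomposition, and below each of its components in the first one\<close>
      have "w \<in> {s \<in> elts S p. \<beta> a p (\<pi> a p s) \<in> ?Z}"
      proof (rule decomp_mem[OF dB subspace_preimage[OF homD(1)[OF \<psi>] Zsub] w \<kappa>])
        fix b assume b: "b \<in> I'"
        have \<rho>w: "\<rho> b p w \<in> elts (B b) p" using homD(3)[OF DB(3)[OF b] w] .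
        have "\<beta> a p (\<pi> a p (\<kappa> b p (\<rho> b p w))) \<in> ?Z"
        proof (cases "b \<in> ?G")
          case True
          then show ?thesis
            using wG Z0 homD(6)[OF \<kappa>(1)[OF b]] homD(6)[OF \<psi>] by simp
        next
          case False
          then have noniso: "\<not> pmod_isomorphic K X (B b)" using b by simp
          have g: "(\<lambda>p s. \<beta> a p (\<pi> a p (\<kappa> b p s))) \<in> Hom (B b) X"
            by (rule hom_comp[OF \<kappa>(1)[OF b] \<psi>])
          have \<phi>: "(\<lambda>p s. \<beta> a p (\<pi> a p (\<kappa> b p (\<rho> b p s)))) \<in> Hom S X"
            by (rule hom_comp[OF DB(3)[OF b] g])
          have "w \<in> {s \<in> elts S p. \<beta> a p (\<pi> a p (\<kappa> b p (\<rho> b p s))) \<in> ?Z}"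
          proof (rule decomp_mem[OF dA subspace_preimage[OF homD(1)[OF \<phi>] Zsub] w \<iota>])
            fix a' assume a': "a' \<in> I"
            have "\<beta> a p (\<pi> a p (\<kappa> b p (\<rho> b p (\<iota> a' p (\<pi> a' p w))))) \<in> ?Z"
            proof (cases "a' \<in> ?F")
              case False
              then have "\<pi> a' p w = zero_of (A a') p" using wU a' by blast
              then show ?thesis using Z0 homD(6)[OF \<iota>(1)[OF a']] homD(6)[OF \<phi>] by simp
            next
              case True
              have e: "(\<lambda>p x. \<rho> b p (\<iota> a' p (\<alpha> a' p x))) \<in> Hom X (B b)"
                by (rule hom_comp[OF hom_comp[OF \<alpha>(1)[OF True] \<iota>(1)[OF a']] DB(3)[OF b]])
              \<comment> \<open>an endomorphism of \<open>X\<close> that factors through \<open>B b\<close>\<close>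
              have "(\<lambda>p x. \<beta> a p (\<pi> a p (\<kappa> b p (\<rho> b p (\<iota> a' p (\<alpha> a' p x)))))) \<in> rad X"
                using rad_iff[OF X hom_comp[OF e g]]
                  factor_through_nonisomorphic[OF X ind[OF b] noniso e g] by simp
              from radspan_gen(2)[OF X yX this, of "y a'"] show ?thesis
                using \<alpha>y[OF True] True by simp
            qed
            then show "\<iota> a' p (\<pi> a' p w) \<in> {s \<in> elts S p. \<beta> a p (\<pi> a p (\<kappa> b p (\<rho> b p s))) \<in> ?Z}"
              using homD(3)[OF \<iota>(1)[OF a'] \<pi>w[OF a']] by simp
          qed
          then show ?thesis by simp
        qed
        then show "\<kappa> b p (\<rho> b p w) \<in> {s \<in> elts S p. \<beta> a p (\<pi> a p s) \<in> ?Z}"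
          using homD(3)[OF \<kappa>(1)[OF b] \<rho>w] by simp
      qed
      then show ?thesis by (simp add: y_def)
    qed
    then have "y ` ?F \<subseteq> {zero_of X p}"
      using nakayama[OF X finite_imageI[OF finF] yX] by blast
    then have "\<pi> a p w = zero_of (A a) p" if "a \<in> I" for a
      using wU that \<alpha>y[of a] homD(6)[OF \<alpha>(1)[of a], of p] by (cases "a \<in> ?F") auto
    then show ?thesis using DA(5)[OF w] by blast
  qed
  let ?d = "dm (Sp X p)"
  have d: "?d > 0" using dm_eq_0[OF VX pfdD(2)[OF X(2)]] p by blast
  have dimF: "dm (Sp (A a) p) = ?d" if "a \<in> ?F" for a
    using dm_iso[OF homD(1)[OF \<alpha>(1)[OF that]] pfdD(2)[OF X(2)] \<alpha>(2)[OF that]] by simp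
  have dimG: "dm (Sp (B b) p) = ?d" if "b \<in> ?G" for b
  proof -
    obtain f where f: "f \<in> Hom X (B b)"
      "bij_betw (f p) (elts X p) (elts (B b) p)"
      using \<open>b \<in> ?G\<close> by (auto simp: pmod_isomorphic_def)
    show ?thesis using dm_iso[OF homD(1)[OF f(1)] pfdD(2)[OF X(2)] f(2)] by simp
  qed
  have U: "subsp ?U (Sp S p)"
    by (rule subspace_common_kernel[OF VS homD(1)[OF DA(3)]]) blast
  have "sdim (Sp S p) ?U
      \<le> sdim (Sp S p) {w \<in> ?U. \<forall>b\<in>?G. \<rho> b p w = zero_of (B b) p} + card ?G * ?d"
  proof (rule dm_common_kernel[OF VS pfdD(2)[OF S] finG _ _ _ U])
    fix b assume b: "b \<in> ?G"
    show "linear_map K (Sp S p) (Sp (B b) p) (\<rho> b p)" using homD(1)[OF DB(3)] b by blast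
    show "fd (Sp (B b) p)" using pfdD(2)[OF pfd_summand[OF dB S]] b by blast
    show "dm (Sp (B b) p) \<le> ?d" using dimG[OF b] by simp
  qed
  moreover have "{w \<in> ?U. \<forall>b\<in>?G. \<rho> b p w = zero_of (B b) p} = {zero_of S p}"
    using trivial subspaceD(3)[OF U] homD(6)[OF DB(3)] by blast
  moreover have "sdim (Sp S p) ?U = card ?F * ?d"
    by (rule dm_partial_sum[OF dA S finF]) (use dimF in auto)
  ultimately have "card ?F * ?d \<le> card ?G * ?d" using dm_zero[OF VS] by simp
  then show "card ?F \<le> card ?G" using d by simp
qed

lemma bij_betw_of_fibres:
  assumes "\<And>k. \<exists>h. bij_betw h {a\<in>A. f a = k} {b\<in>B. g b = k}"
  obtains \<sigma> where "bij_betw \<sigma> A B" "\<And>a. a \<in> A ==> g (\<sigma> a) = f a"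
proof -
  obtain h where h: "\<And>k. bij_betw (h k) {a\<in>A. f a = k} {b\<in>B. g b = k}" using assms by metis
  define \<sigma> where "\<sigma> a = h (f a) a" for a
  have \<sigma>: "\<sigma> a \<in> B" "g (\<sigma> a) = f a" if "a \<in> A" for a
    using bij_betwE[OF h[of "f a"]] that by (auto simp: \<sigma>_def)
  have "inj_on \<sigma> A"
  proof (rule inj_onI)
    fix a a' assume *: "a \<in> A" "a' \<in> A" "\<sigma> a = \<sigma> a'"
    then have "f a = f a'" using \<sigma>(2) by metis
    then show "a = a'" using * bij_betw_imp_inj_on[OF h[of "f a"]] by (auto simp: \<sigma>_def inj_on_def)
  qed
  moreover have "b \<in> \<sigma> ` A" if "b \<in> B" for b
  proof -
    have "b \<in> h (g b) ` {a\<in>A. f a = g b}" using bij_betw_imp_surj_on[OF h[of "g b"]] that by blast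
    then obtain a where "a \<in> A" "f a = g b" "b = h (g b) a" by blast
    then show ?thesis by (intro image_eqI[of _ _ a]) (simp_all add: \<sigma>_def)
  qed
  ultimately have "bij_betw \<sigma> A B" using \<sigma>(1) by (auto simp: bij_betw_def)
  then show thesis using \<sigma>(2) that by blast
qed

text \<open>
Each isomorphism class occurs equally often, and finitely often, in both decompositions. The classes
are encoded by sets of indices of the first decomposition: \<open>f a\<close> and \<open>g b\<close> are the sets of all indices
whose summand is isomorphic to \<open>A a\<close> and to \<open>B b\<close>, respectively.
\<close>
theorem krull_schmidt:
  assumes S: "pfd K S" and dA: "decomp S I A \<pi>" and dB: "decomp S I' B \<rho>"
    and iA: "\<And>a. a \<in> I ==> indecomposable K (A a)" and iB: "\<And>b. b \<in> I' ==> indecomposable K (B b)"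
  obtains \<sigma> where "bij_betw \<sigma> I I'" "\<And>a. a \<in> I ==> pmod_isomorphic K (A a) (B (\<sigma> a))"
proof -
  have pA: "pfd K (A a)" if "a \<in> I" for a using pfd_summand[OF dA S that] .
  have pB: "pfd K (B b)" if "b \<in> I'" for b using pfd_summand[OF dB S that] .
  note symA = iso_sym[OF pfdD(1)[OF pA]] and symB = iso_sym[OF pfdD(1)[OF pB]]
  have cardA: "finite {c\<in>I. pmod_isomorphic K (A a) (A c)}"
    "finite {b\<in>I'. pmod_isomorphic K (A a) (B b)}"
    "card {c\<in>I. pmod_isomorphic K (A a) (A c)} = card {b\<in>I'. pmod_isomorphic K (A a) (B b)}"
    if a: "a \<in> I" for a
    using multiplicity_le[OF S dA dB iB iA[OF a] pA[OF a]] multiplicity_le[OF S dB dA iA iA[OF a] pA[OF a]]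
    by auto
  define f where "f a = {c\<in>I. pmod_isomorphic K (A c) (A a)}" for a
  define g where "g b = {c\<in>I. pmod_isomorphic K (A c) (B b)}" for b
  have fA: "{c\<in>I. f c = f a} = {c\<in>I. pmod_isomorphic K (A a) (A c)}" if a: "a \<in> I" for a
  proof (intro Collect_cong conj_cong refl)
    fix c assume c: "c \<in> I"
    show "f c = f a \<longleftrightarrow> pmod_isomorphic K (A a) (A c)"
    proof
      assume "f c = f a"
      then show "pmod_isomorphic K (A a) (A c)"
        using iso_refl[OF pfdD(1)[OF pA[OF a]]] a unfolding f_def by blast
    next
      assume ac: "pmod_isomorphic K (A a) (A c)"
      show "f c = f a" unfolding f_def using iso_trans[OF _ ac] iso_trans[OF _ symA[OF a ac]] by auto
    qed
  qed
  have gB: "{b\<in>I'. g b = f a} = {b\<in>I'. pmod_isomorphic K (A a) (B b)}" if a: "a \<in> I" for a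
  proof (intro Collect_cong conj_cong refl)
    fix b assume b: "b \<in> I'"
    show "g b = f a \<longleftrightarrow> pmod_isomorphic K (A a) (B b)"
    proof
      assume "g b = f a"
      then show "pmod_isomorphic K (A a) (B b)"
        using iso_refl[OF pfdD(1)[OF pA[OF a]]] a unfolding f_def g_def by blast
    next
      assume ab: "pmod_isomorphic K (A a) (B b)"
      show "g b = f a"
        unfolding f_def g_def using iso_trans[OF _ ab] iso_trans[OF _ symA[OF a ab]] by auto
    qed
  qed
  \<comment> \<open>the isomorphism class of \<open>B b\<close> occurs in the first decomposition, too\<close>
  have key: "\<exists>a\<in>I. g b = f a" if b: "b \<in> I'" for b
  proof -
    have "b \<in> {c\<in>I'. pmod_isomorphic K (B b) (B c)}" using b iso_refl[OF pfdD(1)[OF pB[OF b]]] by simp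
    then have "card {c\<in>I'. pmod_isomorphic K (B b) (B c)} > 0"
      using multiplicity_le(1)[OF S dB dA iA iB[OF b] pB[OF b]] card_gt_0_iff by blast
    then have "card {a\<in>I. pmod_isomorphic K (B b) (A a)} > 0"
      using multiplicity_le(2)[OF S dB dA iA iB[OF b] pB[OF b]] by simp
    then have "{a\<in>I. pmod_isomorphic K (B b) (A a)} \<noteq> {}" using card_gt_0_iff by blast
    then obtain a where "a \<in> I" "pmod_isomorphic K (B b) (A a)" by blast
    then show ?thesis using gB[OF \<open>a \<in> I\<close>] symB[OF b] b by blast
  qed
  obtain \<sigma> where \<sigma>: "bij_betw \<sigma> I I'" "\<And>a. a \<in> I ==> g (\<sigma> a) = f a"
  proof (rule bij_betw_of_fibres[of I f I' g])
    fix k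
    show "\<exists>h. bij_betw h {a\<in>I. f a = k} {b\<in>I'. g b = k}"
    proof (cases "\<exists>a\<in>I. k = f a")
      case True
      then obtain a where a: "a \<in> I" "k = f a" by blast
      show ?thesis
        unfolding a(2) fA[OF a(1)] gB[OF a(1)]
        using cardA[OF a(1)] by (rule finite_same_card_bij)
    next
      case False
      then have empty: "{a\<in>I. f a = k} = {}" "{b\<in>I'. g b = k} = {}" using key by auto
      show ?thesis unfolding empty by (simp add: bij_betw_def)
    qed
  qed blast
  have "pmod_isomorphic K (A a) (B (\<sigma> a))" if a: "a \<in> I" for a
    using \<sigma>(2)[OF a] gB[OF a] bij_betwE[OF \<sigma>(1)] a by blast
  then show thesis using \<sigma>(1) that by blast
qed


section \<open>Existence of decompositions into indecomposables\<close>

text \<open>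
The projection to \<open>A\<close> along the complement \<open>B\<close> is the quotient map \<open>X \<rightarrow> X/B\<close> followed by the inverse of
the isomorphism \<open>A \<rightarrow> X/B\<close>.
\<close>
lemma complement_projection:
  assumes X: "pmodule K X" and A: "psubmodule K A X" and B: "psubmodule K B X"
    and AB: "\<And>p. A p \<inter> B p = {zero_of X p}" "\<And>p. A p <+>\<^bsub>Sp X p\<^esub> B p = elts X p"
  obtains \<alpha> where "\<alpha> \<in> Hom X X" "\<And>p x. x \<in> elts X p ==> \<alpha> p x \<in> A p"
    "\<And>p x. x \<in> A p ==> \<alpha> p x = x" "\<And>p x. x \<in> B p ==> \<alpha> p x = zero_of X p"
proof -
  let ?q = "\<lambda>p x. B p +>\<^bsub>Sp X p\<^esub> x"
  note q = quot_facts[OF X B] and V = pmodD(1)[OF X]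
  note SA = psubD(1)[OF A] and SB = psubD(1)[OF B]
  have q0: "?q p b = B p" if "b \<in> B p" for p b
  proof -
    have "b \<in> B p +>\<^bsub>Sp X p\<^esub> (zero_of X p)" using that a_coset_facts(4)[OF SB] by simp
    from a_coset_facts(2)[OF SB vs_closed(1)[OF V] this] show ?thesis using a_coset_facts(4)[OF SB] by simp
  qed
  have qA: "?q \<in> Hom (pmod_sub X A) (pmod_quot X B)" by (rule hom_sub_dom[OF q(2) A])
  have bij: "bij_betw (?q p) (elts (pmod_sub X A) p) (elts (pmod_quot X B) p)" for p
    unfolding bij_betw_def linear_inj_iff[OF homD(1)[OF qA]]
  proof (intro conjI ballI impI equalityI subsetI)
    fix a assume a: "a \<in> elts (pmod_sub X A) p" "?q p a = zero_of (pmod_quot X B) p"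
    then have "a \<in> B p" using a_coset_facts(1)[OF SB, of a p] psubD(3)[OF A, of a p] q(4)[of p] by simp
    then show "a = zero_of (pmod_sub X A) p" using AB(1)[of p] a(1) by auto
  next
    fix c assume "c \<in> elts (pmod_quot X B) p"
    then obtain x where x: "x \<in> elts X p" "c = ?q p x" unfolding q(3)[symmetric] by blast
    then obtain a b where ab: "a \<in> A p" "b \<in> B p" "x = a \<oplus>\<^bsub>Sp X p\<^esub> b"
      using AB(2)[of p] unfolding set_add_def' by blast
    have c: "a \<in> elts X p" "b \<in> elts X p" using ab psubD(3)[OF A] psubD(3)[OF B] by auto
    have "x \<in> B p +>\<^bsub>Sp X p\<^esub> a"
      using ab vs_add_ac(2)[OF V c c(1)] a_coset_facts(5)[OF SB c(1)] by blast
    then have "c = ?q p a" using a_coset_facts(2)[OF SB c(1)] x(2) by blast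
    then show "c \<in> ?q p ` elts (pmod_sub X A) p" using ab(1) by simp
  qed (use homD(3)[OF qA] in blast)
  obtain g where g: "g \<in> Hom (pmod_quot X B) (pmod_sub X A)" "\<And>p a. a \<in> A p ==> g p (?q p a) = a"
    by (rule hom_inverse[OF pmodule_sub[OF X A] qA bij]) simp
  note \<alpha> = hom_comp[OF q(2) g(1)]
  show thesis
  proof (rule that[OF hom_comp[OF \<alpha> hom_sub_dom[OF hom_id[OF X] A]]])
    show "g p (?q p x) \<in> A p" if "x \<in> elts X p" for p x using homD(3)[OF \<alpha> that] by simp
    show "g p (?q p x) = x" if "x \<in> A p" for p x using g(2)[OF that] .
    show "g p (?q p x) = zero_of X p" if "x \<in> B p" for p x
      using homD(6)[OF g(1), of p] q0[OF that] q(4)[of p] by simp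
  qed
qed

definition commuting_idempotents :: "('p::order, 'k, 'v) pmod => ('p => 'v => 'v) set => bool" where
  "commuting_idempotents M E \<longleftrightarrow> E \<subseteq> Hom M M \<and>
    (\<forall>e\<in>E. \<forall>p. \<forall>x\<in>elts M p. e p (e p x) = e p x) \<and>
    (\<forall>e\<in>E. \<forall>f\<in>E. \<forall>p. \<forall>x\<in>elts M p. e p (f p x) = f p (e p x))"

lemma maximal_commuting_idempotents:
  obtains E where "commuting_idempotents M E"
    and "\<And>e. e \<in> Hom M M ==> (\<And>p x. x \<in> elts M p ==> e p (e p x) = e p x) ==>
      (\<And>f p x. f \<in> E ==> x \<in> elts M p ==> e p (f p x) = f p (e p x)) ==> e \<in> E"
proof -
  have "\<exists>E\<in>Collect (commuting_idempotents M). \<forall>E'\<in>Collect (commuting_idempotents M). E \<subseteq> E' \<longrightarrow> E' = E"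
  proof (rule subset_Zorn')
    fix C assume "subset.chain (Collect (commuting_idempotents M)) C"
    then have C: "\<And>E. E \<in> C ==> commuting_idempotents M E" "\<And>E E'. E \<in> C ==> E' \<in> C ==> E \<subseteq> E' \<or> E' \<subseteq> E"
      by (auto simp: subset_chain_def)
    have "e p (f p x) = f p (e p x)"
      if e: "e \<in> \<Union>C" and f: "f \<in> \<Union>C" and x: "x \<in> elts M p" for e f p x
    proof -
      obtain E where "E \<in> C" "e \<in> E" "f \<in> E" using e f C(2) by blast
      then show ?thesis using C(1) x unfolding commuting_idempotents_def by blast
    qed
    moreover have "\<Union>C \<subseteq> Hom M M" "\<forall>e\<in>\<Union>C. \<forall>p. \<forall>x\<in>elts M p. e p (e p x) = e p x"
      using C(1) unfolding commuting_idempotents_def by blast+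
    ultimately show "\<Union>C \<in> Collect (commuting_idempotents M)"
      by (simp add: commuting_idempotents_def)
  qed
  then obtain E where E: "commuting_idempotents M E"
    "\<And>E'. commuting_idempotents M E' ==> E \<subseteq> E' ==> E' = E" by auto
  have "e \<in> E" if "e \<in> Hom M M" "\<And>p x. x \<in> elts M p ==> e p (e p x) = e p x"
    "\<And>f p x. f \<in> E ==> x \<in> elts M p ==> e p (f p x) = f p (e p x)" for e
  proof -
    have "commuting_idempotents M (insert e E)"
      using E(1) that by (simp add: commuting_idempotents_def)
    then show ?thesis using E(2)[of "insert e E"] by blast
  qed
  with E(1) show thesis by (rule that)
qed

context
  fixes M :: "('p::order, 'k, 'v) pmod" and E :: "('p => 'v => 'v) set"
  assumes M: "pfd K M" and E: "commuting_idempotents M E"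
    and max: "\<And>e. e \<in> Hom M M ==> (\<And>p x. x \<in> elts M p ==> e p (e p x) = e p x) ==>
      (\<And>f p x. f \<in> E ==> x \<in> elts M p ==> e p (f p x) = f p (e p x)) ==> e \<in> E"
begin

lemma E_hom: "e \<in> E ==> e \<in> Hom M M"
  and E_idem: "e \<in> E ==> x \<in> elts M p ==> e p (e p x) = e p x"
  and E_comm: "e \<in> E ==> f \<in> E ==> x \<in> elts M p ==> e p (f p x) = f p (e p x)"
  using E by (auto simp: commuting_idempotents_def)

lemma E_closed: "e \<in> E ==> x \<in> elts M p ==> e p x \<in> elts M p"
  using homD(3)[OF E_hom] .

lemma E_id: "(\<lambda>p x. x) \<in> E"
  by (rule max[OF hom_id[OF pfdD(1)[OF M]]]) simp_all

lemma E_comp: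
  assumes e: "e \<in> E" and f: "f \<in> E"
  shows "(\<lambda>p x. e p (f p x)) \<in> E"
proof (rule max[OF hom_comp[OF E_hom[OF f] E_hom[OF e]]])
  show "e p (f p (e p (f p x))) = e p (f p x)" if x: "x \<in> elts M p" for p x
    using E_comm[OF f e E_closed[OF f x]] E_idem[OF f x] E_idem[OF e E_closed[OF f x]] by simp
  show "e p (f p (g p x)) = g p (e p (f p x))" if g: "g \<in> E" and x: "x \<in> elts M p" for g p x
    using E_comm[OF f g x] E_comm[OF e g E_closed[OF f x]] by simp
qed

lemma E_compl:
  assumes e: "e \<in> E"
  shows "(\<lambda>p x. x \<ominus>\<^bsub>Sp M p\<^esub> e p x) \<in> E"
proof (rule max[OF hom_minus[OF pfdD(1)[OF M] hom_id[OF pfdD(1)[OF M]] E_hom[OF e]]])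
  note V = pmodD(1)[OF pfdD(1)[OF M]]
  show "x \<ominus>\<^bsub>Sp M p\<^esub> e p x \<ominus>\<^bsub>Sp M p\<^esub> e p (x \<ominus>\<^bsub>Sp M p\<^esub> e p x) = x \<ominus>\<^bsub>Sp M p\<^esub> e p x"
    if x: "x \<in> elts M p" for p x
    using homD(7)[OF E_hom[OF e] x E_closed[OF e x]] E_idem[OF e x] E_closed[OF e x] x V[of p] by simp
  show "f p x \<ominus>\<^bsub>Sp M p\<^esub> e p (f p x) = f p (x \<ominus>\<^bsub>Sp M p\<^esub> e p x)"
    if f: "f \<in> E" and x: "x \<in> elts M p" for f p x
    using homD(7)[OF E_hom[OF f] x E_closed[OF e x]] E_comm[OF e f x] by simp
qed

text \<open>
The joint eigenspaces of \<open>E\<close>. Each idempotent has the eigenvalues 1 and 0, so a system of eigenvalues is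
given by the set \<open>\<chi>\<close> of the idempotents whose eigenvalue is 1.
\<close>
definition block :: "('p => 'v => 'v) set => 'p => 'v set" where
  "block \<chi> p = {x \<in> elts M p. (\<forall>e\<in>\<chi>. e p x = x) \<and> (\<forall>e\<in>E - \<chi>. e p x = zero_of M p)}"

text \<open>
The eigenvalue systems that occur. Like the characters of an algebra of functions, they are closed under
products (\<open>char_comp\<close>) and contain \<open>e\<close> or \<open>1 - e\<close> for every \<open>e\<close> in \<open>E\<close> (\<open>char_compl\<close>).
\<close>
definition chars :: "('p => 'v => 'v) set set" where
  "chars = {\<chi>. \<chi> \<subseteq> E \<and> (\<exists>p. \<exists>x\<in>block \<chi> p. x \<noteq> zero_of M p)}"

lemma blockD:
  assumes "x \<in> block \<chi> p"
  shows "x \<in> elts M p" "e \<in> \<chi> ==> e p x = x" "e \<in> E ==> e \<notin> \<chi> ==> e p x = zero_of M p"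
  using assms by (auto simp: block_def)

lemma charsE:
  assumes "\<chi> \<in> chars"
  obtains p x where "\<chi> \<subseteq> E" "x \<in> block \<chi> p" "x \<noteq> zero_of M p"
  using assms by (auto simp: chars_def)

lemma char_id: "\<chi> \<in> chars ==> (\<lambda>p x. x) \<in> \<chi>"
  by (erule charsE) (use blockD(3)[OF _ E_id] in blast)

lemma char_comp:
  assumes "\<chi> \<in> chars" "e \<in> \<chi>" "f \<in> \<chi>"
  shows "(\<lambda>p x. e p (f p x)) \<in> \<chi>"
proof (rule ccontr)
  assume *: "(\<lambda>p x. e p (f p x)) \<notin> \<chi>"
  obtain p x where x: "\<chi> \<subseteq> E" "x \<in> block \<chi> p" "x \<noteq> zero_of M p" using assms(1) by (rule charsE)
  have ef: "(\<lambda>p x. e p (f p x)) \<in> E" by (rule E_comp) (use assms(2,3) x(1) in auto)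
  have "e p (f p x) = zero_of M p" using blockD(3)[OF x(2) ef *] .
  then show False using blockD(2)[OF x(2) assms(2)] blockD(2)[OF x(2) assms(3)] x(3) by simp
qed

lemma char_compl:
  assumes "\<chi> \<in> chars" "e \<in> E" "e \<notin> \<chi>"
  shows "(\<lambda>p x. x \<ominus>\<^bsub>Sp M p\<^esub> e p x) \<in> \<chi>"
proof (rule ccontr)
  assume *: "(\<lambda>p x. x \<ominus>\<^bsub>Sp M p\<^esub> e p x) \<notin> \<chi>"
  obtain p x where x: "\<chi> \<subseteq> E" "x \<in> block \<chi> p" "x \<noteq> zero_of M p" using assms(1) by (rule charsE)
  have "x \<ominus>\<^bsub>Sp M p\<^esub> e p x = zero_of M p" using blockD(3)[OF x(2) E_compl[OF assms(2)] *] .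
  then show False
    using blockD(3)[OF x(2) assms(2,3)] blockD(1)[OF x(2)] x(3) pmodD(1)[OF pfdD(1)[OF M]] by simp
qed

text \<open>
The image of \<open>f e\<close> is contained in the image of \<open>e\<close> because \<open>e\<close> and \<open>f\<close> commute. If it is not smaller, then
every \<open>e z\<close> lies in the image of the idempotent \<open>f\<close>.
\<close>
lemma image_minimal:
  assumes e: "e \<in> E" and f: "f \<in> E"
    and le: "sdim (Sp M p) (e p ` elts M p)
      \<le> sdim (Sp M p) ((\<lambda>x. f p (e p x)) ` elts M p)"
    and z: "z \<in> elts M p"
  shows "f p (e p z) = e p z"
proof -
  note V = pmodD(1)[OF pfdD(1)[OF M], of p]
  have sub: "subsp (g p ` elts M p) (Sp M p)" if "g \<in> E" for g
    by (rule subspace_image[OF homD(1)[OF E_hom[OF that]] subspace_carrier[OF V]])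
  have incl: "(\<lambda>x. f p (e p x)) ` elts M p \<subseteq> e p ` elts M p"
    using E_comm[OF f e] E_closed[OF f] by auto
  have "(\<lambda>x. f p (e p x)) ` elts M p = e p ` elts M p"
    using dm_mono[OF V pfdD(2)[OF M] sub[OF E_comp[OF f e]] sub[OF e] incl] le by simp
  then obtain w where w: "w \<in> elts M p" "e p z = f p (e p w)" using z by blast
  then show ?thesis using E_idem[OF f E_closed[OF e w(1)]] by simp
qed

text \<open>
Among the idempotents in \<open>\<chi>\<close> take one, \<open>e\<close>, whose image at \<open>p\<close> has least dimension. As \<open>\<chi>\<close> is closed under
products, every other element of \<open>\<chi>\<close> acts as the identity on the image of \<open>e\<close>; and if \<open>f\<close> is not in \<open>\<chi>\<close>
then \<open>1 - f\<close> is.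
\<close>
lemma char_stabilizes:
  assumes \<chi>: "\<chi> \<in> chars"
  obtains e where "e \<in> \<chi>" "\<And>x. x \<in> elts M p ==> e p x \<in> block \<chi> p"
proof -
  have \<chi>E: "\<chi> \<subseteq> E" using \<chi> by (rule charsE)
  obtain e where e: "e \<in> \<chi>" "\<And>f. f \<in> \<chi> ==> sdim (Sp M p) (e p ` elts M p)
      \<le> sdim (Sp M p) (f p ` elts M p)"
    using ex_has_least_nat[of "\<lambda>f. f \<in> \<chi>" _ "\<lambda>f. sdim (Sp M p) (f p ` elts M p)"]
      char_id[OF \<chi>] by blast
  have fix1: "f p (e p x) = e p x" if f: "f \<in> \<chi>" and x: "x \<in> elts M p" for f x
  proof (rule image_minimal[where e = e and f = f, OF _ _ _ x])
    show "sdim (Sp M p) (e p ` elts M p)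
        \<le> sdim (Sp M p) ((\<lambda>x. f p (e p x)) ` elts M p)"
      using e(2)[OF char_comp[OF \<chi> f e(1)]] .
  qed (use \<chi>E f e(1) in auto)
  have "e p x \<in> block \<chi> p" if x: "x \<in> elts M p" for x
  proof -
    have ex: "e p x \<in> elts M p" using E_closed e(1) \<chi>E x by blast
    have "f p (e p x) = zero_of M p" if f: "f \<in> E" "f \<notin> \<chi>" for f
    proof -
      have fx: "f p (e p x) \<in> elts M p" using E_closed[OF f(1) ex] .
      have "e p x \<ominus>\<^bsub>Sp M p\<^esub> f p (e p x) = e p x" using fix1[OF char_compl[OF \<chi> f] x] .
      then have "f p (e p x \<ominus>\<^bsub>Sp M p\<^esub> f p (e p x)) = f p (e p x)" by simp
      then show ?thesis
        using homD(7)[OF E_hom[OF f(1)] ex fx] E_idem[OF f(1) ex] fx pmodD(1)[OF pfdD(1)[OF M]] by simp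
    qed
    then show ?thesis using ex fix1[OF _ x] by (simp add: block_def)
  qed
  with e(1) show thesis by (rule that)
qed

text \<open>
The projection to a block is the limit of the idempotents in \<open>\<chi>\<close>: at each point it agrees with one of
them, which depends on the point.
\<close>
definition block_pr :: "('p => 'v => 'v) set => 'p => 'v => 'v" where
  "block_pr \<chi> p = (SOME e. e \<in> \<chi> \<and> (\<forall>x\<in>elts M p. e p x \<in> block \<chi> p)) p"

lemma block_prE:
  assumes \<chi>: "\<chi> \<in> chars"
  obtains e where "e \<in> \<chi>" "e \<in> E" "block_pr \<chi> p = e p"
    "\<And>x. x \<in> elts M p ==> e p x \<in> block \<chi> p"
proof -
  have "\<exists>e. e \<in> \<chi> \<and> (\<forall>x\<in>elts M p. e p x \<in> block \<chi> p)"
    by (rule char_stabilizes[OF \<chi>, of p]) blast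
  from someI_ex[OF this] show thesis
    using charsE[OF \<chi>] that unfolding block_pr_def by blast
qed

lemma block_pr_in: "\<chi> \<in> chars ==> x \<in> elts M p ==> block_pr \<chi> p x \<in> block \<chi> p"
  by (rule block_prE[of \<chi> p]) auto

lemma block_pr_id: "\<chi> \<in> chars ==> x \<in> block \<chi> p ==> block_pr \<chi> p x = x"
  by (rule block_prE[of \<chi> p]) (auto simp: blockD(2))

lemma block_pr_comm:
  "\<chi> \<in> chars ==> f \<in> E ==> x \<in> elts M p ==> f p (block_pr \<chi> p x) = block_pr \<chi> p (f p x)"
  by (rule block_prE[of \<chi> p]) (auto simp: E_comm)

lemma block_pr_unique:
  assumes \<chi>: "\<chi> \<in> chars" and f: "f \<in> \<chi>" "\<And>x. x \<in> elts M p ==> f p x \<in> block \<chi> p"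
    and x: "x \<in> elts M p"
  shows "f p x = block_pr \<chi> p x"
proof -
  have fE: "f \<in> E" using f(1) charsE[OF \<chi>] by blast
  have "f p (block_pr \<chi> p x) = block_pr \<chi> p x" using blockD(2)[OF block_pr_in[OF \<chi> x] f(1)] .
  then show ?thesis using block_pr_comm[OF \<chi> fE x] block_pr_id[OF \<chi> f(2)[OF x]] by simp
qed

lemma block_pr_linear: "\<chi> \<in> chars ==> linear_map K (Sp M p) (Sp M p) (block_pr \<chi> p)"
  by (rule block_prE[of \<chi> p]) (use homD(1)[OF E_hom] in auto)

lemma psub_block: assumes "\<chi> \<in> chars" shows "psubmodule K (block \<chi>) M"
proof (rule psubI)
  note P = pfdD(1)[OF M] and V = pmodD(1)[OF pfdD(1)[OF M]]
  have \<chi>E: "\<chi> \<subseteq> E" using assms by (rule charsE)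
  show "subsp (block \<chi> p) (Sp M p)" for p
  proof (rule subspaceI[OF V])
    show "block \<chi> p \<subseteq> elts M p" using blockD(1) by blast
    show "zero_of M p \<in> block \<chi> p"
      using V[of p] homD(6)[OF E_hom] \<chi>E by (simp add: block_def subset_iff)
    show "x \<oplus>\<^bsub>Sp M p\<^esub> y \<in> block \<chi> p" if x: "x \<in> block \<chi> p" and y: "y \<in> block \<chi> p" for x y
      unfolding block_def
    proof (intro CollectI conjI ballI)
      note xc = blockD(1)[OF x] and yc = blockD(1)[OF y]
      show "x \<oplus>\<^bsub>Sp M p\<^esub> y \<in> elts M p" using V xc yc by simp
      show "e p (x \<oplus>\<^bsub>Sp M p\<^esub> y) = x \<oplus>\<^bsub>Sp M p\<^esub> y" if e: "e \<in> \<chi>" for e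
        using homD(4)[OF E_hom[OF subsetD[OF \<chi>E e]] xc yc] blockD(2)[OF x e] blockD(2)[OF y e] by simp
      show "e p (x \<oplus>\<^bsub>Sp M p\<^esub> y) = zero_of M p" if e: "e \<in> E - \<chi>" for e
        using homD(4)[OF E_hom xc yc, of e] blockD(3)[OF x, of e] blockD(3)[OF y, of e] e V[of p] by simp
    qed
    show "c \<odot>\<^bsub>Sp M p\<^esub> x \<in> block \<chi> p" if c: "c \<in> carrier K" and x: "x \<in> block \<chi> p" for c x
      unfolding block_def
    proof (intro CollectI conjI ballI)
      note xc = blockD(1)[OF x]
      show "c \<odot>\<^bsub>Sp M p\<^esub> x \<in> elts M p" using V xc c by simp
      show "e p (c \<odot>\<^bsub>Sp M p\<^esub> x) = c \<odot>\<^bsub>Sp M p\<^esub> x" if e: "e \<in> \<chi>" for e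
        using homD(5)[OF E_hom[OF subsetD[OF \<chi>E e]] c xc] blockD(2)[OF x e] by simp
      show "e p (c \<odot>\<^bsub>Sp M p\<^esub> x) = zero_of M p" if e: "e \<in> E - \<chi>" for e
        using homD(5)[OF E_hom c xc, of e] blockD(3)[OF x, of e] e c V[of p] by simp
    qed
  qed
  show "Mp M p q x \<in> block \<chi> q" if pq: "p \<le> q" and x: "x \<in> block \<chi> p" for p q x
    unfolding block_def
  proof (intro CollectI conjI ballI)
    note xc = blockD(1)[OF x]
    show "Mp M p q x \<in> elts M q" by (rule pmodD(3)[OF P pq xc])
    show "e q (Mp M p q x) = Mp M p q x" if e: "e \<in> \<chi>" for e
      using homD(2)[OF E_hom[OF subsetD[OF \<chi>E e]] pq xc] blockD(2)[OF x e] by simp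
    show "e q (Mp M p q x) = zero_of M q" if e: "e \<in> E - \<chi>" for e
      using homD(2)[OF E_hom pq xc, of e] blockD(3)[OF x, of e] e linear_mapD(6)[OF pmodD(2)[OF P pq]] by simp
  qed
qed

lemma block_pr_other:
  assumes \<chi>: "\<chi> \<in> chars" "\<chi>' \<in> chars" "\<chi> \<noteq> \<chi>'" and x: "x \<in> block \<chi>' p"
  shows "block_pr \<chi> p x = zero_of M p"
proof -
  have sub: "\<chi> \<subseteq> E" "\<chi>' \<subseteq> E" using \<chi>(1,2) by (auto simp: chars_def)
  note xc = blockD(1)[OF x]
  note px = block_pr_in[OF \<chi>(1) xc]
  from \<chi>(3) consider e where "e \<in> \<chi>" "e \<notin> \<chi>'" | e where "e \<in> \<chi>'" "e \<notin> \<chi>" by blast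
  then show ?thesis
  proof cases
    case (1 e)
    have e: "e \<in> E" using 1 sub by blast
    show ?thesis
      using block_pr_comm[OF \<chi>(1) e xc] blockD(2)[OF px 1(1)] blockD(3)[OF x e 1(2)]
        linear_mapD(6)[OF block_pr_linear[OF \<chi>(1)]] by simp
  next
    case (2 e)
    have e: "e \<in> E" using 2 sub by blast
    show ?thesis
      using block_pr_comm[OF \<chi>(1) e xc] blockD(3)[OF px e 2(2)] blockD(2)[OF x 2(1)] by simp
  qed
qed

text \<open>
For naturality with respect to \<open>p \<le> q\<close>, multiply an idempotent that computes the projection at \<open>p\<close> by one
that computes it at \<open>q\<close>. The product computes it at both points, and it is a morphism.
\<close>
lemma block_pr_hom:
  assumes \<chi>: "\<chi> \<in> chars" shows "block_pr \<chi> \<in> Hom M (pmod_sub M (block \<chi>))"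
proof (rule hom_sub_cod[OF homI[OF block_pr_linear[OF \<chi>]] psub_block[OF \<chi>] block_pr_in[OF \<chi>]])
  fix p q x assume pq: "p \<le> q" and x: "x \<in> elts M p"
  obtain e where e: "e \<in> \<chi>" "e \<in> E" "\<And>x. x \<in> elts M p ==> e p x \<in> block \<chi> p"
    by (rule block_prE[OF \<chi>, of p]) blast
  obtain f where f: "f \<in> \<chi>" "f \<in> E" "\<And>x. x \<in> elts M q ==> f q x \<in> block \<chi> q"
    by (rule block_prE[OF \<chi>, of q]) blast
  let ?g = "\<lambda>p x. e p (f p x)"
  have g: "?g \<in> \<chi>" by (rule char_comp[OF \<chi> e(1) f(1)])
  have gE: "?g \<in> E" by (rule E_comp[OF e(2) f(2)])
  have gp: "?g p x = block_pr \<chi> p x"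
    by (rule block_pr_unique[OF \<chi> g _ x]) (use e(3) E_closed[OF f(2)] in blast)
  have gq: "?g q x = block_pr \<chi> q x" if "x \<in> elts M q" for x
    by (rule block_pr_unique[OF \<chi> g _ that]) (use f(3) blockD(2)[OF f(3) e(1)] in simp)
  show "block_pr \<chi> q (Mp M p q x) = Mp M p q (block_pr \<chi> p x)"
    using homD(2)[OF E_hom[OF gE] pq x] gp gq[OF pmodD(3)[OF pfdD(1)[OF M] pq x]] by simp
qed

text \<open>
Take \<open>e\<close> in \<open>E\<close> with \<open>e x \<noteq> 0\<close> and with image at \<open>p\<close> of least dimension. By minimality every \<open>f\<close> in \<open>E\<close> with
\<open>f e x \<noteq> 0\<close> is the identity on the image of \<open>e\<close>. Hence \<open>e x\<close> is a joint eigenvector.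
\<close>
lemma exists_char:
  assumes x: "x \<in> elts M p" "x \<noteq> zero_of M p"
  obtains \<chi> where "\<chi> \<in> chars" "block_pr \<chi> p x \<noteq> zero_of M p"
proof -
  note V = pmodD(1)[OF pfdD(1)[OF M], of p]
  let ?d = "\<lambda>e. sdim (Sp M p) (e p ` elts M p)"
  obtain e where e: "e \<in> E" "e p x \<noteq> zero_of M p"
    "\<And>f. f \<in> E ==> f p x \<noteq> zero_of M p ==> ?d e \<le> ?d f"
    using ex_has_least_nat[of "\<lambda>e. e \<in> E \<and> e p x \<noteq> zero_of M p" "\<lambda>p x. x" ?d] E_id x(2) by blast
  define \<chi> where "\<chi> = {f \<in> E. \<forall>z\<in>elts M p. f p (e p z) = e p z}"
  have dich: "f \<in> \<chi>" if "f \<in> E" "f p (e p x) \<noteq> zero_of M p" for f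
  proof -
    have "?d e \<le> sdim (Sp M p) ((\<lambda>x. f p (e p x)) ` elts M p)"
      using e(3)[OF E_comp[OF that(1) e(1)] that(2)] .
    from image_minimal[where e = e and f = f, OF e(1) that(1) this] show ?thesis
      using that(1) by (simp add: \<chi>_def)
  qed
  have ex: "e p x \<in> elts M p" using E_closed[OF e(1) x(1)] .
  have "f p (e p x) = zero_of M p" if "f \<in> E" "f \<notin> \<chi>" for f using dich that by blast
  then have blk: "e p x \<in> block \<chi> p" using ex x(1) by (auto simp: block_def \<chi>_def)
  then have \<chi>: "\<chi> \<in> chars" using e(2) by (auto simp: chars_def \<chi>_def)
  have "e p (block_pr \<chi> p x) = e p x"
    using block_pr_comm[OF \<chi> e(1) x(1)] block_pr_id[OF \<chi> blk] by simp
  then have "block_pr \<chi> p x \<noteq> zero_of M p" using e(2) homD(6)[OF E_hom[OF e(1)], of p] by auto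
  with \<chi> show thesis by (rule that)
qed

text \<open>
The nonzero components of an element at \<open>p\<close> form a dual family to the projections to their blocks, so
there are finitely many of them. An element all of whose components vanish is zero by the previous lemma.
\<close>
lemma decomp_blocks: "decomp M chars (\<lambda>\<chi>. pmod_sub M (block \<chi>)) block_pr"
proof (rule decompI)
  note P = pfdD(1)[OF M] and V = pmodD(1)[OF pfdD(1)[OF M]]
  show "pmodule K M" by (rule P)
  show "pmodule K (pmod_sub M (block \<chi>))" "block_pr \<chi> \<in> Hom M (pmod_sub M (block \<chi>))"
    if "\<chi> \<in> chars" for \<chi> using pmodule_sub[OF P psub_block[OF that]] block_pr_hom[OF that] by auto
  fix p
  show "finite {\<chi> \<in> chars. block_pr \<chi> p x \<noteq> zero_of (pmod_sub M (block \<chi>)) p}"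
    if x: "x \<in> elts M p" for x
  proof (rule finite_dual_family[where W = "\<lambda>_. Sp M p" and pr = "\<lambda>\<chi>. block_pr \<chi> p" and y = "\<lambda>\<chi>. block_pr \<chi> p x",
        OF V pfdD(2)[OF M]])
    fix \<chi> \<chi>' assume \<chi>: "\<chi> \<in> {\<chi> \<in> chars. block_pr \<chi> p x \<noteq> zero_of (pmod_sub M (block \<chi>)) p}"
    show "linear_map K (Sp M p) (Sp M p) (block_pr \<chi> p)" using block_pr_linear \<chi> by blast
    show "block_pr \<chi> p x \<in> elts M p" using blockD(1)[OF block_pr_in[OF _ x]] \<chi> by blast
    show "block_pr \<chi> p (block_pr \<chi> p x) \<noteq> zero_of M p"
      using block_pr_id[OF _ block_pr_in[OF _ x]] \<chi> by simp
    show "block_pr \<chi>' p (block_pr \<chi> p x) = zero_of M p"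
      if "\<chi>' \<in> {\<chi> \<in> chars. block_pr \<chi> p x \<noteq> zero_of (pmod_sub M (block \<chi>)) p}" "\<chi>' \<noteq> \<chi>"
      using block_pr_other[OF _ _ that(2) block_pr_in[OF _ x]] \<chi> that(1) by simp
  qed
  show "x = zero_of M p" if "x \<in> elts M p"
    "\<And>\<chi>. \<chi> \<in> chars ==> block_pr \<chi> p x = zero_of (pmod_sub M (block \<chi>)) p" for x
    by (rule ccontr, rule exists_char[OF that(1)]) (use that(2) in auto)
  show "\<exists>x\<in>elts M p. \<forall>\<chi>\<in>chars. block_pr \<chi> p x = y \<chi>"
    if y: "\<And>\<chi>. \<chi> \<in> chars ==> y \<chi> \<in> elts (pmod_sub M (block \<chi>)) p"
      and fin: "finite {\<chi> \<in> chars. y \<chi> \<noteq> zero_of (pmod_sub M (block \<chi>)) p}" for y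
  proof -
    have "\<exists>x\<in>elts M p. \<forall>\<chi>\<in>chars. block_pr \<chi> p x = (if \<chi> \<in> F then y \<chi> else zero_of M p)"
      if "finite F" "F \<subseteq> chars" for F
      using that
    proof (induction F rule: finite_induct)
      case empty
      then show ?case
        using linear_mapD(6)[OF block_pr_linear] V by (intro bexI[of _ "zero_of M p"]) auto
    next
      case (insert \<phi> F)
      then obtain x where x: "x \<in> elts M p"
        "\<And>\<chi>. \<chi> \<in> chars ==> block_pr \<chi> p x = (if \<chi> \<in> F then y \<chi> else zero_of M p)" by auto
      have \<phi>: "\<phi> \<in> chars" using insert.prems by blast
      have yb: "y \<chi> \<in> block \<chi> p" if "\<chi> \<in> chars" for \<chi> using y[OF that] by simp
      have yc: "y \<chi> \<in> elts M p" if "\<chi> \<in> chars" for \<chi> using blockD(1)[OF yb[OF that]] .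
      have "block_pr \<chi> p (x \<oplus>\<^bsub>Sp M p\<^esub> y \<phi>) = (if \<chi> \<in> insert \<phi> F then y \<chi> else zero_of M p)"
        if \<chi>: "\<chi> \<in> chars" for \<chi>
        using linear_mapD(4)[OF block_pr_linear[OF \<chi>] x(1) yc[OF \<phi>]] x(2)[OF \<chi>] insert.hyps(2)
          block_pr_id[OF \<phi> yb[OF \<phi>]] block_pr_other[OF \<chi> \<phi> _ yb[OF \<phi>]] yc[OF \<chi>] V[of p]
        by (cases "\<chi> = \<phi>") simp_all
      moreover have "x \<oplus>\<^bsub>Sp M p\<^esub> y \<phi> \<in> elts M p" using V x(1) yc[OF \<phi>] by simp
      ultimately show ?case by blast
    qed
    from this[OF fin] obtain x where x: "x \<in> elts M p"
      "\<And>\<chi>. \<chi> \<in> chars ==> block_pr \<chi> p x = (if y \<chi> \<noteq> zero_of M p then y \<chi> else zero_of M p)" by auto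
    show ?thesis by (rule bexI[OF _ x(1)]) (use x(2) in \<open>auto split: if_splits\<close>)
  qed
qed

text \<open>
Suppose that the block is the sum of \<open>A\<close> and \<open>B\<close>. Projecting to the block and then to \<open>A\<close> is an idempotent
endomorphism of \<open>M\<close>. It commutes with \<open>E\<close>, because every element of \<open>E\<close> is 0 or 1 on the block, so by
maximality it lies in \<open>E\<close> and is itself 0 or 1 on the block.
\<close>
lemma indecomposable_block:
  assumes \<chi>: "\<chi> \<in> chars"
  shows "indecomposable K (pmod_sub M (block \<chi>))"
  unfolding indecomposable_def
proof (intro conjI allI impI)
  note P = pfdD(1)[OF M] and V = pmodD(1)[OF pfdD(1)[OF M]]
  let ?N = "pmod_sub M (block \<chi>)"
  show PN: "pmodule K ?N" by (rule pmodule_sub[OF P psub_block[OF \<chi>]])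
  show "\<exists>p. elts ?N p \<noteq> {zero_of ?N p}" using \<chi> by (auto simp: chars_def)
  fix A B
  assume *: "psubmodule K A ?N \<and> psubmodule K B ?N \<and>
    (\<forall>p. A p \<inter> B p = {zero_of ?N p} \<and> A p <+>\<^bsub>Sp ?N p\<^esub> B p = elts ?N p)"
  then have A: "psubmodule K A ?N" and B: "psubmodule K B ?N" by auto
  obtain \<alpha> where \<alpha>: "\<alpha> \<in> Hom ?N ?N" "\<And>p x. x \<in> elts ?N p ==> \<alpha> p x \<in> A p"
    "\<And>p x. x \<in> A p ==> \<alpha> p x = x" "\<And>p x. x \<in> B p ==> \<alpha> p x = zero_of ?N p"
    by (rule complement_projection[OF PN A B]) (use * in auto)
  define \<epsilon> where "\<epsilon> = (\<lambda>p x. \<alpha> p (block_pr \<chi> p x))"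
  have AN: "x \<in> block \<chi> p" if "x \<in> A p" for x p using psubD(3)[OF A that] by simp
  have BN: "x \<in> block \<chi> p" if "x \<in> B p" for x p using psubD(3)[OF B that] by simp
  have \<alpha>blk: "\<alpha> p x \<in> block \<chi> p" if "x \<in> block \<chi> p" for x p using AN[OF \<alpha>(2)] that by simp
  have "(\<lambda>p x. x) \<in> Hom ?N M" by (rule hom_sub_dom[OF hom_id[OF P] psub_block[OF \<chi>]])
  from hom_comp[OF hom_comp[OF block_pr_hom[OF \<chi>] \<alpha>(1)] this]
  have hom: "\<epsilon> \<in> Hom M M" by (simp add: \<epsilon>_def)
  have \<alpha>0: "\<alpha> p (zero_of M p) = zero_of M p" for p using homD(6)[OF \<alpha>(1), of p] by simp
  have "\<epsilon> \<in> E"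
  proof (rule max[OF hom])
    fix p x assume x: "x \<in> elts M p"
    note b = block_pr_in[OF \<chi> x]
    show "\<epsilon> p (\<epsilon> p x) = \<epsilon> p x"
      using block_pr_id[OF \<chi> \<alpha>blk[OF b]] \<alpha>(3)[OF \<alpha>(2)] b by (simp add: \<epsilon>_def)
    show "\<epsilon> p (f p x) = f p (\<epsilon> p x)" if f: "f \<in> E" for f
    proof (cases "f \<in> \<chi>")
      case True
      then show ?thesis
        using block_pr_comm[OF \<chi> f x] blockD(2)[OF b True] blockD(2)[OF \<alpha>blk[OF b] True] by (simp add: \<epsilon>_def)
    next
      case False
      then show ?thesis
        using blockD(3)[OF b f False] blockD(3)[OF \<alpha>blk[OF b] f False] \<alpha>0
        by (simp add: \<epsilon>_def block_pr_comm[OF \<chi> f x, symmetric])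
    qed
  qed
  have zA: "zero_of M p \<in> A p" and zB: "zero_of M p \<in> B p" for p
    using subspaceD(3)[OF psubD(1)[OF A], of p] subspaceD(3)[OF psubD(1)[OF B], of p] by simp_all
  show "(\<forall>p. A p = {zero_of ?N p}) \<or> (\<forall>p. B p = {zero_of ?N p})"
  proof (cases "\<epsilon> \<in> \<chi>")
    case True
    have "x = zero_of M p" if "x \<in> B p" for p x
      using blockD(2)[OF BN[OF that] True] block_pr_id[OF \<chi> BN[OF that]] \<alpha>(4)[OF that] by (simp add: \<epsilon>_def)
    then show ?thesis using zB by auto
  next
    case False
    have "x = zero_of M p" if "x \<in> A p" for p x
      using blockD(3)[OF AN[OF that] \<open>\<epsilon> \<in> E\<close> False] block_pr_id[OF \<chi> AN[OF that]] \<alpha>(3)[OF that]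
      by (simp add: \<epsilon>_def)
    then show ?thesis using zA by auto
  qed
qed

lemma inj_on_block: "inj_on block chars"
proof (rule inj_onI, rule ccontr)
  fix \<chi> \<chi>' assume *: "\<chi> \<in> chars" "\<chi>' \<in> chars" "block \<chi> = block \<chi>'" "\<chi> \<noteq> \<chi>'"
  obtain p x where x: "x \<in> block \<chi> p" "x \<noteq> zero_of M p" using *(1) by (rule charsE)
  show False using block_pr_id[OF *(1) x(1)] block_pr_other[OF *(1,2,4)] x *(3) by simp
qed

end

text \<open>
The blocks serve as their own indices; distinct eigenvalue systems have distinct blocks because these
are nonzero.
\<close>
theorem decomposition_into_indecomposables:
  fixes M :: "('p::order, 'k, 'v) pmod"
  assumes M: "pfd K M"
  obtains I :: "('p => 'v set) set" and N :: "('p => 'v set) => ('p, 'k, 'v) pmod" and pr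
  where "decomp M I N pr" "\<And>i. i \<in> I ==> indecomposable K (N i)"
proof -
  obtain E where E: "commuting_idempotents M E"
    and max: "\<And>e. e \<in> Hom M M ==> (\<And>p x. x \<in> elts M p ==> e p (e p x) = e p x) ==>
      (\<And>f p x. f \<in> E ==> x \<in> elts M p ==> e p (f p x) = f p (e p x)) ==> e \<in> E"
    using maximal_commuting_idempotents[of M] by metis
  let ?\<sigma> = "inv_into (chars M E) (block M E)"
  have \<sigma>: "bij_betw ?\<sigma> (block M E ` chars M E) (chars M E)"
    by (rule bij_betw_inv_into[OF inj_on_imp_bij_betw[OF inj_on_block[OF M E max]]])
  show thesis
  proof (rule that[OF decomp_reindex[OF decomp_blocks[OF M E max] \<sigma>]])
    fix i assume "i \<in> block M E ` chars M E"
    then show "indecomposable K (pmod_sub M (block M E (?\<sigma> i)))"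
      using indecomposable_block[OF M E max] bij_betwE[OF \<sigma>] by blast
  qed
qed


section \<open>Refinements\<close>

lemma inf_refinement_iff:
  fixes R :: "('p::order, 'k, 'w) pmod" and M :: "('p, 'k, 'v) pmod"
  assumes R: "pmodule K R" and M: "pmodule K M"
  shows "inf_refinement K R M \<longleftrightarrow>
    (\<exists>(I :: ('p => 'v set) set) (Ms :: ('p => 'v set) => ('p, 'k, 'v) pmod)
      (Ns :: ('p => 'v set) => ('p, 'k, 'w) pmod) pr qr.
      (\<forall>i\<in>I. indecomposable K (Ms i)) \<and> (\<forall>i\<in>I. subquotient K (Ns i) (Ms i)) \<and>
      decomp M I Ms pr \<and> decomp R I Ns qr)" (is "?L \<longleftrightarrow> ?R")
proof
  assume ?L
  then obtain I :: "('p => 'v set) set" and Ms :: "('p => 'v set) => ('p, 'k, 'v) pmod"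
    and Ns :: "('p => 'v set) => ('p, 'k, 'w) pmod"
    where ind: "\<And>i. i \<in> I ==> indecomposable K (Ms i)" and iM: "pmod_isomorphic K M (pmod_dsum I Ms)"
      and sq: "\<And>i. i \<in> I ==> subquotient K (Ns i) (Ms i)" and iR: "pmod_isomorphic K R (pmod_dsum I Ns)"
    unfolding inf_refinement_def by blast
  obtain pr where "decomp M I Ms pr"
    by (rule decomp_of_iso[OF M indecomposableD(1)[OF ind] iM])
  moreover obtain qr where "decomp R I Ns qr"
    by (rule decomp_of_iso[OF R _ iR]) (use sq in \<open>auto simp: subquotient_def\<close>)
  ultimately show ?R using ind sq by blast
next
  assume ?R
  then obtain I :: "('p => 'v set) set" and Ms :: "('p => 'v set) => ('p, 'k, 'v) pmod"
    and Ns :: "('p => 'v set) => ('p, 'k, 'w) pmod" and pr qr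
    where "\<forall>i\<in>I. indecomposable K (Ms i)" "\<forall>i\<in>I. subquotient K (Ns i) (Ms i)"
      and "decomp M I Ms pr" "decomp R I Ns qr" by blast
  then show ?L
    unfolding inf_refinement_def
    by (intro exI[of _ I] exI[of _ Ms] exI[of _ Ns] conjI iso_of_decomp)
qed

lemma inf_refinement_refl:
  fixes M :: "('p::order, 'k, 'v) pmod"
  assumes M: "pfd K M" shows "inf_refinement K M M"
proof -
  note P = pfdD(1)[OF M]
  show ?thesis
  proof (rule decomposition_into_indecomposables[OF M])
    fix I :: "('p => 'v set) set" and N :: "('p => 'v set) => ('p, 'k, 'v) pmod" and pr
    assume d: "decomp M I N pr" and ind: "\<And>i. i \<in> I ==> indecomposable K (N i)"
    have "subquotient K (N i) (N i)" if "i \<in> I" for i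
      using subquotient_of_iso[OF _ _ iso_refl] indecomposableD(1)[OF ind[OF that]] by blast
    then show ?thesis
      unfolding inf_refinement_iff[OF P P] using d ind
      by (intro exI[of _ I] exI[of _ N] exI[of _ pr]) simp
  qed
qed

text \<open>
The bijection \<open>\<sigma>\<close> of the Krull--Schmidt theorem matches the indecomposable summands \<open>S' j\<close>, of which \<open>R\<close>
contains subquotients, with the indecomposable summands \<open>L i k\<close> of the \<open>Ss i\<close>. Its first component \<open>c\<close>
labels the summands of \<open>R\<close> by the indices of the decomposition of \<open>T\<close>.
\<close>
lemma inf_refinement_trans:
  fixes R :: "('p::order, 'k, 'u) pmod" and S :: "('p, 'k, 'v) pmod" and T :: "('p, 'k, 'w) pmod"
  assumes R: "pmodule K R" and S: "pfd K S" and T: "pmodule K T"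
    and RS: "inf_refinement K R S" and ST: "inf_refinement K S T"
  shows "inf_refinement K R T"
proof -
  note PS = pfdD(1)[OF S]
  obtain I :: "('p => 'w set) set" and Ts :: "('p => 'w set) => ('p, 'k, 'w) pmod"
    and Ss :: "('p => 'w set) => ('p, 'k, 'v) pmod" and tr sr
    where T: "\<And>i. i \<in> I ==> indecomposable K (Ts i)" "\<And>i. i \<in> I ==> subquotient K (Ss i) (Ts i)"
      "decomp T I Ts tr" "decomp S I Ss sr"
    using ST unfolding inf_refinement_iff[OF PS T] by blast
  obtain J :: "('p => 'v set) set" and S' :: "('p => 'v set) => ('p, 'k, 'v) pmod"
    and Rs :: "('p => 'v set) => ('p, 'k, 'u) pmod" and s'r rr
    where R': "\<And>j. j \<in> J ==> indecomposable K (S' j)" "\<And>j. j \<in> J ==> subquotient K (Rs j) (S' j)"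
      "decomp S J S' s'r" "decomp R J Rs rr"
    using RS unfolding inf_refinement_iff[OF R PS] by blast
  have "\<forall>i\<in>I. \<exists>F. case F of (\<Theta> :: ('p => 'v set) set, L :: _ => ('p, 'k, 'v) pmod, q) =>
      decomp (Ss i) \<Theta> L q \<and> (\<forall>k\<in>\<Theta>. indecomposable K (L k))"
  proof
    fix i assume "i \<in> I"
    from pfd_summand[OF T(4) S this] obtain \<Theta> :: "('p => 'v set) set"
      and L :: "_ => ('p, 'k, 'v) pmod" and q
      where "decomp (Ss i) \<Theta> L q" "\<And>k. k \<in> \<Theta> ==> indecomposable K (L k)"
      using decomposition_into_indecomposables by blast
    then show "\<exists>F. case F of (\<Theta> :: ('p => 'v set) set, L :: _ => ('p, 'k, 'v) pmod, q) =>
      decomp (Ss i) \<Theta> L q \<and> (\<forall>k\<in>\<Theta>. indecomposable K (L k))"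
      by (intro exI[of _ "(\<Theta>, L, q)"]) simp
  qed
  from bchoice[OF this] obtain F where F: "\<forall>i\<in>I. case F i of (\<Theta> :: ('p => 'v set) set,
      L :: _ => ('p, 'k, 'v) pmod, q) => decomp (Ss i) \<Theta> L q \<and> (\<forall>k\<in>\<Theta>. indecomposable K (L k))"
    by (rule exE)
  \<comment> \<open>index set, summands and projections of a decomposition of \<open>Ss i\<close> into indecomposables\<close>
  define \<Theta> where "\<Theta> i = fst (F i)" for i
  define L where "L i = fst (snd (F i))" for i
  define q where "q i = snd (snd (F i))" for i
  have L: "decomp (Ss i) (\<Theta> i) (L i) (q i)" "k \<in> \<Theta> i ==> indecomposable K (L i k)" if "i \<in> I" for i k
    using F that by (auto simp: \<Theta>_def L_def q_def case_prod_unfold)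
  obtain \<sigma> where \<sigma>: "bij_betw \<sigma> J (Sigma I \<Theta>)"
    "\<And>j. j \<in> J ==> pmod_isomorphic K (S' j) (L (fst (\<sigma> j)) (snd (\<sigma> j)))"
    by (rule krull_schmidt[OF S R'(3) decomp_Sigma[OF T(4) L(1)] R'(1)]) (use L(2) in auto)
  define c where "c j = fst (\<sigma> j)" for j
  have \<sigma>mem: "\<sigma> j \<in> Sigma I \<Theta>" if "j \<in> J" for j using bij_betwE[OF \<sigma>(1)] that by blast
  have c: "c j \<in> I" if "j \<in> J" for j using \<sigma>mem[OF that] by (auto simp: c_def)
  let ?R = "\<lambda>i. pmod_sub R (part R J Rs rr c i)"
  obtain r' where r': "decomp R I ?R r'" by (rule decomp_group[OF R'(4) c])
  have sq: "subquotient K (?R i) (Ts i)" if i: "i \<in> I" for i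
  proof (rule subquotient_trans[OF indecomposableD(1)[OF T(1)[OF i]] _ T(2)[OF i]])
    let ?J = "{j\<in>J. c j = i}"
    have bij: "bij_betw (\<lambda>j. snd (\<sigma> j)) ?J (\<Theta> i)"
      unfolding bij_betw_def
    proof (intro conjI equalityI subsetI)
      show "inj_on (\<lambda>j. snd (\<sigma> j)) ?J"
        using bij_betw_imp_inj_on[OF \<sigma>(1)] by (auto simp: inj_on_def c_def prod_eq_iff)
      show "k \<in> \<Theta> i" if "k \<in> (\<lambda>j. snd (\<sigma> j)) ` ?J" for k using that \<sigma>mem by (fastforce simp: c_def)
      show "k \<in> (\<lambda>j. snd (\<sigma> j)) ` ?J" if "k \<in> \<Theta> i" for k
      proof -
        have "(i, k) \<in> \<sigma> ` J" using bij_betw_imp_surj_on[OF \<sigma>(1)] i that by blast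
        then obtain j where "j \<in> J" "\<sigma> j = (i, k)" by auto
        then show ?thesis by (intro image_eqI[of _ _ j]) (simp_all add: c_def)
      qed
    qed
    show "subquotient K (?R i) (Ss i)"
    proof (rule subquotient_sum[OF decomp_part[OF R'(4)] decomp_reindex[OF L(1)[OF i] bij]])
      fix j assume j: "j \<in> ?J"
      have Lj: "pmodule K (L i (snd (\<sigma> j)))"
        using decompD(2)[OF L(1)[OF i]] bij_betwE[OF bij] j by blast
      have "pmod_isomorphic K (S' j) (L i (snd (\<sigma> j)))" using \<sigma>(2)[of j] j by (auto simp: c_def)
      then have "pmod_isomorphic K (L i (snd (\<sigma> j))) (S' j)"
        using iso_sym indecomposableD(1)[OF R'(1)] j by blast
      then have "subquotient K (S' j) (L i (snd (\<sigma> j)))"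
        using subquotient_of_iso[OF Lj indecomposableD(1)[OF R'(1)]] j by blast
      then show "subquotient K (Rs j) (L i (snd (\<sigma> j)))"
        using subquotient_trans[OF Lj R'(2)] j by blast
    qed
  qed
  show ?thesis
    unfolding inf_refinement_iff[OF R decompD(1)[OF T(3)]]
    by (intro exI[of _ I] exI[of _ Ts] exI[of _ ?R] exI[of _ tr] exI[of _ r'] conjI ballI T(1,3) r' sq)
qed


section \<open>The pruning of a module\<close>

context
  fixes sh :: "real => 'p::order => 'p"
  assumes sh: "shifted_poset sh"
begin

lemma pfd_shift:
  assumes "pfd K N" shows "pfd K (pmod_shift sh \<epsilon> N)"
proof -
  have "sh \<epsilon> p \<le> sh \<epsilon> q" if "p \<le> q" for p q using shifted_poset.sh_mono[OF sh that] .
  then show ?thesis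
    using assms pmodD[OF pfdD(1)[OF assms]] by (simp add: pfd_def pmodule_def pmod_shift_def)
qed

lemma shift_map_linear:
  assumes "pmodule K M" "0 \<le> \<epsilon>"
  shows "linear_map K (Sp M p) (Sp M (sh (2 * \<epsilon>) p)) (pmod_shift_map sh M 0 (2 * \<epsilon>) p)"
  using pmodD(2)[OF assms(1) shifted_poset.sh_ge[OF sh], of "2 * \<epsilon>" p] assms(2) shifted_poset.sh_zero[OF sh]
  by (simp add: pmod_shift_map_def)

text \<open>
The largest submodule with the required property exists: it is the sum of all of them, since the
property is preserved by sums. At each point the sum is the span of the union.
\<close>
lemma psub_prune_sub:
  fixes M :: "('p, 'k, 'v) pmod"
  assumes M: "pmodule K M" and \<epsilon>: "0 \<le> \<epsilon>"
  shows "psubmodule K (prune_sub K sh \<epsilon> M) M"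
proof -
  note V = pmodD(1)[OF M]
  let ?g = "\<lambda>p. pmod_shift_map sh M 0 (2 * \<epsilon>) p"
  note g = shift_map_linear[OF M \<epsilon>]
  let ?P = "\<lambda>I. psubmodule K I M \<and> (\<forall>f \<in> Hom M (pmod_shift sh (2 * \<epsilon>) M). \<forall>p.
           f p ` I p \<subseteq> ?g p ` I p)"
  define U where "U p = (\<Union>I\<in>Collect ?P. I p)" for p
  define G where "G p = LinearCombinations.module.span K (Sp M p) (U p)" for p
  have U: "U p \<subseteq> elts M p" for p
  proof
    fix x assume "x \<in> U p"
    then obtain I where "psubmodule K I M" "x \<in> I p" unfolding U_def by blast
    then show "x \<in> elts M p" by (rule psubD(3))
  qed
  note Gsub = span_facts(1)[OF V U, folded G_def]
    and UG = span_facts(2)[OF V U, folded G_def]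
    and Gmin = span_facts(3)[OF V U, folded G_def]
  have "?P G"
  proof (intro conjI ballI allI)
    show "psubmodule K G M"
    proof (rule psubI[OF Gsub])
      fix p q x assume pq: "p \<le> q" and x: "x \<in> G p"
      have "U p \<subseteq> {x \<in> elts M p. Mp M p q x \<in> G q}"
      proof
        fix y assume y: "y \<in> U p"
        then obtain I where I: "?P I" "y \<in> I p" by (auto simp: U_def)
        then have "Mp M p q y \<in> U q" using psubD(2)[of I M p q y] pq by (auto simp: U_def)
        then show "y \<in> {x \<in> elts M p. Mp M p q x \<in> G q}" using U y UG by blast
      qed
      from Gmin[OF subspace_preimage[OF pmodD(2)[OF M pq] Gsub] this] x
      show "Mp M p q x \<in> G q" by blast
    qed
    fix f p assume f: "f \<in> Hom M (pmod_shift sh (2 * \<epsilon>) M)"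
    have fl: "linear_map K (Sp M p) (Sp M (sh (2 * \<epsilon>) p)) (f p)"
      using homD(1)[OF f, of p] by (simp add: pmod_shift_def)
    have "U p \<subseteq> {x \<in> elts M p. f p x \<in> ?g p ` G p}"
    proof
      fix y assume y: "y \<in> U p"
      then obtain I where I: "?P I" "y \<in> I p" by (auto simp: U_def)
      then have "f p y \<in> ?g p ` I p" using f by blast
      moreover have "I p \<subseteq> U p" using I(1) by (auto simp: U_def)
      ultimately show "y \<in> {x \<in> elts M p. f p x \<in> ?g p ` G p}" using U y UG by blast
    qed
    from Gmin[OF subspace_preimage[OF fl subspace_image[OF g Gsub]] this]
    show "f p ` G p \<subseteq> ?g p ` G p" by blast
  qed
  moreover have "I \<le> G" if "?P I" for I
    using that UG by (auto simp: le_fun_def U_def)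
  ultimately have "prune_sub K sh \<epsilon> M = G"
    unfolding prune_sub_def by (rule Greatest_equality)
  then show ?thesis using \<open>?P G\<close> by blast
qed

text \<open>
The smallest submodule with the required property exists: it is the intersection of all of them. If
\<open>x\<close> is mapped into the image under \<open>f\<close> of the intersection, it is mapped into the image of each of the
submodules, and so it lies in each of them.
\<close>
lemma psub_prune_ker:
  fixes M :: "('p, 'k, 'v) pmod"
  assumes M: "pmodule K M" and \<epsilon>: "0 \<le> \<epsilon>"
  shows "psubmodule K (prune_ker K sh \<epsilon> M) (pmod_sub M (prune_sub K sh \<epsilon> M))"
proof -
  let ?I = "prune_sub K sh \<epsilon> M"
  let ?N = "pmod_sub M ?I"
  let ?g = "\<lambda>p. pmod_shift_map sh M 0 (2 * \<epsilon>) p"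
  have N: "pmodule K ?N" by (rule pmodule_sub[OF M psub_prune_sub[OF M \<epsilon>]])
  let ?P = "\<lambda>L. psubmodule K L ?N \<and> (\<forall>f \<in> Hom M (pmod_shift sh (2 * \<epsilon>) M). \<forall>p.
           {x \<in> ?I p. ?g p x \<in> f p ` L p} \<subseteq> L p)"
  define L where "L = (\<lambda>p. {x \<in> elts ?N p. \<forall>L'\<in>Collect ?P. x \<in> L' p})"
  have "?P L"
  proof (intro conjI ballI allI)
    show "psubmodule K L ?N" unfolding L_def by (rule psub_Inter[OF N]) blast
    fix f p assume f: "f \<in> Hom M (pmod_shift sh (2 * \<epsilon>) M)"
    show "{x \<in> ?I p. ?g p x \<in> f p ` L p} \<subseteq> L p"
    proof
      fix x assume x: "x \<in> {x \<in> ?I p. ?g p x \<in> f p ` L p}"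
      have "x \<in> L' p" if L': "?P L'" for L'
      proof -
        have "L p \<subseteq> L' p" using L' by (auto simp: L_def)
        then have "x \<in> {x \<in> ?I p. ?g p x \<in> f p ` L' p}" using x by blast
        then show ?thesis using L' f by blast
      qed
      then show "x \<in> L p" using x by (simp add: L_def)
    qed
  qed
  moreover have "L \<le> L'" if "?P L'" for L' using that by (auto simp: le_fun_def L_def)
  ultimately have "prune_ker K sh \<epsilon> M = L"
    unfolding prune_ker_def Let_def by (rule Least_equality)
  then show ?thesis using \<open>?P L\<close> by blast
qed

lemma pfd_Pru:
  assumes "pfd K M" "0 \<le> \<epsilon>" shows "pfd K (Pru K sh \<epsilon> M)"
  unfolding Pru_def
  using pfd_shift[OF pfd_quot[OF pfd_sub[OF assms(1) psub_prune_sub] psub_prune_ker]] pfdD(1)[OF assms(1)] assms(2)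
  by blast

end

end

lemma pruning_dist_le:
  assumes "0 \<le> \<epsilon>"
    and "\<And>\<delta>. 0 \<le> \<delta> ==> inf_refinement K (Pru K sh (\<epsilon> + \<delta>) M) (Pru K sh \<delta> N)"
    and "\<And>\<delta>. 0 \<le> \<delta> ==> inf_refinement K (Pru K sh (\<epsilon> + \<delta>) N) (Pru K sh \<delta> M)"
  shows "pruning_dist K sh M N \<le> ennreal \<epsilon>"
  unfolding pruning_dist_def using assms by (intro INF_lower) simp

text \<open>
Both infima may be infinite; otherwise approximate each of them up to \<open>e / 2\<close>.
\<close>
lemma INF_plus_INF_greatest:
  fixes f g :: "real => ennreal"
  assumes "\<And>a b. a \<in> A ==> b \<in> B ==> d \<le> f a + g b"
  shows "d \<le> (INF a\<in>A. f a) + (INF b\<in>B. g b)"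
proof (rule ennreal_le_epsilon)
  let ?F = "INF a\<in>A. f a" and ?G = "INF b\<in>B. g b"
  fix e :: real assume fin: "?F + ?G < Orderings.top" and e: "0 < e"
  have less: "x < x + ennreal (e / 2)" if "x < Orderings.top" for x
    using that e ennreal_add_left_cancel_less[of x 0 "ennreal (e / 2)"] by (auto simp: less_top)
  have "?F < Orderings.top" "?G < Orderings.top" using fin by (simp_all only: ennreal_add_less_top)
  from this[THEN less] have "?F < ?F + ennreal (e / 2)" "?G < ?G + ennreal (e / 2)" .
  then obtain a b where "a \<in> A" "f a < ?F + ennreal (e / 2)" "b \<in> B" "g b < ?G + ennreal (e / 2)"
    unfolding INF_less_iff by blast
  then have "d \<le> (?F + ennreal (e / 2)) + (?G + ennreal (e / 2))"
    using assms[of a b] add_mono[of "f a" _ "g b"] by (meson less_imp_le order_trans)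
  also have "\<dots> = ?F + ?G + (ennreal (e / 2) + ennreal (e / 2))" by (simp only: ac_simps)
  also have "ennreal (e / 2) + ennreal (e / 2) = ennreal e" using e by (simp flip: ennreal_plus)
  finally show "d \<le> ?F + ?G + ennreal e" .
qed

theorem proposition4p19:
  fixes K :: "('k, 'e) ring_scheme"
    and sh :: "real \<Rightarrow> 'p::order \<Rightarrow> 'p"
    and M :: "('p, 'k, 'a) pmod"
    and N :: "('p, 'k, 'b) pmod"
    and Q :: "('p, 'k, 'c) pmod"
  assumes "field K" and "shifted_poset sh"
    and "pfd K M" and "pfd K N" and "pfd K Q"
  shows "pruning_dist K sh M M = 0 \<and>
         pruning_dist K sh M N = pruning_dist K sh N M \<and>
         pruning_dist K sh M Q \<le> pruning_dist K sh M N + pruning_dist K sh N Q"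
proof (intro conjI)
  interpret over_field K by (rule over_field.intro) (rule assms(1))
  note pruM = pfd_Pru[OF assms(2,3)] and pruN = pfd_Pru[OF assms(2,4)] and pruQ = pfd_Pru[OF assms(2,5)]
  have "pruning_dist K sh M M \<le> ennreal 0"
    by (rule pruning_dist_le) (simp_all add: inf_refinement_refl[OF pruM])
  then show "pruning_dist K sh M M = 0" by simp
  show "pruning_dist K sh M N = pruning_dist K sh N M"
    unfolding pruning_dist_def by (simp only: conj_commute)
  show "pruning_dist K sh M Q \<le> pruning_dist K sh M N + pruning_dist K sh N Q"
    unfolding pruning_dist_def[of K sh M N] pruning_dist_def[of K sh N Q]
  proof (rule INF_plus_INF_greatest)
    fix a b :: real
    assume "a \<in> {\<epsilon>. 0 \<le> \<epsilon> \<and> (\<forall>\<delta>\<ge>0. inf_refinement K (Pru K sh (\<epsilon> + \<delta>) M) (Pru K sh \<delta> N) \<and>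
        inf_refinement K (Pru K sh (\<epsilon> + \<delta>) N) (Pru K sh \<delta> M))}"
    then have a: "0 \<le> a" "\<And>\<delta>. 0 \<le> \<delta> \<Longrightarrow> inf_refinement K (Pru K sh (a + \<delta>) M) (Pru K sh \<delta> N)"
      "\<And>\<delta>. 0 \<le> \<delta> \<Longrightarrow> inf_refinement K (Pru K sh (a + \<delta>) N) (Pru K sh \<delta> M)" by auto
    assume "b \<in> {\<epsilon>. 0 \<le> \<epsilon> \<and> (\<forall>\<delta>\<ge>0. inf_refinement K (Pru K sh (\<epsilon> + \<delta>) N) (Pru K sh \<delta> Q) \<and>
        inf_refinement K (Pru K sh (\<epsilon> + \<delta>) Q) (Pru K sh \<delta> N))}"
    then have b: "0 \<le> b" "\<And>\<delta>. 0 \<le> \<delta> \<Longrightarrow> inf_refinement K (Pru K sh (b + \<delta>) N) (Pru K sh \<delta> Q)"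
      "\<And>\<delta>. 0 \<le> \<delta> \<Longrightarrow> inf_refinement K (Pru K sh (b + \<delta>) Q) (Pru K sh \<delta> N)" by auto
    have "pruning_dist K sh M Q \<le> ennreal (a + b)"
    proof (rule pruning_dist_le)
      show "0 \<le> a + b" using a(1) b(1) by simp
      fix \<delta> :: real assume \<delta>: "0 \<le> \<delta>"
      have nn: "0 \<le> b + \<delta>" "0 \<le> a + \<delta>" "0 \<le> a + (b + \<delta>)" "0 \<le> b + (a + \<delta>)"
        using a(1) b(1) \<delta> by simp_all
      have eq: "a + b + \<delta> = a + (b + \<delta>)" "a + b + \<delta> = b + (a + \<delta>)" by simp_all
      show "inf_refinement K (Pru K sh (a + b + \<delta>) M) (Pru K sh \<delta> Q)"
        unfolding eq(1)
        by (rule inf_refinement_trans[OF pfdD(1)[OF pruM[OF nn(3)]] pruN[OF nn(1)] pfdD(1)[OF pruQ[OF \<delta>]]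
            a(2)[OF nn(1)] b(2)[OF \<delta>]])
      show "inf_refinement K (Pru K sh (a + b + \<delta>) Q) (Pru K sh \<delta> M)"
        unfolding eq(2)
        by (rule inf_refinement_trans[OF pfdD(1)[OF pruQ[OF nn(4)]] pruN[OF nn(2)] pfdD(1)[OF pruM[OF \<delta>]]
            b(3)[OF nn(2)] a(3)[OF \<delta>]])
    qed
    then show "pruning_dist K sh M Q \<le> ennreal a + ennreal b"
      using a(1) b(1) by (simp add: ennreal_plus)
  qed
qed

end
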